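(* Let $\Lambda\subset\mathbb{R}^{2d}$ be a quasicrystal with hull $\Omega_\Lambda$. Then there exist functions $g_1,\dots,g_N$ such that for every $T\in\Omega_\Lambda$ the system $\mathcal{G}(g_1,\dots,g_N,T)=\{\pi(z)g_i : i=1,\dots,N,\ z\in T\}$ is a multiwindow Gabor frame for $L^2(\mathbb{R}^d)$ and an $M^p$-frame for all $1\le p\le\infty$.
   Context: Quasicrystals. A discrete set $\Lambda\subset\mathbb{R}^{2d}$ is uniformly discrete if there is $r>0$ with $(\Lambda-\Lambda)\cap B_r(0)=\{0\}$; it is relatively dense if its hole $\rho(\Lambda)=\sup_{z\in\mathbb{R}^{2d}}\inf_{\lambda\in\Lambda}|z-\lambda|$ is finite; it is a Delone set if both hold. The $r$-patches of a Delone set $\Lambda$ are the sets $B_r(z)\cap\Lambda$, $z\in\Lambda$. $\Lambda$ has finite local complexity (FLC) if for each fixed $r$ there are only finitely many $r$-patches up to translation. For an $r$-patch $P$ and $A\subset\mathbb{R}^{2d}$ let $L_P(A)$ be the number of translates $P-z$ that are $r$-patches of $\Lambda$ contained in $A$; the patch frequency of $P$ is $\lim_{k\to\infty}L_P(B_{r_k}-z)/\mathrm{vol}(B_{r_k})$ for balls with radius $r_k\to\infty$, if this limit exists uniformly in $z$ and independently of the choice of balls. $\Lambda$ has uniform cluster frequencies (UCF) if all patch frequencies exist. A quasicrystal is a Delone set with FLC and UCF. Hull. For Delone sets $\Lambda,\Lambda'$ put $R(\Lambda,\Lambda')=\sup\{r : \exists z\in\mathbb{R}^{2d},\ \|z\|<1/r,\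 B_r(0)\cap(\Lambda-z)=\Lambda'\cap B_r(0)\}$ and $d(\Lambda,\Lambda')=\min\{1,1/R(\Lambda,\Lambda')\}$. The hull $\Omega_\Lambda$ is the closure of $\{\Lambda-z: z\in\mathbb{R}^{2d}\}$ in the metric $d$ on the space of Delone sets. Standing convention: the translation action of $\mathbb{R}^{2d}$ on the hull of a quasicrystal is minimal and uniquely ergodic. Time-frequency analysis. For $z=(x,\omega)\in\mathbb{R}^{d}\times\mathbb{R}^d$, $\pi(z)f(t)=e^{2\pi i\omega\cdot t}f(t-x)$. $V_gf(x,\omega)=\int_{\mathbb{R}^d} f(t)\overline{g(t-x)}e^{-2\pi i t\cdot\omega}\,dt=\langle f,\pi(x,\omega)g\rangle$. For a fixed nonzero Schwartz function $\phi$ and $1\le p\le\infty$, $M^p(\mathbb{R}^d)=\{f\in\mathcal{S}'(\mathbb{R}^d): V_\phi f\in L^p(\mathbb{R}^{2d})\}$ with $\|f\|_{M^p}=\|V_\phi f\|_p$ (different $\phi$ give equivalent norms). The system $\mathcal{G}(g_1,\dots,g_N,T)$ is a multiwindow Gabor frame for $L^2(\mathbb{R}^d)$ if there are $A,B>0$ with $A\|f\|^2\le\sum_{i}\sum_{z\in T}|\langle f,\pi(z)g_i\rangle|^2\le B\|f\|^2$ for all $f\in L^2(\mathbb{R}^d)$. It is called an $M^p$-frame if $g_1,\dots,g_N\in M^1(\mathbb{R}^d)$ and the analysis operator $f\mapsto(\langle f,\pi(z)g_i\rangle)_{i,z}$, which is bounded from $M^p(\mathbb{R}^d)$ to $\ell^p$,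 is bounded below on $M^p(\mathbb{R}^d)$. *)

theory Defs
  imports "HOL-Probability.Probability"
begin

section \<open>Quasicrystals\<close>

text \<open>Balls are open throughout.  \<open>translate_by z A\<close> is the set \<open>A - z\<close>.\<close>

definition translate_by :: "'a::euclidean_space \<Rightarrow> 'a set \<Rightarrow> 'a set" where
  "translate_by z A = (\<lambda>x. x - z) ` A"

definition uniformly_discrete :: "'a::euclidean_space set \<Rightarrow> bool" where
  "uniformly_discrete \<Lambda> \<longleftrightarrow>
     (\<exists>r>0. {x - y | x y. x \<in> \<Lambda> \<and> y \<in> \<Lambda>} \<inter> ball 0 r = {0})"

definition hole :: "'a::euclidean_space set \<Rightarrow> ennreal" where
  "hole \<Lambda> = (SUP z. INF x\<in>\<Lambda>. ennreal (norm (z - x)))"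

definition relatively_dense :: "'a::euclidean_space set \<Rightarrow> bool" where
  "relatively_dense \<Lambda> \<longleftrightarrow> hole \<Lambda> < \<infinity>"

definition delone :: "'a::euclidean_space set \<Rightarrow> bool" where
  "delone \<Lambda> \<longleftrightarrow> uniformly_discrete \<Lambda> \<and> relatively_dense \<Lambda>"

definition patches :: "real \<Rightarrow> 'a::euclidean_space set \<Rightarrow> 'a set set" where
  "patches r \<Lambda> = {ball z r \<inter> \<Lambda> | z. z \<in> \<Lambda>}"

definition translation_equiv :: "('a::euclidean_space set \<times> 'a set) set" where
  "translation_equiv = {(P, Q). \<exists>z. Q = translate_by z P}"

definition finite_local_complexity :: "'a::euclidean_space set \<Rightarrow> bool" where
  "finite_local_complexity \<Lambda> \<longleftrightarrow> (\<forall>r>0. finite (patches r \<Lambda> // translation_equiv))"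

definition patch_count :: "'a::euclidean_space set \<Rightarrow> real \<Rightarrow> 'a set \<Rightarrow> 'a set \<Rightarrow> nat" where
  "patch_count \<Lambda> r P A =
     card {Q. (\<exists>z. Q = translate_by z P) \<and> Q \<in> patches r \<Lambda> \<and> Q \<subseteq> A}"

text \<open>The frequency has to exist along every sequence of balls whose radii tend to infinity,
  uniformly in the translation \<open>z\<close>, with a limit that does not depend on the sequence.\<close>

definition has_patch_frequency ::
    "'a::euclidean_space set \<Rightarrow> real \<Rightarrow> 'a set \<Rightarrow> real \<Rightarrow> bool" where
  "has_patch_frequency \<Lambda> r P \<nu> \<longleftrightarrow>
     (\<forall>c \<rho>. filterlim \<rho> at_top sequentially \<longrightarrow>
        uniform_limit UNIV
          (\<lambda>k z. real (patch_count \<Lambda> r P (translate_by z (ball (c k) (\<rho> k))))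
                   / measure lborel (ball (c k) (\<rho> k)))
          (\<lambda>_. \<nu>) sequentially)"

definition uniform_cluster_frequencies :: "'a::euclidean_space set \<Rightarrow> bool" where
  "uniform_cluster_frequencies \<Lambda> \<longleftrightarrow>
     (\<forall>r>0. \<forall>P\<in>patches r \<Lambda>. \<exists>\<nu>. has_patch_frequency \<Lambda> r P \<nu>)"

definition quasicrystal :: "'a::euclidean_space set \<Rightarrow> bool" where
  "quasicrystal \<Lambda> \<longleftrightarrow>
     delone \<Lambda> \<and> finite_local_complexity \<Lambda> \<and> uniform_cluster_frequencies \<Lambda>"


section \<open>The hull and its translation action\<close>

text \<open>In \<open>ennreal\<close> the supremum of the empty set is \<open>0\<close>, \<open>1 / 0 = \<infinity>\<close> and \<open>1 / \<infinity> = 0\<close>,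
  so the distance is \<open>1\<close> if no radius is admissible and \<open>0\<close> if all are.\<close>

definition agreement_radius :: "'a::euclidean_space set \<Rightarrow> 'a set \<Rightarrow> ennreal" where
  "agreement_radius \<Lambda> \<Lambda>' =
     (SUP r\<in>{r::real. r > 0 \<and>
               (\<exists>z. norm z < 1 / r \<and> ball 0 r \<inter> translate_by z \<Lambda> = \<Lambda>' \<inter> ball 0 r)}.
        ennreal r)"

definition delone_dist :: "'a::euclidean_space set \<Rightarrow> 'a set \<Rightarrow> ennreal" where
  "delone_dist \<Lambda> \<Lambda>' = min 1 (1 / agreement_radius \<Lambda> \<Lambda>')"

text \<open>The formula for \<open>delone_dist\<close> is symmetric, and satisfies the triangle inequality, only up to
  a slight change of the radius.  The closure and the open sets are therefore expressed directly by
  \<open>delone_dist\<close>-balls.\<close>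

definition delone_hull :: "'a::euclidean_space set \<Rightarrow> 'a set set" where
  "delone_hull \<Lambda> =
     {T. delone T \<and> (\<forall>\<epsilon>>0. \<exists>z. delone_dist (translate_by z \<Lambda>) T < \<epsilon>)}"

definition hull_open :: "'a::euclidean_space set \<Rightarrow> 'a set set \<Rightarrow> bool" where
  "hull_open \<Lambda> U \<longleftrightarrow> U \<subseteq> delone_hull \<Lambda> \<and>
     (\<forall>T\<in>U. \<exists>\<epsilon>>0. \<forall>S\<in>delone_hull \<Lambda>. delone_dist T S < \<epsilon> \<longrightarrow> S \<in> U)"

definition hull_borel :: "'a::euclidean_space set \<Rightarrow> 'a set measure" where
  "hull_borel \<Lambda> = sigma (delone_hull \<Lambda>) {U. hull_open \<Lambda> U}"

definition minimal_hull :: "'a::euclidean_space set \<Rightarrow> bool" where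
  "minimal_hull \<Lambda> \<longleftrightarrow>
     (\<forall>T\<in>delone_hull \<Lambda>. \<forall>S\<in>delone_hull \<Lambda>. \<forall>\<epsilon>>0. \<exists>z. delone_dist (translate_by z T) S < \<epsilon>)"

definition uniquely_ergodic_hull :: "'a::euclidean_space set \<Rightarrow> bool" where
  "uniquely_ergodic_hull \<Lambda> \<longleftrightarrow>
     (\<exists>!M. prob_space M \<and> sets M = sets (hull_borel \<Lambda>) \<and>
           (\<forall>z. distr M M (translate_by z) = M))"


section \<open>Lebesgue spaces\<close>

text \<open>The case \<open>M = count_space I\<close> gives the sequence spaces over \<open>I\<close>.\<close>

definition Lp_norm :: "ennreal \<Rightarrow> 'a measure \<Rightarrow> ('a \<Rightarrow> complex) \<Rightarrow> ennreal" where
  "Lp_norm p M F =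
     (if p = \<infinity> then esssup M (\<lambda>x. ennreal (norm (F x)))
      else let I = (\<integral>\<^sup>+ x. ennreal (norm (F x) powr enn2real p) \<partial>M)
           in if I = \<infinity> then \<infinity> else ennreal (enn2real I powr (1 / enn2real p)))"

definition Lp_space :: "ennreal \<Rightarrow> 'a measure \<Rightarrow> ('a \<Rightarrow> complex) set" where
  "Lp_space p M = {F \<in> borel_measurable M. Lp_norm p M F < \<infinity>}"


section \<open>Schwartz functions and tempered distributions\<close>

text \<open>Iterated partial derivatives along a list of coordinate directions (elements of \<open>Basis\<close>).\<close>

primrec iter_partial ::
    "'a::euclidean_space list \<Rightarrow> ('a \<Rightarrow> complex) \<Rightarrow> 'a \<Rightarrow> complex" where
  "iter_partial [] f = f"
| "iter_partial (b # bs) f = (\<lambda>x. frechet_derivative (iter_partial bs f) (at x) b)"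

definition schwartz :: "('a::euclidean_space \<Rightarrow> complex) \<Rightarrow> bool" where
  "schwartz f \<longleftrightarrow>
     (\<forall>bs. set bs \<subseteq> Basis \<longrightarrow>
        (\<forall>x. iter_partial bs f differentiable (at x)) \<and>
        (\<forall>k. bounded (range (\<lambda>x. (1 + norm x) ^ k *\<^sub>R iter_partial bs f x))))"

definition schwartz_seminorm ::
    "nat \<Rightarrow> 'a::euclidean_space list \<Rightarrow> ('a \<Rightarrow> complex) \<Rightarrow> real" where
  "schwartz_seminorm k bs f = (SUP x. (1 + norm x) ^ k * norm (iter_partial bs f x))"

text \<open>Linear functionals that are continuous for the topology of the Schwartz seminorms.  Only the
  values on Schwartz functions are relevant.\<close>

definition tempered_distribution ::
    "(('a::euclidean_space \<Rightarrow> complex) \<Rightarrow> complex) \<Rightarrow> bool" where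
  "tempered_distribution u \<longleftrightarrow>
     (\<forall>f g. schwartz f \<longrightarrow> schwartz g \<longrightarrow> u (\<lambda>t. f t + g t) = u f + u g) \<and>
     (\<forall>c f. schwartz f \<longrightarrow> u (\<lambda>t. c * f t) = c * u f) \<and>
     (\<exists>C k m. \<forall>f. schwartz f \<longrightarrow>
        norm (u f) \<le> C * (\<Sum>bs | set bs \<subseteq> Basis \<and> length bs \<le> m. schwartz_seminorm k bs f))"

definition fun_distribution ::
    "('a::euclidean_space \<Rightarrow> complex) \<Rightarrow> ('a \<Rightarrow> complex) \<Rightarrow> complex" where
  "fun_distribution g = (\<lambda>f. LINT t|lborel. g t * f t)"


section \<open>Modulation spaces and Gabor frames\<close>

definition tf_shift ::
    "'a \<times> 'a \<Rightarrow> ('a::euclidean_space \<Rightarrow> complex) \<Rightarrow> 'a \<Rightarrow> complex" where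
  "tf_shift z f = (\<lambda>t. cis (2 * pi * (snd z \<bullet> t)) * f (t - fst z))"

text \<open>\<open>V\<^sub>\<phi> u (z) = \<langle>u, \<pi>(z) \<phi>\<rangle>\<close>.  Distributions are linear and the bracket is conjugate linear in its
  second argument, so \<open>u\<close> is evaluated at the conjugate of \<open>\<pi>(z) \<phi>\<close>; for \<open>u = fun_distribution f\<close>
  this is the integral formula for the short-time Fourier transform of \<open>f\<close>.\<close>

definition stft ::
    "('a::euclidean_space \<Rightarrow> complex) \<Rightarrow> (('a \<Rightarrow> complex) \<Rightarrow> complex) \<Rightarrow> 'a \<times> 'a \<Rightarrow> complex" where
  "stft \<phi> u = (\<lambda>z. u (\<lambda>t. cnj (tf_shift z \<phi> t)))"

definition modulation_norm ::
    "('a::euclidean_space \<Rightarrow> complex) \<Rightarrow> ennreal \<Rightarrow> (('a \<Rightarrow> complex) \<Rightarrow> complex) \<Rightarrow> ennreal" where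
  "modulation_norm \<phi> p u = Lp_norm p lborel (stft \<phi> u)"

definition modulation_space ::
    "('a::euclidean_space \<Rightarrow> complex) \<Rightarrow> ennreal \<Rightarrow> (('a \<Rightarrow> complex) \<Rightarrow> complex) set" where
  "modulation_space \<phi> p = {u. tempered_distribution u \<and> stft \<phi> u \<in> Lp_space p lborel}"

text \<open>\<open>M\<^sup>1\<close> as a space of functions, using that \<open>M\<^sup>1\<close> is contained in \<open>L\<^sup>2\<close>.\<close>

definition M1_function ::
    "('a::euclidean_space \<Rightarrow> complex) \<Rightarrow> ('a \<Rightarrow> complex) \<Rightarrow> bool" where
  "M1_function \<phi> g \<longleftrightarrow>
     g \<in> Lp_space 2 lborel \<and> fun_distribution g \<in> modulation_space \<phi> 1"

definition L2_inner ::
    "('a::euclidean_space \<Rightarrow> complex) \<Rightarrow> ('a \<Rightarrow> complex) \<Rightarrow> complex" where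
  "L2_inner f g = (LINT t|lborel. f t * cnj (g t))"

text \<open>The duality bracket \<open>\<langle>u, g\<rangle>\<close> of \<open>u \<in> M\<^sup>p\<close> and \<open>g \<in> M\<^sup>1\<close>.  A window \<open>g \<in> M\<^sup>1\<close> need not be a
  Schwartz function, so \<open>u\<close> cannot be applied to it directly; the bracket is the usual extension
  based on the orthogonality relation
  \<open>\<langle>V\<^sub>\<phi> f, V\<^sub>\<phi> g\<rangle> = \<parallel>\<phi>\<parallel>\<^sup>2 \<langle>f, g\<rangle>\<close>.  It does not depend on \<open>\<phi>\<close>, and it agrees with \<open>L2_inner\<close> if \<open>u\<close>
  is given by an \<open>L\<^sup>2\<close> function.\<close>

definition modulation_pairing ::
    "('a::euclidean_space \<Rightarrow> complex) \<Rightarrow> (('a \<Rightarrow> complex) \<Rightarrow> complex) \<Rightarrow> ('a \<Rightarrow> complex) \<Rightarrow> complex"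
  where
  "modulation_pairing \<phi> u g =
     (LINT w|lborel. stft \<phi> u w * cnj (stft \<phi> (fun_distribution g) w)) / L2_inner \<phi> \<phi>"

definition multiwindow_gabor_frame ::
    "nat \<Rightarrow> (nat \<Rightarrow> 'a::euclidean_space \<Rightarrow> complex) \<Rightarrow> ('a \<times> 'a) set \<Rightarrow> bool" where
  "multiwindow_gabor_frame N g T \<longleftrightarrow>
     (\<forall>i\<in>{1..N}. g i \<in> Lp_space 2 lborel) \<and>
     (\<exists>A>0. \<exists>B>0. \<forall>f\<in>Lp_space 2 lborel.
        ennreal A * (Lp_norm 2 lborel f)\<^sup>2
          \<le> (\<Sum>i=1..N. \<Sum>\<^sub>\<infinity>z\<in>T. ennreal ((norm (L2_inner f (tf_shift z (g i))))\<^sup>2)) \<and>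
        (\<Sum>i=1..N. \<Sum>\<^sub>\<infinity>z\<in>T. ennreal ((norm (L2_inner f (tf_shift z (g i))))\<^sup>2))
          \<le> ennreal B * (Lp_norm 2 lborel f)\<^sup>2)"

definition analysis_coeffs ::
    "('a::euclidean_space \<Rightarrow> complex) \<Rightarrow> (nat \<Rightarrow> 'a \<Rightarrow> complex) \<Rightarrow>
     (('a \<Rightarrow> complex) \<Rightarrow> complex) \<Rightarrow> nat \<times> ('a \<times> 'a) \<Rightarrow> complex" where
  "analysis_coeffs \<phi> g u = (\<lambda>(i, z). modulation_pairing \<phi> u (tf_shift z (g i)))"

text \<open>The upper bound says that the analysis operator is bounded from \<open>M\<^sup>p\<close> to the sequence space;
  for uniformly discrete \<open>T\<close> it is a consequence of \<open>g i\<close> being in \<open>M\<^sup>1\<close>.\<close>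

definition Mp_frame ::
    "('a::euclidean_space \<Rightarrow> complex) \<Rightarrow> ennreal \<Rightarrow> nat \<Rightarrow> (nat \<Rightarrow> 'a \<Rightarrow> complex) \<Rightarrow>
     ('a \<times> 'a) set \<Rightarrow> bool" where
  "Mp_frame \<phi> p N g T \<longleftrightarrow>
     (\<forall>i\<in>{1..N}. M1_function \<phi> (g i)) \<and>
     (\<exists>A>0. \<exists>B>0. \<forall>u\<in>modulation_space \<phi> p.
        ennreal A * modulation_norm \<phi> p u
          \<le> Lp_norm p (count_space ({1..N} \<times> T)) (analysis_coeffs \<phi> g u) \<and>
        Lp_norm p (count_space ({1..N} \<times> T)) (analysis_coeffs \<phi> g u)
          \<le> ennreal B * modulation_norm \<phi> p u)"

end

theory Submission
  imports Defs
begin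

text \<open>The windows are time-frequency shifts \<open>\<pi>(w\<^sub>i) \<phi>\<close> of \<open>\<phi>\<close> along a finite \<open>\<delta>\<close>-net \<open>w\<^sub>i\<close> of a ball whose
  radius is a covering radius shared by all \<open>T\<close> in the hull.  Up to a phase,
  \<open>\<langle>u, \<pi>(z) \<pi>(w\<^sub>i) \<phi>\<rangle> = V\<^sub>\<phi> u (z + w\<^sub>i)\<close>, so the coefficients are samples of \<open>F = V\<^sub>\<phi> u\<close> on a
  \<open>\<delta>\<close>-dense set.  The reproducing formula \<open>\<parallel>\<phi>\<parallel>\<^sup>2 F = F * V\<^sub>\<phi> \<phi>\<close> (twisted convolution) bounds the oscillation of
  \<open>\<bar>F\<bar>\<close> on \<open>\<delta>\<close>-balls by \<open>\<bar>F\<bar> * H\<close> with \<open>\<parallel>H\<parallel>\<^sub>1 \<le> 1/4\<close> for small \<open>\<delta>\<close>; this error is absorbed in \<open>L\<^sup>p\<close> for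
  all \<open>p\<close> simultaneously, which gives the \<open>M\<^sup>p\<close> bounds.  The case \<open>p = 2\<close> together with Moyal's identity
  \<open>\<parallel>V\<^sub>\<phi> f\<parallel>\<^sub>2 = \<parallel>\<phi>\<parallel>\<^sub>2 \<parallel>f\<parallel>\<^sub>2\<close> gives the frame property.\<close>

section \<open>Decay weights and Schwartz functions\<close>

text \<open>The case p = \<infinity> shapes the proof. Schwartz functions are not dense in
  M^\<infinity>, so the reproducing formula cannot be extended by density; it is proved for every
  tempered \<open>u\<close> at once, by moving \<open>u\<close> inside an integral over phase space.
  Riemann sums of that integral converge in each Schwartz seminorm, because the derivatives of a
  time-frequency shift grow only polynomially in the shift, while the coefficients (the transform of
  one Schwartz function by another) decay faster than any power. Absorbing the error subtracts a
  multiple of the norm of \<open>F\<close> from both sides. This is legitimate because that norm is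
  finite: by membership in M^p, and for the frame property by Moyal's identity. The windows are
  common to the hull, but the frame bounds may vary with \<open>T\<close>: the separation that
  controls the upper bound is taken from each \<open>T\<close> itself.\<close>

definition decay :: "nat \<Rightarrow> 'a::real_normed_vector \<Rightarrow> real" where
  "decay k t = 1 / (1 + norm t) ^ k"

lemma decay_pos [simp]: "decay k t > 0"
  unfolding decay_def by (simp add: add_pos_nonneg)

lemma decay_nonneg [simp]: "decay k t \<ge> 0"
  using decay_pos[of k t] by linarith

lemma decay_mult_power: "(1 + norm t) ^ k * decay k t = 1"
proof -
  have "1 + norm t > 0" by (simp add: add_pos_nonneg)
  then show ?thesis unfolding decay_def by simp
qed

lemma decay_mono: "k \<le> l \<Longrightarrow> decay l t \<le> decay k t"
  unfolding decay_def by (intro divide_left_mono power_increasing) (auto simp: add_pos_nonneg)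

lemma decay_0 [simp]: "decay 0 t = 1"
  by (simp add: decay_def)

lemma decay_le_1: "decay k t \<le> 1"
  using decay_mono[of 0 k t] by simp

lemma decay_add: "decay (j + k) t = decay j t * decay k t"
  unfolding decay_def by (simp add: power_add)

lemma decay_norm_mono: "norm s \<le> norm t \<Longrightarrow> decay k t \<le> decay k s"
  unfolding decay_def by (intro divide_left_mono power_mono) (auto simp: add_pos_nonneg)

lemma one_plus_norm_add: "1 + norm (x + y) \<le> (1 + norm x) * (1 + norm y)"
  using norm_triangle_ineq[of x y] mult_nonneg_nonneg[of "norm x" "norm y"]
  by (simp add: algebra_simps del: mult_nonneg_nonneg)

text \<open>Peetre's inequality, from submultiplicativity of \<open>1 + norm\<close> applied to t =
  (t + x) + (- x). A translation costs only a polynomial factor in its size.\<close>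

lemma decay_add_arg: "decay k (t + x) \<le> (1 + norm x) ^ k * decay k t"
proof -
  have pos: "1 + norm t > 0" "1 + norm (t + x) > 0" by (simp_all add: add_pos_nonneg)
  have "(1 + norm t) ^ k \<le> ((1 + norm (t + x)) * (1 + norm x)) ^ k"
    using one_plus_norm_add[of "t + x" "- x"] by (intro power_mono) (auto simp: add_pos_nonneg)
  then have "(1 + norm t) ^ k \<le> (1 + norm (t + x)) ^ k * (1 + norm x) ^ k"
    by (simp only: power_mult_distrib)
  moreover have "(1 + norm t) ^ k > 0" "(1 + norm (t + x)) ^ k > 0" using pos by simp_all
  ultimately show ?thesis unfolding decay_def
    by (simp add: divide_le_eq pos_le_divide_eq mult.commute)
qed

lemma decay_diff_arg: "decay k (t - x) \<le> (1 + norm x) ^ k * decay k t"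
  using decay_add_arg[of k t "- x"] by simp

text \<open>The norm of a pair is at most the sum of the norms. This merges separate estimates in
  position and in frequency into one estimate on phase space.\<close>

lemma decay_Pair: "decay (2 * k) (x, y) \<ge> decay (2 * k) x * decay (2 * k) y"
proof -
  have "1 + norm (x, y) \<le> (1 + norm x) * (1 + norm y)"
    using norm_Pair_le[of x y] mult_nonneg_nonneg[of "norm x" "norm y"]
    by (simp add: algebra_simps del: mult_nonneg_nonneg)
  then have "(1 + norm (x, y)) ^ (2 * k) \<le> ((1 + norm x) * (1 + norm y)) ^ (2 * k)"
    by (intro power_mono) (auto simp: add_pos_nonneg)
  then have "1 / ((1 + norm x) * (1 + norm y)) ^ (2 * k) \<le> 1 / (1 + norm (x, y)) ^ (2 * k)"
    by (intro divide_left_mono mult_pos_pos zero_less_power) (auto simp: add_pos_nonneg)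
  then show ?thesis unfolding decay_def by (simp add: power_mult_distrib)
qed

lemma continuous_on_decay [continuous_intros]:
  "continuous_on S f \<Longrightarrow> continuous_on S (\<lambda>x. decay k (f x))"
  unfolding decay_def
  by (intro continuous_intros) (auto simp: add_nonneg_eq_0_iff)

lemma measurable_decay [measurable]: "decay k \<in> borel_measurable borel"
  by (intro borel_measurable_continuous_onI continuous_intros)

text \<open>Comparison with a sum over balls: where the norm has integer part k the weight is at
  most (1 + k)^-(d + 2), and the ball of radius k + 1 has volume proportional to (k + 1)^d. What
  remains is the series of inverse squares, hence the exponent d + 2.\<close>

lemma integrable_decay_minimal:
  "integrable lborel (decay (DIM('a) + 2) :: 'a::euclidean_space \<Rightarrow> real)"
proof -
  let ?D = "DIM('a)"
  define c where "c k = (1::real) / (1 + real k) ^ (?D + 2)" for k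
  have le: "ennreal (decay (?D + 2) t) \<le> (\<Sum>k. ennreal (c k) * indicator (ball 0 (real k + 1)) t)"
    for t :: 'a
  proof -
    define k where "k = nat \<lfloor>norm t\<rfloor>"
    have k: "real k \<le> norm t" "norm t < real k + 1"
      unfolding k_def by (auto simp: of_nat_nat)
    have "decay (?D + 2) t \<le> c k"
      unfolding decay_def c_def using k by (intro divide_left_mono power_mono) (auto simp: add_pos_nonneg)
    then have "ennreal (decay (?D + 2) t) \<le> ennreal (c k) * indicator (ball 0 (real k + 1)) t"
      using k by (simp add: indicator_def ennreal_leI)
    also have "\<dots> = (\<Sum>j\<in>{k}. ennreal (c j) * indicator (ball 0 (real j + 1)) t)"
      by (simp del: sum_mult_indicator)
    also have "\<dots> \<le> (\<Sum>k. ennreal (c k) * indicator (ball 0 (real k + 1)) t)"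
      by (intro sum_le_suminf) auto
    finally show ?thesis .
  qed
  have s: "summable (\<lambda>k. 1 / (real k + 1) ^ 2)"
    using inverse_squares_sums by (simp add: sums_iff add.commute)
  have "(\<integral>\<^sup>+t. ennreal (decay (?D + 2) t) \<partial>(lborel :: 'a measure))
      \<le> (\<integral>\<^sup>+t. (\<Sum>k. ennreal (c k) * indicator (ball 0 (real k + 1)) t) \<partial>(lborel :: 'a measure))"
    by (intro nn_integral_mono le)
  also have "\<dots> = (\<Sum>k. ennreal (c k) * emeasure lborel (ball (0::'a) (real k + 1)))"
  proof (subst nn_integral_suminf)
    show "(\<lambda>t. ennreal (c i) * indicator (ball (0::'a) (real i + 1)) t) \<in> borel_measurable lborel" for i
      by (intro borel_measurable_times_ennreal borel_measurable_indicator) auto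
  qed (simp add: nn_integral_cmult_indicator)
  also have "\<dots> = (\<Sum>k. ennreal (unit_ball_vol ?D * (1 / (real k + 1) ^ 2)))"
  proof (rule suminf_cong)
    fix k
    have "(1 + real k) ^ (?D + 2) = (real k + 1) ^ ?D * (real k + 1) ^ 2"
      by (simp only: power_add add.commute)
    moreover have "real k + 1 > 0" by simp
    ultimately have "c k * (unit_ball_vol ?D * (real k + 1) ^ ?D) = unit_ball_vol ?D * (1 / (real k + 1) ^ 2)"
      unfolding c_def by (simp add: field_simps)
    moreover have "c k \<ge> 0" unfolding c_def by simp
    ultimately show "ennreal (c k) * emeasure lborel (ball (0::'a) (real k + 1)) = ennreal (unit_ball_vol ?D * (1 / (real k + 1) ^ 2))"
      by (subst emeasure_ball) (auto simp: ennreal_mult[symmetric])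
  qed
  also have "\<dots> = ennreal (\<Sum>k. unit_ball_vol ?D * (1 / (real k + 1) ^ 2))"
    by (intro suminf_ennreal_eq summable_sums summable_mult s) auto
  also have "\<dots> < \<infinity>" by simp
  finally show ?thesis
    by (intro integrableI_nonneg) auto
qed

lemma integrable_decay:
  assumes "k \<ge> DIM('a) + 2"
  shows "integrable lborel (decay k :: 'a::euclidean_space \<Rightarrow> real)"
  by (rule Bochner_Integration.integrable_bound[OF integrable_decay_minimal])
     (use decay_mono[OF assms] in auto)

lemma integrable_decay_bound:
  fixes f :: "'a::euclidean_space \<Rightarrow> 'b::{banach, second_countable_topology}"
  assumes "f \<in> borel_measurable borel" and "k \<ge> DIM('a) + 2"
    and "\<And>t. norm (f t) \<le> C * decay k t"
  shows "integrable lborel f"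
proof (rule Bochner_Integration.integrable_bound)
  show "integrable lborel (\<lambda>t::'a. C * decay k t)"
    using integrable_decay[OF assms(2)] by simp
  show "AE t in lborel. norm (f t) \<le> norm (C * decay k t)"
    using assms(3) by (intro AE_I2) (smt (verit) real_norm_def)
qed (use assms(1) in simp)

section \<open>Schwartz functions: linear combinations, translation, conjugation\<close>

lemma schwartz_differentiable:
  "schwartz f \<Longrightarrow> set bs \<subseteq> Basis \<Longrightarrow> iter_partial bs f differentiable at x"
  by (auto simp: schwartz_def)

lemma schwartz_has_derivative:
  assumes "schwartz f" "set bs \<subseteq> Basis"
  shows "(iter_partial bs f has_derivative frechet_derivative (iter_partial bs f) (at x)) (at x)"
  using schwartz_differentiable[OF assms] by (simp add: frechet_derivative_works)

lemma schwartz_continuous: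
  assumes "schwartz f" "set bs \<subseteq> Basis"
  shows "continuous_on S (iter_partial bs f)"
  using schwartz_differentiable[OF assms]
  by (intro differentiable_imp_continuous_on) (auto simp: differentiable_on_def differentiable_at_withinI)

lemma schwartz_decay:
  assumes "schwartz f" "set bs \<subseteq> Basis"
  shows "\<exists>C>0. \<forall>t. norm (iter_partial bs f t) \<le> C * decay k t"
proof -
  have "bounded (range (\<lambda>x. (1 + norm x) ^ k *\<^sub>R iter_partial bs f x))"
    using assms by (auto simp: schwartz_def)
  then obtain C where C: "C > 0" "\<And>x. norm ((1 + norm x) ^ k *\<^sub>R iter_partial bs f x) \<le> C"
    unfolding bounded_pos by auto
  have "norm (iter_partial bs f t) \<le> C * decay k t" for t
    using C(2)[of t] by (simp add: decay_def add_pos_nonneg field_simps)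
  then show ?thesis using C(1) by blast
qed

lemma schwartzI:
  assumes "\<And>bs x. set bs \<subseteq> Basis \<Longrightarrow> iter_partial bs f differentiable at x"
    and "\<And>bs k. set bs \<subseteq> Basis \<Longrightarrow> \<exists>C. \<forall>t. norm (iter_partial bs f t) \<le> C * decay k t"
  shows "schwartz f"
  unfolding schwartz_def
proof (intro allI impI conjI)
  fix bs :: "'a list" and k
  assume bs: "set bs \<subseteq> Basis"
  show "iter_partial bs f differentiable at x" for x by (rule assms(1)[OF bs])
  obtain C where C: "\<And>t. norm (iter_partial bs f t) \<le> C * decay k t"
    using assms(2)[OF bs] by blast
  have "norm ((1 + norm t) ^ k *\<^sub>R iter_partial bs f t) \<le> C" for t
    using C[of t] by (simp add: decay_def add_pos_nonneg field_simps)
  then show "bounded (range (\<lambda>x. (1 + norm x) ^ k *\<^sub>R iter_partial bs f x))"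
    unfolding bounded_iff by blast
qed

lemma schwartz_seminorm_le:
  assumes "\<And>t. norm (iter_partial bs f t) \<le> C * decay k t"
  shows "schwartz_seminorm k bs f \<le> C"
  unfolding schwartz_seminorm_def
proof (rule cSUP_least)
  fix t
  show "(1 + norm t) ^ k * norm (iter_partial bs f t) \<le> C"
    using assms[of t] by (simp add: decay_def add_pos_nonneg field_simps)
qed auto

lemma frechet_derivative_eqI:
  "(f has_derivative f') (at x) \<Longrightarrow> frechet_derivative f (at x) b = f' b"
  using frechet_derivative_at by metis

text \<open>\<open>frechet_derivative\<close> is a choice operator and obeys the rules of calculus
  only where the function is differentiable; the Schwartz hypotheses supply this at every stage of
  the iteration.\<close>

lemma iter_partial_linear:
  assumes "schwartz f" "schwartz g" "set bs \<subseteq> Basis"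
  shows "iter_partial bs (\<lambda>t. c * f t + g t) = (\<lambda>t. c * iter_partial bs f t + iter_partial bs g t)"
  using assms(3)
proof (induction bs)
  case (Cons b bs)
  have "((\<lambda>t. c * iter_partial bs f t + iter_partial bs g t) has_derivative
      (\<lambda>h. c * frechet_derivative (iter_partial bs f) (at x) h + frechet_derivative (iter_partial bs g) (at x) h)) (at x)" for x
    using Cons.prems assms(1,2)
    by (intro derivative_intros schwartz_has_derivative) auto
  from frechet_derivative_eqI[OF this] show ?case
    using Cons by simp
qed simp

lemma schwartz_linear:
  assumes "schwartz f" "schwartz g"
  shows "schwartz (\<lambda>t. c * f t + g t)"
proof (rule schwartzI)
  fix bs :: "'a list" assume bs: "set bs \<subseteq> Basis"
  show "iter_partial bs (\<lambda>t. c * f t + g t) differentiable at x" for x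
    unfolding iter_partial_linear[OF assms bs]
    using schwartz_differentiable[OF assms(1) bs] schwartz_differentiable[OF assms(2) bs]
    by (intro derivative_intros) auto
  fix k
  obtain C1 C2 where "\<forall>t. norm (iter_partial bs f t) \<le> C1 * decay k t"
    "\<forall>t. norm (iter_partial bs g t) \<le> C2 * decay k t"
    using schwartz_decay[OF assms(1) bs] schwartz_decay[OF assms(2) bs] by blast
  then have "norm (c * iter_partial bs f t + iter_partial bs g t) \<le> (norm c * C1 + C2) * decay k t" for t
    by (simp add: norm_mult mult.assoc distrib_right add_mono mult_left_mono norm_triangle_le)
  then show "\<exists>C. \<forall>t. norm (iter_partial bs (\<lambda>t. c * f t + g t) t) \<le> C * decay k t"
    unfolding iter_partial_linear[OF assms bs] by blast
qed

lemma iter_partial_zero: "iter_partial bs (\<lambda>t. 0) = (\<lambda>t. 0)"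
  by (induction bs) simp_all

lemma schwartz_zero [simp]: "schwartz (\<lambda>t. 0)"
  by (rule schwartzI) (auto simp: iter_partial_zero intro!: exI[of _ 0])

lemma schwartz_sum:
  assumes "finite J" "\<And>j. j \<in> J \<Longrightarrow> schwartz (f j)"
  shows "schwartz (\<lambda>t. \<Sum>j\<in>J. c j * f j t)"
  using assms by (induction rule: finite_induct) (auto intro!: schwartz_linear)

lemma iter_partial_sum:
  assumes "finite J" "\<And>j. j \<in> J \<Longrightarrow> schwartz (f j)" "set bs \<subseteq> Basis"
  shows "iter_partial bs (\<lambda>t. \<Sum>j\<in>J. c j * f j t) = (\<lambda>t. \<Sum>j\<in>J. c j * iter_partial bs (f j) t)"
  using assms(1,2)
proof (induction rule: finite_induct)
  case (insert j J)
  have "iter_partial bs (\<lambda>t. c j * f j t + (\<Sum>j\<in>J. c j * f j t))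
     = (\<lambda>t. c j * iter_partial bs (f j) t + iter_partial bs (\<lambda>t. \<Sum>j\<in>J. c j * f j t) t)"
    using insert by (intro iter_partial_linear schwartz_sum assms(3)) auto
  then show ?case using insert by simp
qed (simp add: iter_partial_zero)

lemma schwartz_shift_has_derivative:
  assumes "schwartz f" "set bs \<subseteq> Basis"
  shows "((\<lambda>t. iter_partial bs f (t - x)) has_derivative
           frechet_derivative (iter_partial bs f) (at (t - x))) (at t)"
proof -
  have "((\<lambda>t. t - x) has_derivative (\<lambda>h. h)) (at t)" by (auto intro!: derivative_eq_intros)
  from has_derivative_compose[OF this schwartz_has_derivative[OF assms, of "t - x"]]
  show ?thesis by simp
qed

lemma iter_partial_cnj_shift:
  assumes "schwartz f" "set bs \<subseteq> Basis"
  shows "iter_partial bs (\<lambda>t. cnj (f (t - x))) = (\<lambda>t. cnj (iter_partial bs f (t - x)))"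
  using assms(2)
proof (induction bs)
  case (Cons b bs)
  have "((\<lambda>t. cnj (iter_partial bs f (t - x))) has_derivative (\<lambda>h. cnj (frechet_derivative (iter_partial bs f) (at (t - x)) h))) (at t)" for t
    using Cons.prems by (intro has_derivative_cnj schwartz_shift_has_derivative assms(1)) auto
  from frechet_derivative_eqI[OF this] show ?case
    using Cons by simp
qed simp

lemma schwartz_cnj_shift:
  assumes "schwartz f"
  shows "schwartz (\<lambda>t. cnj (f (t - x)))"
proof (rule schwartzI)
  fix bs :: "'a list" assume bs: "set bs \<subseteq> Basis"
  from has_derivative_cnj[OF schwartz_shift_has_derivative[OF assms bs]] show "iter_partial bs (\<lambda>t. cnj (f (t - x))) differentiable at t" for t
    unfolding iter_partial_cnj_shift[OF assms bs] differentiable_def by blast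
  fix k
  obtain C where C: "C > 0" "\<And>t. norm (iter_partial bs f t) \<le> C * decay k t"
    using schwartz_decay[OF assms bs] by blast
  have "norm (iter_partial bs f (t - x)) \<le> (C * (1 + norm x) ^ k) * decay k t" for t
    using order_trans[OF C(2)[of "t - x"] mult_left_mono[OF decay_diff_arg[of k t x], of C]] C(1) by (simp add: mult.assoc)
  then show "\<exists>C. \<forall>t. norm (iter_partial bs (\<lambda>t. cnj (f (t - x))) t) \<le> C * decay k t"
    unfolding iter_partial_cnj_shift[OF assms bs] by auto
qed

lemma schwartz_cnj: "schwartz f \<Longrightarrow> schwartz (\<lambda>t. cnj (f t))"
  using schwartz_cnj_shift[of f 0] by simp

text \<open>The expansion of the iterated product rule. In a pair, the first list collects the
  directions that differentiate the exponential, the second those that differentiate the other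
  factor. A list of pairs, rather than a set, keeps multiplicities.\<close>

fun leibniz :: "'a list \<Rightarrow> ('a list \<times> 'a list) list" where
  "leibniz [] = [([], [])]"
| "leibniz (b # bs) =
     map (\<lambda>(as, cs). (b # as, cs)) (leibniz bs) @ map (\<lambda>(as, cs). (as, b # cs)) (leibniz bs)"

lemma set_leibniz:
  "(as, cs) \<in> set (leibniz bs) \<Longrightarrow> set as \<subseteq> set bs \<and> set cs \<subseteq> set bs \<and> length as \<le> length bs"
  by (induction bs arbitrary: as cs) fastforce+

lemma has_derivative_sum_list:
  assumes "\<And>y. y \<in> set ys \<Longrightarrow> (f y has_derivative f' y) F"
  shows "((\<lambda>t. \<Sum>y\<leftarrow>ys. f y t) has_derivative (\<lambda>h. \<Sum>y\<leftarrow>ys. f' y h)) F"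
  using assms by (induction ys) (auto intro!: derivative_intros)

definition modulation_factor :: "'a::euclidean_space \<Rightarrow> 'a list \<Rightarrow> complex" where
  "modulation_factor \<omega> as = (\<Prod>a\<leftarrow>as. \<i> * complex_of_real (\<omega> \<bullet> a))"

lemma modulation_factor_simps [simp]:
  "modulation_factor \<omega> [] = 1"
  "modulation_factor \<omega> (a # as) = \<i> * complex_of_real (\<omega> \<bullet> a) * modulation_factor \<omega> as"
  by (simp_all add: modulation_factor_def)

text \<open>A closed form for an iterated partial derivative of a modulated function. The frequency
  enters only through the phase and the monomials \<open>modulation_factor\<close>, so growth in the
  frequency can be read off.\<close>

definition modulated_partial :: "'a::euclidean_space \<Rightarrow> 'a list \<Rightarrow> ('a \<Rightarrow> complex) \<Rightarrow> 'a \<Rightarrow> complex" where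
  "modulated_partial \<omega> bs f t =
     cis (\<omega> \<bullet> t) * (\<Sum>(as, cs)\<leftarrow>leibniz bs. modulation_factor \<omega> as * iter_partial cs f t)"

lemma has_derivative_cis_inner:
  "((\<lambda>t. cis (\<omega> \<bullet> t)) has_derivative (\<lambda>h. \<i> * complex_of_real (\<omega> \<bullet> h) * cis (\<omega> \<bullet> t))) (at t)"
proof -
  have "((\<lambda>t. exp (\<i> * complex_of_real (\<omega> \<bullet> t))) has_derivative (\<lambda>h. \<i> * complex_of_real (\<omega> \<bullet> h) * exp (\<i> * complex_of_real (\<omega> \<bullet> t)))) (at t)"
    by (rule has_derivative_eq_rhs, rule has_derivative_compose[OF _ DERIV_exp[unfolded has_field_derivative_def]])
       (auto intro!: derivative_eq_intros simp: mult_ac)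
  then show ?thesis by (simp add: cis_conv_exp)
qed

lemma modulated_partial_has_derivative:
  assumes f: "schwartz f" and bs: "set bs \<subseteq> Basis"
  shows "(modulated_partial \<omega> bs f has_derivative
     (\<lambda>h. cis (\<omega> \<bullet> t) * (\<Sum>(as, cs)\<leftarrow>leibniz bs. modulation_factor \<omega> as * frechet_derivative (iter_partial cs f) (at t) h)
        + \<i> * complex_of_real (\<omega> \<bullet> h) * cis (\<omega> \<bullet> t) * (\<Sum>(as, cs)\<leftarrow>leibniz bs. modulation_factor \<omega> as * iter_partial cs f t))) (at t)"
proof -
  have "((\<lambda>t. \<Sum>y\<leftarrow>leibniz bs. (\<lambda>(as, cs) t. modulation_factor \<omega> as * iter_partial cs f t) y t) has_derivative
     (\<lambda>h. \<Sum>y\<leftarrow>leibniz bs. (\<lambda>(as, cs) h. modulation_factor \<omega> as * frechet_derivative (iter_partial cs f) (at t) h) y h)) (at t)"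
    using set_leibniz bs
    by (intro has_derivative_sum_list) (fastforce intro!: derivative_intros schwartz_has_derivative[OF f])
  from has_derivative_mult[OF has_derivative_cis_inner[of \<omega> t] this]
  show ?thesis
    unfolding modulated_partial_def by (simp add: case_prod_unfold)
qed

text \<open>One more derivative splits every term in two, according to the factor it hits; these are
  the two halves of the recursion for \<open>leibniz\<close>.\<close>

lemma iter_partial_modulation:
  assumes f: "schwartz f" and bs: "set bs \<subseteq> Basis"
  shows "iter_partial bs (\<lambda>t. cis (\<omega> \<bullet> t) * f t) = modulated_partial \<omega> bs f"
  using bs
proof (induction bs)
  case Nil
  then show ?case by (simp add: modulated_partial_def fun_eq_iff)
next
  case (Cons b bs)
  then have bs: "set bs \<subseteq> Basis" by simp
  show ?case
  proof
    fix t
    have "iter_partial (b # bs) (\<lambda>t. cis (\<omega> \<bullet> t) * f t) t = frechet_derivative (modulated_partial \<omega> bs f) (at t) b"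
      using Cons by simp
    also have "\<dots> = modulated_partial \<omega> (b # bs) f t"
      unfolding frechet_derivative_eqI[OF modulated_partial_has_derivative[OF f bs]]
      by (simp add: modulated_partial_def case_prod_unfold comp_def sum_list_const_mult[symmetric] algebra_simps)
    finally show "iter_partial (b # bs) (\<lambda>t. cis (\<omega> \<bullet> t) * f t) t = modulated_partial \<omega> (b # bs) f t" .
  qed
qed

lemma norm_modulation_factor_le:
  assumes "set as \<subseteq> Basis"
  shows "norm (modulation_factor \<omega> as) \<le> norm \<omega> ^ length as"
  using assms
proof (induction as)
  case (Cons a as)
  have "\<bar>\<omega> \<bullet> a\<bar> \<le> norm \<omega>" using Cons.prems by (intro Basis_le_norm) auto
  then show ?case using Cons by (auto simp: norm_mult intro!: mult_mono)
qed simp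

lemma norm_sum_list_le:
  assumes "\<And>y. y \<in> set ys \<Longrightarrow> norm (f y) \<le> g y"
  shows "norm (\<Sum>y\<leftarrow>ys. f y) \<le> (\<Sum>y\<leftarrow>ys. g y)"
  using assms by (induction ys) (auto intro!: norm_triangle_le add_mono)

text \<open>What matters is that the constant is uniform in the frequency, the translation and the
  point. Each derivative that hits the exponential costs at most one power of the frequency, and
  Peetre's inequality transfers the decay from t - x to t.\<close>

lemma modulated_partial_bound:
  assumes f: "schwartz f" and bs: "set bs \<subseteq> Basis"
  shows "\<exists>C>0. \<forall>\<omega> x t. norm (modulated_partial \<omega> bs (\<lambda>t. cnj (f (t - x))) t)
           \<le> C * (1 + norm \<omega>) ^ length bs * ((1 + norm x) ^ k * decay k t)"
proof -
  have "\<forall>cs\<in>{cs. set cs \<subseteq> Basis}. \<exists>C>0. \<forall>t. norm (iter_partial cs f t) \<le> C * decay k t"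
    using schwartz_decay[OF f] by blast
  then obtain C where C: "\<And>cs. set cs \<subseteq> Basis \<Longrightarrow> C cs > 0"
     "\<And>cs t. set cs \<subseteq> Basis \<Longrightarrow> norm (iter_partial cs f t) \<le> C cs * decay k t"
    by (metis mem_Collect_eq)
  define K where "K = (\<Sum>(as, cs)\<leftarrow>leibniz bs. C cs)"
  have sub: "set as \<subseteq> Basis" "set cs \<subseteq> Basis" "length as \<le> length bs" if "(as, cs) \<in> set (leibniz bs)" for as cs
    using set_leibniz[OF that] bs by auto
  have "norm (modulated_partial \<omega> bs (\<lambda>t. cnj (f (t - x))) t)
           \<le> K * (1 + norm \<omega>) ^ length bs * ((1 + norm x) ^ k * decay k t)" for \<omega> x t
  proof -
    have *: "norm (modulation_factor \<omega> as * iter_partial cs (\<lambda>t. cnj (f (t - x))) t)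
        \<le> C cs * ((1 + norm \<omega>) ^ length bs * ((1 + norm x) ^ k * decay k t))" if "(as, cs) \<in> set (leibniz bs)" for as cs
    proof -
      have "norm (modulation_factor \<omega> as) \<le> (1 + norm \<omega>) ^ length bs"
        using norm_modulation_factor_le[OF sub(1)[OF that], of \<omega>]
          power_mono[of "norm \<omega>" "1 + norm \<omega>" "length as"] power_increasing[OF sub(3)[OF that], of "1 + norm \<omega>"]
        by simp
      moreover have "norm (iter_partial cs f (t - x)) \<le> C cs * ((1 + norm x) ^ k * decay k t)"
        using order_trans[OF C(2)[OF sub(2)[OF that], of "t - x"] mult_left_mono[OF decay_diff_arg[of k t x], of "C cs"]] C(1)[OF sub(2)[OF that]] by simp
      ultimately have "norm (modulation_factor \<omega> as) * norm (iter_partial cs f (t - x)) \<le> (1 + norm \<omega>) ^ length bs * (C cs * ((1 + norm x) ^ k * decay k t))"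
        by (intro mult_mono) auto
      then show ?thesis
        by (simp add: norm_mult iter_partial_cnj_shift[OF f sub(2)[OF that]] mult_ac)
    qed
    have "norm (modulated_partial \<omega> bs (\<lambda>t. cnj (f (t - x))) t)
      = norm (\<Sum>(as, cs)\<leftarrow>leibniz bs. modulation_factor \<omega> as * iter_partial cs (\<lambda>t. cnj (f (t - x))) t)"
      by (simp add: modulated_partial_def norm_mult)
    also have "\<dots> \<le> (\<Sum>(as, cs)\<leftarrow>leibniz bs. C cs * ((1 + norm \<omega>) ^ length bs * ((1 + norm x) ^ k * decay k t)))"
      using * by (intro norm_sum_list_le) auto
    also have "\<dots> = K * (1 + norm \<omega>) ^ length bs * ((1 + norm x) ^ k * decay k t)"
      unfolding K_def by (simp add: case_prod_unfold sum_list_mult_const mult.assoc)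
    finally show ?thesis .
  qed
  note bound = this
  have "K \<ge> 0" unfolding K_def using C(1) sub by (intro sum_list_nonneg) (fastforce simp: less_imp_le)
  have "norm (modulated_partial \<omega> bs (\<lambda>t. cnj (f (t - x))) t)
           \<le> (K + 1) * (1 + norm \<omega>) ^ length bs * ((1 + norm x) ^ k * decay k t)" for \<omega> x t
  proof -
    have "K * (1 + norm \<omega>) ^ length bs * ((1 + norm x) ^ k * decay k t)
        \<le> (K + 1) * (1 + norm \<omega>) ^ length bs * ((1 + norm x) ^ k * decay k t)"
      by (intro mult_right_mono) auto
    with bound show ?thesis by (rule order_trans)
  qed
  then show ?thesis using \<open>K \<ge> 0\<close> by (intro exI[of _ "K + 1"]) auto
qed

lemma continuous_on_sum_list:
  fixes f :: "'i \<Rightarrow> 'a::topological_space \<Rightarrow> 'b::real_normed_vector"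
  assumes "\<And>y. y \<in> set ys \<Longrightarrow> continuous_on S (f y)"
  shows "continuous_on S (\<lambda>t. \<Sum>y\<leftarrow>ys. f y t)"
  using assms by (induction ys) (auto intro!: continuous_intros)

lemma continuous_on_cis_real [continuous_intros]:
  "continuous_on S f \<Longrightarrow> continuous_on S (\<lambda>x. cis (f x))"
  unfolding cis_conv_exp by (intro continuous_intros)

lemma continuous_on_modulation_factor:
  "continuous_on S (\<lambda>\<omega>. modulation_factor \<omega> as)"
  by (induction as) (auto intro!: continuous_intros)

lemma modulated_partial_continuous:
  assumes f: "schwartz f" and bs: "set bs \<subseteq> Basis"
  shows "continuous_on UNIV (\<lambda>(\<omega>, x, t). modulated_partial \<omega> bs (\<lambda>t. cnj (f (t - x))) t)"
proof -
  have *: "continuous_on UNIV (\<lambda>z. modulation_factor (fst z) as * iter_partial cs (\<lambda>t. cnj (f (t - fst (snd z)))) (snd (snd z)))"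
    if y: "y \<in> set (leibniz bs)" and as: "as = fst y" and cs: "cs = snd y" for y as cs
  proof -
    have cs: "set cs \<subseteq> Basis" using set_leibniz[of as cs bs] y bs unfolding as cs by auto
    have "continuous_on UNIV (\<lambda>z. iter_partial cs f (snd (snd z) - fst (snd z)))"
      by (rule continuous_on_compose2[OF schwartz_continuous[OF f cs]]) (auto intro!: continuous_intros)
    then show ?thesis
      unfolding iter_partial_cnj_shift[OF f cs]
      by (intro continuous_intros continuous_on_compose2[OF continuous_on_modulation_factor]) auto
  qed
  show ?thesis
    unfolding modulated_partial_def case_prod_unfold
    by (rule continuous_on_mult[OF _ continuous_on_sum_list[OF *]])
       (assumption | rule refl | intro continuous_intros)+
qed

lemma schwartz_modulation:
  assumes f: "schwartz f"
  shows "schwartz (\<lambda>t. cis (\<omega> \<bullet> t) * f t)"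
proof (rule schwartzI)
  fix bs :: "'a list" assume bs: "set bs \<subseteq> Basis"
  show "iter_partial bs (\<lambda>t. cis (\<omega> \<bullet> t) * f t) differentiable at x" for x
    unfolding iter_partial_modulation[OF f bs] differentiable_def
    using modulated_partial_has_derivative[OF f bs] by blast
  fix k
  \<comment> \<open>The bound is available for conjugated translates; used for the conjugate of
    \<open>f\<close> and translation 0, the two conjugations cancel.\<close>
  obtain C where C: "\<And>t. norm (modulated_partial \<omega> bs (\<lambda>t. cnj (cnj (f (t - 0)))) t)
           \<le> C * (1 + norm \<omega>) ^ length bs * ((1 + norm (0::'a)) ^ k * decay k t)"
    using modulated_partial_bound[OF schwartz_cnj[OF f] bs, of k] by blast
  show "\<exists>C. \<forall>t. norm (iter_partial bs (\<lambda>t. cis (\<omega> \<bullet> t) * f t) t) \<le> C * decay k t"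
    unfolding iter_partial_modulation[OF f bs] using C by auto
qed

lemma tf_shift_cnj_eq:
  "(\<lambda>t. cnj (tf_shift z f t)) = (\<lambda>t. cis ((- 2 * pi) *\<^sub>R snd z \<bullet> t) * cnj (f (t - fst z)))"
  by (simp add: tf_shift_def cis_cnj fun_eq_iff)

lemma schwartz_tf_shift_cnj:
  assumes "schwartz f"
  shows "schwartz (\<lambda>t. cnj (tf_shift z f t))"
  unfolding tf_shift_cnj_eq by (intro schwartz_modulation schwartz_cnj_shift assms)

lemma schwartz_tf_shift:
  assumes "schwartz f"
  shows "schwartz (tf_shift z f)"
  using schwartz_cnj[OF schwartz_tf_shift_cnj[OF assms, of z]] by simp

text \<open>The power of \<open>1 + norm z\<close> has two sources: \<open>length bs\<close> comes
  from derivatives of the exponential, \<open>k\<close> from undoing the translation in the decay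
  weight. Rapidly decaying coefficients will later pay for this growth.\<close>

lemma iter_partial_tf_shift_bound:
  assumes f: "schwartz f" and bs: "set bs \<subseteq> Basis"
  shows "\<exists>C>0. \<forall>z t. norm (iter_partial bs (\<lambda>t. cnj (tf_shift z f t)) t)
            \<le> C * (1 + norm z) ^ (length bs + k) * decay k t"
proof -
  obtain C where C: "C > 0" "\<And>\<omega> x t. norm (modulated_partial \<omega> bs (\<lambda>t. cnj (f (t - x))) t)
           \<le> C * (1 + norm \<omega>) ^ length bs * ((1 + norm x) ^ k * decay k t)"
    using modulated_partial_bound[OF f bs] by blast
  let ?l = "length bs"
  have "norm (iter_partial bs (\<lambda>t. cnj (tf_shift z f t)) t)
            \<le> (C * (1 + 2 * pi) ^ ?l) * (1 + norm z) ^ (?l + k) * decay k t" for z t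
  proof -
    have 1: "norm (fst z) \<le> norm z" "norm (snd z) \<le> norm z"
      by (metis norm_fst_le prod.collapse, metis norm_snd_le prod.collapse)
    have "1 + norm ((- 2 * pi) *\<^sub>R snd z) \<le> (1 + 2 * pi) * (1 + norm z)"
    proof -
      have "1 + norm ((- 2 * pi) *\<^sub>R snd z) = 1 + 2 * pi * norm (snd z)"
        using pi_gt_zero by (simp add: abs_mult)
      also have "\<dots> \<le> 1 + 2 * pi * norm z" using 1(2) by (simp add: mult_left_mono)
      also have "\<dots> \<le> (1 + 2 * pi) * (1 + norm z)" using pi_gt_zero by (simp add: algebra_simps)
      finally show ?thesis .
    qed
    then have 2: "(1 + norm ((- 2 * pi) *\<^sub>R snd z)) ^ ?l \<le> ((1 + 2 * pi) * (1 + norm z)) ^ ?l"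
      by (intro power_mono) (auto simp: add_nonneg_nonneg)
    have 3: "(1 + norm (fst z)) ^ k * decay k t \<le> (1 + norm z) ^ k * decay k t"
      using 1 by (intro mult_right_mono power_mono) auto
    have "norm (iter_partial bs (\<lambda>t. cnj (tf_shift z f t)) t)
      \<le> C * (1 + norm ((- 2 * pi) *\<^sub>R snd z)) ^ ?l * ((1 + norm (fst z)) ^ k * decay k t)"
      unfolding tf_shift_cnj_eq iter_partial_modulation[OF schwartz_cnj_shift[OF f] bs]
      by (rule C(2))
    also have "\<dots> \<le> C * ((1 + 2 * pi) * (1 + norm z)) ^ ?l * ((1 + norm z) ^ k * decay k t)"
      using C(1) 2 3 pi_gt_zero by (intro mult_mono) (auto simp: add_nonneg_nonneg)
    finally show ?thesis
      by (simp add: power_mult_distrib power_add mult_ac)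
  qed
  moreover have "C * (1 + 2 * pi) ^ ?l > 0" using C(1) pi_gt_zero by (simp add: add_pos_pos)
  ultimately show ?thesis by blast
qed

lemma iter_partial_tf_shift_continuous:
  assumes f: "schwartz f" and bs: "set bs \<subseteq> Basis"
  shows "continuous_on UNIV (\<lambda>(z, t). iter_partial bs (\<lambda>t. cnj (tf_shift z f t)) t)"
proof -
  have "continuous_on UNIV (\<lambda>y. (\<lambda>(\<omega>, x, t). modulated_partial \<omega> bs (\<lambda>t. cnj (f (t - x))) t)
      ((- 2 * pi) *\<^sub>R snd (fst y), fst (fst y), snd y))"
    by (rule continuous_on_compose2[OF modulated_partial_continuous[OF f bs]]) (auto intro!: continuous_intros)
  then show ?thesis
    unfolding tf_shift_cnj_eq iter_partial_modulation[OF schwartz_cnj_shift[OF f] bs]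
    by (simp add: case_prod_unfold)
qed


section \<open>Tempered distributions under the integral\<close>

lemma schwartz_seminorm_nonneg:
  assumes "\<And>t. norm (iter_partial bs f t) \<le> C * decay k t"
  shows "schwartz_seminorm k bs f \<ge> 0"
proof -
  have "(1 + norm t) ^ k * norm (iter_partial bs f t) \<le> C" for t
    using assms[of t] by (simp add: decay_def add_pos_nonneg field_simps)
  then have "bdd_above (range (\<lambda>t. (1 + norm t) ^ k * norm (iter_partial bs f t)))"
    by (intro bdd_aboveI2[where M = C])
  then have "(1 + norm (0::'a)) ^ k * norm (iter_partial bs f 0) \<le> schwartz_seminorm k bs f"
    unfolding schwartz_seminorm_def by (intro cSUP_upper) auto
  then show ?thesis by (rule order_trans[rotated]) simp
qed

lemma finite_bounded_index_lists:
  "finite {bs :: 'a::euclidean_space list. set bs \<subseteq> Basis \<and> length bs \<le> m}"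
  by (rule finite_lists_length_le) simp

text \<open>Continuity of finite order, phrased with pointwise bounds instead of suprema, so that an
  estimate of size e for the derivatives passes directly to \<open>u\<close>.\<close>

definition order_bound ::
    "(('a::euclidean_space \<Rightarrow> complex) \<Rightarrow> complex) \<Rightarrow> real \<Rightarrow> nat \<Rightarrow> nat \<Rightarrow> bool" where
  "order_bound u C m k \<longleftrightarrow> (\<forall>f e. schwartz f \<longrightarrow>
      (\<forall>bs t. set bs \<subseteq> Basis \<longrightarrow> length bs \<le> m \<longrightarrow> norm (iter_partial bs f t) \<le> e * decay k t) \<longrightarrow>
      norm (u f) \<le> C * e)"

lemma order_boundD:
  assumes "order_bound u C m k" and "schwartz f"
    and "\<And>bs t. set bs \<subseteq> Basis \<Longrightarrow> length bs \<le> m \<Longrightarrow> norm (iter_partial bs f t) \<le> e * decay k t"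
  shows "norm (u f) \<le> C * e"
  using assms unfolding order_bound_def by simp

lemma tempered_distribution_bound:
  fixes u :: "('a::euclidean_space \<Rightarrow> complex) \<Rightarrow> complex"
  assumes "tempered_distribution u"
  obtains C m k where "C \<ge> 0" "order_bound u C m k"
proof -
  obtain C k m where C: "\<And>f. schwartz f \<Longrightarrow>
        norm (u f) \<le> C * (\<Sum>bs | set bs \<subseteq> Basis \<and> length bs \<le> m. schwartz_seminorm k bs f)"
    using assms unfolding tempered_distribution_def by blast
  let ?B = "{bs :: 'a list. set bs \<subseteq> Basis \<and> length bs \<le> m}"
  show ?thesis
  proof
    show "\<bar>C\<bar> * real (card ?B) \<ge> 0" by simp
    show "order_bound u (\<bar>C\<bar> * real (card ?B)) m k"
      unfolding order_bound_def
    proof (intro allI impI)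
      fix f :: "'a \<Rightarrow> complex" and e
      assume f: "schwartz f"
        and "\<forall>bs t. set bs \<subseteq> Basis \<longrightarrow> length bs \<le> m \<longrightarrow> norm (iter_partial bs f t) \<le> e * decay k t"
      then have e: "\<And>bs t. set bs \<subseteq> Basis \<Longrightarrow> length bs \<le> m \<Longrightarrow> norm (iter_partial bs f t) \<le> e * decay k t" by blast
      have "norm (u f) \<le> C * (\<Sum>bs\<in>?B. schwartz_seminorm k bs f)" by (rule C[OF f])
      \<comment> \<open>The constant in the definition of a tempered distribution carries no sign,
        whereas the seminorms are nonnegative.\<close>
      also have "\<dots> \<le> \<bar>C\<bar> * (\<Sum>bs\<in>?B. schwartz_seminorm k bs f)"
        using schwartz_seminorm_nonneg[OF e] by (intro mult_right_mono sum_nonneg) auto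
      also have "\<dots> \<le> \<bar>C\<bar> * (\<Sum>bs\<in>?B. e)"
        using schwartz_seminorm_le[OF e] by (intro mult_left_mono sum_mono) auto
      finally show "norm (u f) \<le> \<bar>C\<bar> * real (card ?B) * e" by (simp add: mult.assoc)
    qed
  qed
qed

lemma tempered_distribution_sum:
  assumes u: "tempered_distribution u" and "finite J" "\<And>j. j \<in> J \<Longrightarrow> schwartz (f j)"
  shows "u (\<lambda>t. \<Sum>j\<in>J. c j * f j t) = (\<Sum>j\<in>J. c j * u (f j))"
proof -
  have scale: "u (\<lambda>t. c * f t) = c * u f" if "schwartz f" for c f
    using u that by (auto simp: tempered_distribution_def)
  have add: "u (\<lambda>t. f t + g t) = u f + u g" if "schwartz f" "schwartz g" for f g
    using u that by (auto simp: tempered_distribution_def)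
  show ?thesis using assms(2,3)
  proof (induction rule: finite_induct)
    case empty
    show ?case using scale[of "\<lambda>_. 0" 0] by simp
  next
    case (insert j J)
    have "schwartz (\<lambda>t. c j * f j t)" using schwartz_linear[of "f j" "\<lambda>_. 0" "c j"] insert.prems by simp
    then show ?case
      using insert add[of "\<lambda>t. c j * f j t" "\<lambda>t. \<Sum>j\<in>J. c j * f j t"] scale[of "f j" "c j"] schwartz_sum[of J f c]
      by simp
  qed
qed

lemma tempered_distribution_diff:
  assumes u: "tempered_distribution u" and "schwartz f" "schwartz g"
  shows "u (\<lambda>t. f t - g t) = u f - u g"
proof -
  have "u (\<lambda>t. (- 1) * g t + f t) = (- 1) * u g + u f"
  proof -
    have "u (\<lambda>t. (- 1) * g t + f t) = u (\<lambda>t. (- 1) * g t) + u f"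
      using u assms(2,3) schwartz_linear[of g "\<lambda>_. 0" "- 1"] unfolding tempered_distribution_def by auto
    also have "u (\<lambda>t. (- 1) * g t) = (- 1) * u g"
      using u assms(3) unfolding tempered_distribution_def by blast
    finally show ?thesis .
  qed
  then show ?thesis by simp
qed

lemma schwartz_diff: "schwartz f \<Longrightarrow> schwartz g \<Longrightarrow> schwartz (\<lambda>t. f t - g t)"
  using schwartz_linear[of g f "- 1"] by simp

lemma iter_partial_diff:
  "schwartz f \<Longrightarrow> schwartz g \<Longrightarrow> set bs \<subseteq> Basis \<Longrightarrow>
   iter_partial bs (\<lambda>t. f t - g t) t = iter_partial bs f t - iter_partial bs g t"
  using iter_partial_linear[of g f bs "- 1"] by simp

text \<open>On a compact part of the t-space this is ordinary uniform continuity. Far out both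
  values are small separately: the hypothesis has one power of decay more than the conclusion, and
  that power beats any constant.\<close>

lemma weighted_uniform_continuity:
  fixes A :: "'b::metric_space \<Rightarrow> 'a::euclidean_space \<Rightarrow> 'c::real_normed_vector"
  assumes A: "continuous_on UNIV (\<lambda>(w, t). A w t)" and S: "compact S"
    and bnd: "\<And>w t. w \<in> S \<Longrightarrow> norm (A w t) \<le> c * decay (k + 1) t" and "e > 0"
  shows "\<exists>d>0. \<forall>w\<in>S. \<forall>w'\<in>S. dist w w' < d \<longrightarrow> (\<forall>t. norm (A w t - A w' t) \<le> e * decay k t)"
proof -
  \<comment> \<open>Beyond norm \<open>R\<close>, the spare factor \<open>decay 1 t\<close> brings
    2c below e.\<close>
  define R where "R = \<bar>2 * c / e\<bar>"
  have R: "R \<ge> 0" unfolding R_def by simp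
  \<comment> \<open>This is e times the smallest value of \<open>decay k\<close> on the ball of
    radius \<open>R\<close>.\<close>
  define e' where "e' = e / (1 + R) ^ k"
  have e': "e' > 0" unfolding e'_def using \<open>e > 0\<close> R by simp
  have "uniformly_continuous_on (S \<times> cball 0 R) (\<lambda>(w, t). A w t)"
    by (intro compact_uniformly_continuous continuous_on_subset[OF A] compact_Times S) auto
  then obtain d where d: "d > 0" "\<And>p q. p \<in> S \<times> cball 0 R \<Longrightarrow> q \<in> S \<times> cball 0 R \<Longrightarrow> dist q p < d \<Longrightarrow>
      dist ((\<lambda>(w, t). A w t) q) ((\<lambda>(w, t). A w t) p) < e'"
    unfolding uniformly_continuous_on_def using e' by metis
  have "norm (A w t - A w' t) \<le> e * decay k t" if w: "w \<in> S" "w' \<in> S" "dist w w' < d" for w w' t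
  proof (cases "norm t \<le> R")
    case True
    have "dist (w, t) (w', t) < d" using w(3) by (simp add: dist_Pair_Pair)
    then have "norm (A w t - A w' t) < e'"
      using d(2)[of "(w', t)" "(w, t)"] w True by (simp add: dist_norm)
    also have "e' \<le> e * decay k t"
    proof -
      have "(1 + norm t) ^ k \<le> (1 + R) ^ k" using True by (intro power_mono) auto
      then show ?thesis unfolding e'_def decay_def using \<open>e > 0\<close>
        by (simp add: divide_left_mono add_pos_nonneg R)
    qed
    finally show ?thesis by simp
  next
    case False
    have "2 * c \<le> e * R" unfolding R_def using \<open>e > 0\<close> by (simp add: abs_mult)
    also have "\<dots> \<le> e * (1 + norm t)" using False \<open>e > 0\<close> by simp
    finally have *: "2 * c * decay 1 t \<le> e"
      by (simp add: decay_def divide_le_eq add_pos_nonneg)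
    have "norm (A w t - A w' t) \<le> 2 * c * decay (k + 1) t"
      using norm_triangle_ineq4[of "A w t" "A w' t"] bnd[OF w(1), of t] bnd[OF w(2), of t] by simp
    also have "\<dots> = (2 * c * decay 1 t) * decay k t" unfolding decay_add by simp
    also have "\<dots> \<le> e * decay k t" using * by (intro mult_right_mono) auto
    finally show ?thesis .
  qed
  with d(1) show ?thesis by blast
qed

text \<open>Joint continuity together with local bounds in every weight expresses continuity of w
  \<mapsto> \<open>G w\<close> into the Schwartz space, without introducing its topology.\<close>

locale schwartz_family =
  fixes G :: "'b::euclidean_space \<Rightarrow> 'a::euclidean_space \<Rightarrow> complex"
  assumes schwartz_member: "schwartz (G w)"
    and jointly_continuous: "set bs \<subseteq> Basis \<Longrightarrow> continuous_on UNIV (\<lambda>(w, t). iter_partial bs (G w) t)"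
    and locally_bounded: "set bs \<subseteq> Basis \<Longrightarrow> compact S \<Longrightarrow>
      \<exists>C. \<forall>w\<in>S. \<forall>t. norm (iter_partial bs (G w) t) \<le> C * decay k t"
begin

text \<open>A fixed order involves only finitely many direction lists, so the minimum of their
  moduli of continuity serves all of them.\<close>

lemma uniformly_close:
  assumes S: "compact S" and "e > 0"
  shows "\<exists>d>0. \<forall>w\<in>S. \<forall>w'\<in>S. dist w w' < d \<longrightarrow>
    (\<forall>bs t. set bs \<subseteq> Basis \<longrightarrow> length bs \<le> m \<longrightarrow>
       norm (iter_partial bs (G w) t - iter_partial bs (G w') t) \<le> e * decay k t)"
proof -
  let ?B = "{bs :: 'a list. set bs \<subseteq> Basis \<and> length bs \<le> m}"
  have "\<forall>bs\<in>?B. \<exists>d>0. \<forall>w\<in>S. \<forall>w'\<in>S. dist w w' < d \<longrightarrow>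
       (\<forall>t. norm (iter_partial bs (G w) t - iter_partial bs (G w') t) \<le> e * decay k t)"
  proof
    fix bs assume "bs \<in> ?B"
    then have bs: "set bs \<subseteq> Basis" by simp
    obtain C where "\<forall>w\<in>S. \<forall>t. norm (iter_partial bs (G w) t) \<le> C * decay (k + 1) t"
      using locally_bounded[OF bs S] by blast
    then show "\<exists>d>0. \<forall>w\<in>S. \<forall>w'\<in>S. dist w w' < d \<longrightarrow>
       (\<forall>t. norm (iter_partial bs (G w) t - iter_partial bs (G w') t) \<le> e * decay k t)"
      by (intro weighted_uniform_continuity[OF jointly_continuous[OF bs] S _ \<open>e > 0\<close>]) auto
  qed
  from bchoice[OF this] obtain d where "\<forall>bs\<in>?B. d bs > 0 \<and> (\<forall>w\<in>S. \<forall>w'\<in>S. dist w w' < d bs \<longrightarrow>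
       (\<forall>t. norm (iter_partial bs (G w) t - iter_partial bs (G w') t) \<le> e * decay k t))"
    by blast
  then have d: "\<And>bs. bs \<in> ?B \<Longrightarrow> d bs > 0"
      "\<And>bs w w' t. bs \<in> ?B \<Longrightarrow> w \<in> S \<Longrightarrow> w' \<in> S \<Longrightarrow> dist w w' < d bs \<Longrightarrow>
       norm (iter_partial bs (G w) t - iter_partial bs (G w') t) \<le> e * decay k t"
    by blast+
  have fin: "finite ?B" by (rule finite_bounded_index_lists)
  have ne: "[] \<in> ?B" by simp
  define D where "D = Min (d ` ?B)"
  have "D > 0" unfolding D_def using fin ne d(1) by (subst Min_gr_iff) (auto simp del: mem_Collect_eq)
  have D_le: "D \<le> d bs" if "bs \<in> ?B" for bs :: "'a list" unfolding D_def using fin that by (intro Min_le) auto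
  have "\<forall>w\<in>S. \<forall>w'\<in>S. dist w w' < D \<longrightarrow>
    (\<forall>bs t. set bs \<subseteq> Basis \<longrightarrow> length bs \<le> m \<longrightarrow>
       norm (iter_partial bs (G w) t - iter_partial bs (G w') t) \<le> e * decay k t)"
  proof (intro ballI allI impI)
    fix w w' and bs :: "'a list" and t
    assume w: "w \<in> S" "w' \<in> S" "dist w w' < D" and "set bs \<subseteq> Basis" "length bs \<le> m"
    then have bs: "bs \<in> ?B" by simp
    have "dist w w' < d bs" using w(3) D_le[OF bs] by simp
    with d(2)[OF bs w(1,2)] show "norm (iter_partial bs (G w) t - iter_partial bs (G w') t) \<le> e * decay k t" by blast
  qed
  with \<open>D > 0\<close> show ?thesis by (intro exI[of _ D] conjI)
qed

lemma tempered_uniformly_close: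
  assumes u: "tempered_distribution u" and S: "compact S" and "e > 0"
  shows "\<exists>d>0. \<forall>w\<in>S. \<forall>w'\<in>S. dist w w' < d \<longrightarrow> norm (u (G w) - u (G w')) \<le> e"
proof -
  obtain C m k where C: "C \<ge> 0" "order_bound u C m k"
    by (rule tempered_distribution_bound[OF u])
  \<comment> \<open>The added 1 covers the case that \<open>C\<close> vanishes.\<close>
  define e' where "e' = e / (C + 1)"
  have e': "e' > 0" "C * e' \<le> e" unfolding e'_def using \<open>e > 0\<close> C(1)
    by (auto simp: divide_le_eq field_simps)
  obtain d where d: "d > 0" "\<forall>w\<in>S. \<forall>w'\<in>S. dist w w' < d \<longrightarrow>
    (\<forall>bs t. set bs \<subseteq> Basis \<longrightarrow> length bs \<le> m \<longrightarrow>
       norm (iter_partial bs (G w) t - iter_partial bs (G w') t) \<le> e' * decay k t)"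
    using uniformly_close[OF S e'(1), of m k] by (elim exE conjE)
  have "norm (u (G w) - u (G w')) \<le> e" if "w \<in> S" "w' \<in> S" "dist w w' < d" for w w'
  proof -
    have "norm (u (\<lambda>t. G w t - G w' t)) \<le> C * e'"
      using that d(2) by (intro order_boundD[OF C(2)] schwartz_diff schwartz_member) (auto simp: iter_partial_diff schwartz_member)
    then show ?thesis using e'(2) tempered_distribution_diff[OF u schwartz_member schwartz_member, of w w'] by simp
  qed
  with d(1) show ?thesis by blast
qed

lemma tempered_continuous:
  assumes u: "tempered_distribution u"
  shows "continuous_on UNIV (\<lambda>w. u (G w))"
proof -
  have "isCont (\<lambda>w. u (G w)) w" for w
    unfolding continuous_at_eps_delta
  proof (intro allI impI)
    fix e :: real assume "e > 0"
    obtain d where d: "d > 0" "\<forall>v\<in>cball w 1. \<forall>v'\<in>cball w 1. dist v v' < d \<longrightarrow> norm (u (G v) - u (G v')) \<le> e / 2"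
      using tempered_uniformly_close[OF u compact_cball, of "e / 2" w 1] \<open>e > 0\<close> by auto
    have "dist (u (G v)) (u (G w)) < e" if "dist v w < min d 1" for v
    proof -
      have "v \<in> cball w 1" "w \<in> cball w 1" "dist v w < d" using that by (auto simp: dist_commute)
      then have "norm (u (G v) - u (G w)) \<le> e / 2" using d(2) by blast
      then show ?thesis using \<open>e > 0\<close> by (simp add: dist_norm)
    qed
    then show "\<exists>d>0. \<forall>x'. dist x' w < d \<longrightarrow> dist (u (G x')) (u (G w)) < e"
      using d(1) by (intro exI[of _ "min d 1"]) auto
  qed
  then show ?thesis by (simp add: continuous_on_eq_continuous_at)
qed

end

section \<open>Difference quotients, Riemann sums and tails of integrals\<close>

lemma has_derivative_directional_limit:
  assumes "(A has_derivative D) (at t)" and b: "norm b = 1"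
    and s: "\<And>n. s n > (0::real)" "s \<longlonglongrightarrow> 0"
  shows "(\<lambda>n. (A (t + s n *\<^sub>R b) - A t) /\<^sub>R s n) \<longlonglongrightarrow> D b"
proof -
  have lin: "bounded_linear D" and
    lim: "((\<lambda>y. norm ((A y - A t) - D (y - t)) / norm (y - t)) \<longlongrightarrow> 0) (at t)"
    using assms(1) unfolding has_derivative_iff_norm by auto
  have b0: "b \<noteq> 0" using b by auto
  have "filterlim (\<lambda>n. t + s n *\<^sub>R b) (at t) sequentially"
    unfolding filterlim_at
  proof
    have "(\<lambda>n. t + s n *\<^sub>R b) \<longlonglongrightarrow> t + 0 *\<^sub>R b" by (intro tendsto_intros s)
    then show "(\<lambda>n. t + s n *\<^sub>R b) \<longlonglongrightarrow> t" by simp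
    have "s n \<noteq> 0" for n using s(1)[of n] by simp
    then show "\<forall>\<^sub>F n in sequentially. t + s n *\<^sub>R b \<in> UNIV \<and> t + s n *\<^sub>R b \<noteq> t" using b0 by simp
  qed
  from filterlim_compose[OF lim this]
  have "(\<lambda>n. norm (A (t + s n *\<^sub>R b) - A t - D (s n *\<^sub>R b)) / s n) \<longlonglongrightarrow> 0"
    using s(1) b by (simp add: less_imp_le)
  moreover have "norm (A (t + s n *\<^sub>R b) - A t - D (s n *\<^sub>R b)) / s n
      = norm ((A (t + s n *\<^sub>R b) - A t) /\<^sub>R s n - D b)" for n
  proof -
    have "s n \<noteq> 0" using s(1)[of n] by simp
    then have "(A (t + s n *\<^sub>R b) - A t) /\<^sub>R s n - D b = (A (t + s n *\<^sub>R b) - A t - D (s n *\<^sub>R b)) /\<^sub>R s n"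
      by (simp add: linear_simps[OF lin] scaleR_diff_right)
    then show ?thesis using s(1)[of n] by (simp add: divide_inverse_commute)
  qed
  ultimately have "(\<lambda>n. norm ((A (t + s n *\<^sub>R b) - A t) /\<^sub>R s n - D b)) \<longlonglongrightarrow> 0" by simp
  from tendsto_norm_zero_cancel[OF this] show ?thesis by (rule LIM_zero_cancel)
qed

text \<open>The mean value inequality for the restriction to a segment; only the derivative in
  direction \<open>b\<close>, and only along the segment, has to be bounded. This provides majorants
  for difference quotients.\<close>

lemma directional_increment_bound:
  fixes f :: "'a::real_normed_vector \<Rightarrow> 'b::real_normed_vector"
  assumes d: "\<And>x. (f has_derivative f' x) (at x)" and "s > 0"
    and bnd: "\<And>r. 0 \<le> r \<Longrightarrow> r \<le> s \<Longrightarrow> norm (f' (t + r *\<^sub>R b) b) \<le> B"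
  shows "norm (f (t + s *\<^sub>R b) - f t) \<le> B * s"
proof -
  let ?g = "\<lambda>r. f (t + r *\<^sub>R b)"
  have g: "(?g has_derivative (\<lambda>h. h *\<^sub>R f' (t + r *\<^sub>R b) b)) (at r within {0..s})" for r
  proof -
    have *: "((\<lambda>r. t + r *\<^sub>R b) has_derivative (\<lambda>h. h *\<^sub>R b)) (at r within {0..s})"
      by (auto intro!: derivative_eq_intros)
    have lin: "linear (f' x)" for x
      using d has_derivative_linear by blast
    show ?thesis
      using has_derivative_compose[OF * d[of "t + r *\<^sub>R b"]] by (simp add: linear_cmul[OF lin])
  qed
  have "norm (?g s - ?g 0) \<le> B * norm (s - 0)"
  proof (rule differentiable_bound)
    show "convex {0..s}" by simp
    show "(?g has_derivative (\<lambda>h. h *\<^sub>R f' (t + r *\<^sub>R b) b)) (at r within {0..s})" for r by (rule g)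
    show "onorm (\<lambda>h. h *\<^sub>R f' (t + r *\<^sub>R b) b) \<le> B" if "r \<in> {0..s}" for r
    proof (rule onorm_le)
      fix h :: real
      show "norm (h *\<^sub>R f' (t + r *\<^sub>R b) b) \<le> B * norm h"
        using mult_left_mono[OF bnd[of r], of "\<bar>h\<bar>"] that by (simp add: mult.commute)
    qed
  qed (use \<open>s > 0\<close> in auto)
  then show ?thesis using \<open>s > 0\<close> by simp
qed

text \<open>Outside the box the integrand is dominated by \<open>W\<close>; inside, each cell
  contributes at most its volume times the oscillation. Only \<open>e\<close> and \<open>W\<close>
  enter, so one tagged division can serve many integrands at once.\<close>

lemma riemann_sum_error:
  fixes h :: "'b::euclidean_space \<Rightarrow> complex"
  assumes h: "integrable lborel h" and cont: "continuous_on UNIV h"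
    and W: "integrable lborel W" and le: "\<And>w. norm (h w) \<le> W w"
    and p: "p tagged_division_of cbox a b"
    and osc: "\<And>x K w. (x, K) \<in> p \<Longrightarrow> w \<in> K \<Longrightarrow> norm (h w - h x) \<le> e" and e: "e \<ge> 0"
  shows "norm ((LINT w|lborel. h w) - (\<Sum>y\<in>p. complex_of_real (measure lborel (snd y)) * h (fst y)))
     \<le> (LINT w|lborel. indicator (- cbox a b) w * W w) + e * measure lborel (cbox a b)"
proof -
  let ?Q = "cbox a b"
  have i1: "integrable lborel (\<lambda>w. indicator ?Q w *\<^sub>R h w)" "integrable lborel (\<lambda>w. indicator (- ?Q) w *\<^sub>R h w)"
    using h by (auto intro!: integrable_mult_indicator)
  have iW: "integrable lborel (\<lambda>w. indicator (- ?Q) w * W w)"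
    using integrable_mult_indicator[of "- ?Q" lborel W] W by simp
  have io: "h integrable_on S" if "S = cbox c d" for S c d
    unfolding that by (rule integrable_continuous[OF continuous_on_subset[OF cont]]) simp
  have "(LINT w|lborel. h w) = (LINT w|lborel. indicator ?Q w *\<^sub>R h w + indicator (- ?Q) w *\<^sub>R h w)"
    by (intro Bochner_Integration.integral_cong) (auto simp: indicator_def)
  also have "\<dots> = (LINT w|lborel. indicator ?Q w *\<^sub>R h w) + (LINT w|lborel. indicator (- ?Q) w *\<^sub>R h w)"
    using i1 by (rule Bochner_Integration.integral_add)
  \<comment> \<open>On the box the Lebesgue integral is replaced by the gauge integral, which is
    additive over tagged divisions.\<close>
  finally have split: "(LINT w|lborel. h w) = integral ?Q h + (LINT w|lborel. indicator (- ?Q) w *\<^sub>R h w)"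
    using set_borel_integral_eq_integral(2)[of ?Q h] i1(1)
    by (simp add: set_integrable_def set_lebesgue_integral_def)
  have tail: "norm (LINT w|lborel. indicator (- ?Q) w *\<^sub>R h w) \<le> (LINT w|lborel. indicator (- ?Q) w * W w)"
  proof (rule order_trans[OF integral_norm_bound])
    show "(LINT w|lborel. norm (indicator (- ?Q) w *\<^sub>R h w)) \<le> (LINT w|lborel. indicator (- ?Q) w * W w)"
      using le by (intro integral_mono integrable_norm i1 iW) (auto simp: indicator_def)
  qed
  have "integral ?Q h = (\<Sum>(x, K)\<in>p. integral K h)"
    by (rule integral_combine_tagged_division_topdown[OF io[OF refl] p])
  then have "norm (integral ?Q h - (\<Sum>y\<in>p. complex_of_real (measure lborel (snd y)) * h (fst y)))
     = norm (\<Sum>y\<in>p. integral (snd y) h - complex_of_real (measure lborel (snd y)) * h (fst y))"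
    by (simp add: sum_subtractf case_prod_unfold)
  also have "\<dots> \<le> (\<Sum>y\<in>p. e * measure lborel (snd y))"
  proof (rule sum_norm_le)
    fix y assume y: "y \<in> p"
    obtain x K where y': "y = (x, K)" by force
    obtain c d where K: "K = cbox c d" using tagged_division_ofD(4)[OF p] y y' by blast
    have "(h has_integral integral K h) (cbox c d)" using io[OF K] K by (simp add: has_integral_integral)
    moreover have "((\<lambda>w. h x) has_integral measure lborel (cbox c d) *\<^sub>R h x) (cbox c d)" by (rule has_integral_const)
    ultimately have "((\<lambda>w. h w - h x) has_integral integral K h - measure lborel (cbox c d) *\<^sub>R h x) (cbox c d)"
      by (rule has_integral_diff)
    then have "norm (integral K h - measure lborel (cbox c d) *\<^sub>R h x) \<le> e * measure lborel (cbox c d)"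
      using osc[of x K] y y' K e by (intro has_integral_bound) auto
    then show "norm (integral (snd y) h - complex_of_real (measure lborel (snd y)) * h (fst y)) \<le> e * measure lborel (snd y)"
      unfolding y' K by (simp add: scaleR_conv_of_real)
  qed
  also have "\<dots> = e * measure lborel ?Q"
    using additive_content_tagged_division[OF p] by (simp add: sum_distrib_left[symmetric] case_prod_unfold)
  finally have "norm (integral ?Q h - (\<Sum>y\<in>p. complex_of_real (measure lborel (snd y)) * h (fst y))) \<le> e * measure lborel ?Q" .
  with tail show ?thesis unfolding split
    using norm_triangle_ineq[of "integral ?Q h - (\<Sum>y\<in>p. complex_of_real (measure lborel (snd y)) * h (fst y))"
        "LINT w|lborel. indicator (- ?Q) w *\<^sub>R h w"]
    by (simp add: algebra_simps)
qed

text \<open>Dominated convergence along the cubes of half-width n, which eventually contain any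
  given point.\<close>

lemma integral_tail_small:
  fixes W :: "'b::euclidean_space \<Rightarrow> real"
  assumes W: "integrable lborel W" and "e > 0"
  shows "\<exists>a b. \<bar>LINT w|lborel. indicator (- cbox a b) w * W w\<bar> < e"
proof -
  let ?Q = "\<lambda>n::nat. cbox (- real n *\<^sub>R One) (real n *\<^sub>R One :: 'b)"
  have "(\<lambda>n. LINT w|lborel. indicator (- ?Q n) w * W w) \<longlonglongrightarrow> (LINT w|(lborel::'b measure). 0)"
  proof (rule integral_dominated_convergence[where w = "\<lambda>w. norm (W w)"])
    show "AE w in lborel. (\<lambda>n. indicator (- ?Q n) w * W w) \<longlonglongrightarrow> 0"
    proof (rule AE_I2)
      fix w :: 'b
      obtain N :: nat where N: "norm w \<le> real N" using real_arch_simple by blast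
      have "w \<in> ?Q n" if "n \<ge> N" for n
        unfolding mem_box
      proof
        fix i :: 'b assume i: "i \<in> Basis"
        have "- real n \<le> w \<bullet> i \<and> w \<bullet> i \<le> real n" using Basis_le_norm[OF i, of w] N that by linarith
        then show "(- real n *\<^sub>R One) \<bullet> i \<le> w \<bullet> i \<and> w \<bullet> i \<le> (real n *\<^sub>R One) \<bullet> i"
          using i by simp
      qed
      then have "\<forall>\<^sub>F n in sequentially. indicator (- ?Q n) w * W w = 0"
        unfolding eventually_sequentially by (intro exI[of _ N]) auto
      then show "(\<lambda>n. indicator (- ?Q n) w * W w) \<longlonglongrightarrow> 0" by (rule tendsto_eventually)
    qed
  qed (use W in \<open>auto simp: indicator_def\<close>)
  then have "(\<lambda>n. LINT w|lborel. indicator (- ?Q n) w * W w) \<longlonglongrightarrow> 0" by simp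
  then obtain n where "\<bar>LINT w|lborel. indicator (- ?Q n) w * W w\<bar> < e"
    using \<open>e > 0\<close> unfolding LIMSEQ_iff by force
  then show ?thesis by blast
qed

text \<open>The new bound splits into an integrable weight in the parameter and an arbitrary weight
  in t. It says that the integral of the family converges absolutely in every Schwartz
  seminorm.\<close>

locale integrable_schwartz_family = schwartz_family G
  for G :: "'b::euclidean_space \<Rightarrow> 'a::euclidean_space \<Rightarrow> complex" +
  assumes integrably_bounded: "set bs \<subseteq> Basis \<Longrightarrow>
      \<exists>C. \<forall>w t. norm (iter_partial bs (G w) t) \<le> C * decay (DIM('b) + 2) w * decay k t"
begin

lemma continuous_first: "set bs \<subseteq> Basis \<Longrightarrow> continuous_on UNIV (\<lambda>w. iter_partial bs (G w) t)"
  using continuous_on_compose2[OF jointly_continuous, of bs UNIV "\<lambda>w. (w, t)"] continuous_on_Pair[OF continuous_on_id continuous_on_const]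
  by auto

lemma integrable_iter_partial:
  assumes bs: "set bs \<subseteq> Basis"
  shows "integrable lborel (\<lambda>w. iter_partial bs (G w) t)"
proof -
  obtain C where C: "\<And>w t. norm (iter_partial bs (G w) t) \<le> C * decay (DIM('b) + 2) w * decay 0 t"
    using integrably_bounded[OF bs, of 0] by blast
  show ?thesis
    using C[of _ t] by (intro integrable_decay_bound[where k = "DIM('b) + 2" and C = C]
        borel_measurable_continuous_onI continuous_first bs) auto
qed

text \<open>Differentiation under the integral sign. Since \<open>\<psi>\<close> is already
  differentiable, the limit along the single sequence \<open>s\<close> identifies its derivative;
  the mean value inequality and the bound on the next derivative give the majorant.\<close>

lemma iter_partial_integral:
  assumes \<psi>: "schwartz \<psi>" and eq: "\<And>t. \<psi> t = (LINT w|lborel. G w t)" and bs: "set bs \<subseteq> Basis"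
  shows "iter_partial bs \<psi> t = (LINT w|lborel. iter_partial bs (G w) t)"
  using bs
proof (induction bs arbitrary: t)
  case Nil
  then show ?case by (simp add: eq)
next
  case (Cons b bs)
  then have bs': "set bs \<subseteq> Basis" and b: "b \<in> Basis" by auto
  have b1: "norm b = 1" using b by simp
  define s where "s n = inverse (real (Suc n))" for n
  have s: "\<And>n. s n > 0" "s \<longlonglongrightarrow> 0"
    unfolding s_def using LIMSEQ_inverse_real_of_nat by auto
  obtain C where C: "\<And>w t. norm (iter_partial (b # bs) (G w) t) \<le> C * decay (DIM('b) + 2) w * decay 0 t"
    using integrably_bounded[OF Cons.prems, of 0] by blast
  have 1: "(\<lambda>n. (iter_partial bs \<psi> (t + s n *\<^sub>R b) - iter_partial bs \<psi> t) /\<^sub>R s n)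
     \<longlonglongrightarrow> iter_partial (b # bs) \<psi> t"
    using has_derivative_directional_limit[OF schwartz_has_derivative[OF \<psi> bs'] b1 s] by simp
  have 2: "(\<lambda>n. LINT w|lborel. (iter_partial bs (G w) (t + s n *\<^sub>R b) - iter_partial bs (G w) t) /\<^sub>R s n)
     \<longlonglongrightarrow> (LINT w|lborel. iter_partial (b # bs) (G w) t)"
  proof (rule integral_dominated_convergence[where w = "\<lambda>w. C * decay (DIM('b) + 2) w"])
    show "AE w in lborel. (\<lambda>n. (iter_partial bs (G w) (t + s n *\<^sub>R b) - iter_partial bs (G w) t) /\<^sub>R s n)
        \<longlonglongrightarrow> iter_partial (b # bs) (G w) t"
      using has_derivative_directional_limit[OF schwartz_has_derivative[OF schwartz_member bs'] b1 s]
      by (intro AE_I2) simp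
    show "AE w in lborel. norm ((iter_partial bs (G w) (t + s n *\<^sub>R b) - iter_partial bs (G w) t) /\<^sub>R s n)
        \<le> C * decay (DIM('b) + 2) w" for n
    proof (rule AE_I2)
      fix w
      have "norm (iter_partial bs (G w) (t + s n *\<^sub>R b) - iter_partial bs (G w) t) \<le> C * decay (DIM('b) + 2) w * s n"
        using C by (intro directional_increment_bound[OF schwartz_has_derivative[OF schwartz_member bs'] s(1)]) auto
      then show "norm ((iter_partial bs (G w) (t + s n *\<^sub>R b) - iter_partial bs (G w) t) /\<^sub>R s n)
        \<le> C * decay (DIM('b) + 2) w" using s(1)[of n] by (simp add: divide_inverse_commute[symmetric] pos_divide_le_eq)
    qed
    show "(\<lambda>w. (iter_partial bs (G w) (t + s n *\<^sub>R b) - iter_partial bs (G w) t) /\<^sub>R s n) \<in> borel_measurable lborel" for n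
      by (simp, intro borel_measurable_continuous_onI continuous_intros continuous_first bs')
    show "(\<lambda>w. iter_partial (b # bs) (G w) t) \<in> borel_measurable lborel"
      using borel_measurable_continuous_onI[OF continuous_first[OF Cons.prems]] by simp
    show "integrable lborel (\<lambda>w::'b. C * decay (DIM('b) + 2) w)"
      using integrable_decay[of "DIM('b) + 2", where 'a = 'b] by simp
  qed
  have "(LINT w|lborel. (iter_partial bs (G w) (t + s n *\<^sub>R b) - iter_partial bs (G w) t) /\<^sub>R s n)
     = (iter_partial bs \<psi> (t + s n *\<^sub>R b) - iter_partial bs \<psi> t) /\<^sub>R s n" for n
    using integrable_iter_partial[OF bs'] by (simp add: Cons.IH[OF bs'])
  from 2[unfolded this] have "(\<lambda>n. (iter_partial bs \<psi> (t + s n *\<^sub>R b) - iter_partial bs \<psi> t) /\<^sub>R s n)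
     \<longlonglongrightarrow> (LINT w|lborel. iter_partial (b # bs) (G w) t)" .
  with 1 show ?case by (rule LIMSEQ_unique)
qed

text \<open>The same Riemann sums are used twice: as functions of t they approximate
  \<open>\<psi>\<close> in the seminorms that control \<open>u\<close>, and after applying
  \<open>u\<close>, which is linear on finite sums, they approximate the integral of
  \<open>u (G w)\<close>.\<close>

theorem tempered_distribution_integral:
  assumes u: "tempered_distribution u"
    and \<psi>: "schwartz \<psi>" and eq: "\<And>t. \<psi> t = (LINT w|lborel. G w t)"
  shows "integrable lborel (\<lambda>w. u (G w))" and "u \<psi> = (LINT w|lborel. u (G w))"
proof -
  obtain Cu m k where Cu: "Cu \<ge> 0" "order_bound u Cu m k"
    by (rule tempered_distribution_bound[OF u])
  let ?B = "{bs :: 'a list. set bs \<subseteq> Basis \<and> length bs \<le> m}"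
  let ?W = "decay (DIM('b) + 2) :: 'b \<Rightarrow> real"
  have "\<forall>bs\<in>?B. \<exists>C. \<forall>w t. norm (iter_partial bs (G w) t) \<le> C * ?W w * decay k t"
    using integrably_bounded by blast
  from bchoice[OF this] obtain c where
    c: "\<And>bs w t. bs \<in> ?B \<Longrightarrow> norm (iter_partial bs (G w) t) \<le> c bs * ?W w * decay k t"
    by blast
  \<comment> \<open>One constant for the finitely many derivatives that the order of
    \<open>u\<close> involves.\<close>
  define C where "C = (\<Sum>bs\<in>?B. \<bar>c bs\<bar>)"
  have C0: "C \<ge> 0" unfolding C_def by (intro sum_nonneg) auto
  have C: "norm (iter_partial bs (G w) t) \<le> C * ?W w * decay k t" if bs: "set bs \<subseteq> Basis" "length bs \<le> m" for bs w t
  proof -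
    have "c bs \<le> C" unfolding C_def
      using member_le_sum[of bs ?B "\<lambda>bs. \<bar>c bs\<bar>"] finite_bounded_index_lists[of m, where 'a = 'a] bs by simp
    then have "c bs * ?W w * decay k t \<le> C * ?W w * decay k t" by (intro mult_right_mono) auto
    with c[of bs w t] bs show ?thesis by (auto intro: order_trans)
  qed
  have W: "integrable lborel ?W" by (rule integrable_decay) simp
  have uG: "norm (u (G w)) \<le> Cu * (C * ?W w)" for w
    using C by (intro order_boundD[OF Cu(2)] schwartz_member) auto
  have cont: "continuous_on UNIV (\<lambda>w. u (G w))" by (rule tempered_continuous[OF u])
  show int: "integrable lborel (\<lambda>w. u (G w))"
    using uG by (intro integrable_decay_bound[where k = "DIM('b) + 2" and C = "Cu * C"]
        borel_measurable_continuous_onI cont) (auto simp: mult.assoc)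
  \<comment> \<open>Each of the two approximations costs 2 e up to the factor \<open>Cu\<close>: one
    e for the tail outside the box, one for the oscillation inside.\<close>
  have close: "norm (u \<psi> - (LINT w|lborel. u (G w))) \<le> 4 * Cu * e" if "e > 0" for e
  proof -
    obtain a b where tail: "\<bar>LINT w|lborel. indicator (- cbox a b) w * (C * ?W w)\<bar> < e"
      using integral_tail_small[of "\<lambda>w. C * ?W w" e] W \<open>e > 0\<close> by auto
    let ?T = "LINT w|lborel. indicator (- cbox a b) w * (C * ?W w)"
    \<comment> \<open>The oscillation is multiplied by the volume of the box; the added 1 allows a
      degenerate box.\<close>
    define e' where "e' = e / (1 + measure lborel (cbox a b))"
    have e': "e' > 0" "e' * measure lborel (cbox a b) \<le> e"
      unfolding e'_def using \<open>e > 0\<close> by (auto simp: divide_le_eq field_simps add_pos_nonneg)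
    obtain d where d: "d > 0" "\<forall>w\<in>cbox a b. \<forall>w'\<in>cbox a b. dist w w' < d \<longrightarrow>
      (\<forall>bs t. set bs \<subseteq> Basis \<longrightarrow> length bs \<le> m \<longrightarrow>
       norm (iter_partial bs (G w) t - iter_partial bs (G w') t) \<le> e' * decay k t)"
      using uniformly_close[OF compact_cbox e'(1), of a b m k] by (elim exE conjE)
    obtain p where p: "p tagged_division_of cbox a b" "(\<lambda>x. ball x d) fine p"
      using fine_division_exists[OF gauge_ball[OF d(1)]] by blast
    have fin: "finite p" using p(1) by (rule tagged_division_of_finite)
    have osc: "norm (iter_partial bs (G w) t - iter_partial bs (G x) t) \<le> e' * decay k t"
      if "(x, K) \<in> p" "w \<in> K" "set bs \<subseteq> Basis" "length bs \<le> m" for x K w bs t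
    proof -
      have "K \<subseteq> cbox a b" "x \<in> K" "K \<subseteq> ball x d"
        using tagged_division_ofD(2,3)[OF p(1) that(1)] fineD[OF p(2) that(1)] by auto
      then show ?thesis using d(2) that by (auto simp: subset_iff dist_commute)
    qed
    define \<psi>a where "\<psi>a = (\<lambda>t. \<Sum>y\<in>p. complex_of_real (measure lborel (snd y)) * G (fst y) t)"
    have \<psi>a: "schwartz \<psi>a" unfolding \<psi>a_def by (intro schwartz_sum fin schwartz_member)
    have "norm (u (\<lambda>t. \<psi> t - \<psi>a t)) \<le> Cu * (2 * e)"
    proof (rule order_boundD[OF Cu(2) schwartz_diff[OF \<psi> \<psi>a]])
      fix bs :: "'a list" and t assume bs: "set bs \<subseteq> Basis" "length bs \<le> m"
      have "norm ((LINT w|lborel. iter_partial bs (G w) t) - (\<Sum>y\<in>p. complex_of_real (measure lborel (snd y)) * iter_partial bs (G (fst y)) t))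
        \<le> (LINT w|lborel. indicator (- cbox a b) w * (C * ?W w * decay k t)) + (e' * decay k t) * measure lborel (cbox a b)"
        using C[OF bs] osc bs e'(1) W
        by (intro riemann_sum_error[OF integrable_iter_partial continuous_first _ _ p(1)]) auto
      also have "(LINT w|lborel. indicator (- cbox a b) w * (C * ?W w * decay k t)) = ?T * decay k t"
        by (subst integral_mult_left_zero[symmetric]) (simp add: mult_ac)
      also have "?T * decay k t + (e' * decay k t) * measure lborel (cbox a b) = (?T + e' * measure lborel (cbox a b)) * decay k t"
        by (simp add: algebra_simps)
      also have "\<dots> \<le> (2 * e) * decay k t" using tail e'(2) by (intro mult_right_mono) auto
      finally show "norm (iter_partial bs (\<lambda>t. \<psi> t - \<psi>a t) t) \<le> 2 * e * decay k t"
        \<comment> \<open>A derivative of the error is itself the error of a Riemann sum for the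
          differentiated family, so the preceding estimate applies to it.\<close>
        unfolding iter_partial_diff[OF \<psi> \<psi>a bs(1)] iter_partial_integral[OF \<psi> eq bs(1)]
        unfolding \<psi>a_def iter_partial_sum[OF fin schwartz_member bs(1)] .
    qed
    then have 1: "norm (u \<psi> - u \<psi>a) \<le> 2 * Cu * e"
      unfolding tempered_distribution_diff[OF u \<psi> \<psi>a] by simp
    have 2: "u \<psi>a = (\<Sum>y\<in>p. complex_of_real (measure lborel (snd y)) * u (G (fst y)))"
      unfolding \<psi>a_def by (rule tempered_distribution_sum[OF u fin schwartz_member])
    have "norm ((LINT w|lborel. u (G w)) - u \<psi>a)
       \<le> (LINT w|lborel. indicator (- cbox a b) w * (Cu * (C * ?W w))) + (Cu * e') * measure lborel (cbox a b)"
      unfolding 2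
    proof (rule riemann_sum_error[OF int cont _ uG p(1)])
      show "integrable lborel (\<lambda>w. Cu * (C * ?W w))" using W by simp
      show "Cu * e' \<ge> 0" using Cu(1) e'(1) by simp
      fix x K w assume *: "(x, K) \<in> p" "w \<in> K"
      have "norm (u (\<lambda>t. G w t - G x t)) \<le> Cu * e'"
        using osc[OF *] by (intro order_boundD[OF Cu(2)] schwartz_diff schwartz_member) (auto simp: iter_partial_diff schwartz_member)
      then show "norm (u (G w) - u (G x)) \<le> Cu * e'"
        by (simp add: tempered_distribution_diff[OF u schwartz_member schwartz_member])
    qed
    also have "(LINT w|lborel. indicator (- cbox a b) w * (Cu * (C * ?W w))) = Cu * ?T"
      by (subst integral_mult_right_zero[symmetric]) (simp add: mult_ac)
    also have "Cu * ?T + (Cu * e') * measure lborel (cbox a b) = Cu * (?T + e' * measure lborel (cbox a b))"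
      by (simp add: algebra_simps)
    also have "\<dots> \<le> Cu * (2 * e)" using tail e'(2) Cu(1) by (intro mult_left_mono) auto
    finally have "norm ((LINT w|lborel. u (G w)) - u \<psi>a) \<le> 2 * Cu * e" by simp
    with 1 show ?thesis
      using norm_triangle_ineq[of "u \<psi> - u \<psi>a" "u \<psi>a - (LINT w|lborel. u (G w))"]
      by (simp add: norm_minus_commute)
  qed
  have small: "norm (u \<psi> - (LINT w|lborel. u (G w))) \<le> 0 + e" if "e > 0" for e
  proof -
    have "4 * Cu * (e / (4 * Cu + 1)) \<le> e" using that Cu(1) by (simp add: divide_le_eq field_simps)
    with close[of "e / (4 * Cu + 1)"] that Cu(1) show ?thesis by simp
  qed
  have "norm (u \<psi> - (LINT w|lborel. u (G w))) \<le> 0" by (rule field_le_epsilon, rule small)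
  then show "u \<psi> = (LINT w|lborel. u (G w))" by simp
qed

end


section \<open>Decay of the short-time Fourier transform\<close>

lemma nn_integral_euclidean_affine:
  fixes f :: "'a::euclidean_space \<Rightarrow> ennreal"
  assumes [measurable]: "f \<in> borel_measurable borel" and "c \<noteq> 0"
  shows "(\<integral>\<^sup>+x. f x \<partial>lborel) = ennreal (\<bar>c\<bar> ^ DIM('a)) * (\<integral>\<^sup>+x. f (t + c *\<^sub>R x) \<partial>lborel)"
  by (subst lborel_affine[OF \<open>c \<noteq> 0\<close>, of t])
     (simp add: nn_integral_density nn_integral_distr nn_integral_cmult)

lemma integrable_euclidean_affine:
  fixes f :: "'a::euclidean_space \<Rightarrow> 'b::{banach, second_countable_topology}"
  assumes "integrable lborel f" and "c \<noteq> 0"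
  shows "integrable lborel (\<lambda>x. f (t + c *\<^sub>R x))"
  using assms(1) assms(1)[THEN borel_measurable_integrable] \<open>c \<noteq> 0\<close> unfolding integrable_iff_bounded
  by (subst (asm) nn_integral_euclidean_affine[where c = c and t = t]) (auto simp: ennreal_mult_less_top)

lemma lborel_integral_euclidean_affine:
  fixes f :: "'a::euclidean_space \<Rightarrow> 'b::{banach, second_countable_topology}"
  assumes [measurable]: "f \<in> borel_measurable borel" and "c \<noteq> 0"
  shows "(LINT x|lborel. f x) = \<bar>c\<bar> ^ DIM('a) *\<^sub>R (LINT x|lborel. f (t + c *\<^sub>R x))"
  by (subst lborel_affine[OF \<open>c \<noteq> 0\<close>, of t])
     (simp add: integral_density integral_distr)

lemma lborel_integral_translate:
  fixes f :: "'a::euclidean_space \<Rightarrow> 'b::{banach, second_countable_topology}"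
  assumes "f \<in> borel_measurable borel"
  shows "(LINT x|lborel. f (x + t)) = (LINT x|lborel. f x)"
  using lborel_integral_euclidean_affine[OF assms, of 1 t] by (simp add: add.commute)

lemma integrable_translate:
  fixes f :: "'a::euclidean_space \<Rightarrow> 'b::{banach, second_countable_topology}"
  assumes "integrable lborel f"
  shows "integrable lborel (\<lambda>x. f (x + t))"
  using integrable_euclidean_affine[OF assms, of 1 t] by (simp add: add.commute)

lemma nn_integral_translate:
  fixes f :: "'a::euclidean_space \<Rightarrow> ennreal"
  assumes "f \<in> borel_measurable borel"
  shows "(\<integral>\<^sup>+x. f (x + t) \<partial>lborel) = (\<integral>\<^sup>+x. f x \<partial>lborel)"
  using nn_integral_euclidean_affine[OF assms, of 1 t] by (simp add: add.commute)

lemma lborel_integral_reflect: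
  fixes f :: "'a::euclidean_space \<Rightarrow> 'b::{banach, second_countable_topology}"
  assumes "f \<in> borel_measurable borel"
  shows "(LINT x|lborel. f (t - x)) = (LINT x|lborel. f x)"
  using lborel_integral_euclidean_affine[OF assms, of "-1" t] by simp

lemma integrable_reflect:
  fixes f :: "'a::euclidean_space \<Rightarrow> 'b::{banach, second_countable_topology}"
  assumes "integrable lborel f"
  shows "integrable lborel (\<lambda>x. f (t - x))"
  using integrable_euclidean_affine[OF assms, of "-1" t] by simp

lemma nn_integral_reflect:
  fixes f :: "'a::euclidean_space \<Rightarrow> ennreal"
  assumes "f \<in> borel_measurable borel"
  shows "(\<integral>\<^sup>+x. f (t - x) \<partial>lborel) = (\<integral>\<^sup>+x. f x \<partial>lborel)"
  using nn_integral_euclidean_affine[OF assms, of "-1" t] by simp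

text \<open>By translation invariance every difference quotient of \<open>H\<close> has integral 0,
  and dominated convergence passes this to the derivative. This is integration by parts without
  boundary terms or iterated integrals.\<close>

lemma integral_directional_derivative_eq_0:
  fixes H :: "'a::euclidean_space \<Rightarrow> complex"
  assumes d: "\<And>t. (H has_derivative H' t) (at t)" and e: "norm e = 1"
    and cont: "continuous_on UNIV (\<lambda>t. H' t e)"
    and b1: "\<And>t. norm (H t) \<le> C * decay (DIM('a) + 2) t"
    and b2: "\<And>t. norm (H' t e) \<le> C * decay (DIM('a) + 2) t"
  shows "(LINT t|lborel. H' t e) = 0"
proof -
  let ?k = "DIM('a) + 2"
  have "0 \<le> C * decay ?k (0::'a)" using order_trans[OF norm_ge_zero b1] .
  then have C: "C \<ge> 0" using decay_pos[of ?k "0::'a"] by (simp add: zero_le_mult_iff del: decay_pos)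
  have contH: "continuous_on UNIV H"
    using d by (intro has_derivative_continuous_on) (auto simp: has_derivative_at_withinI)
  have mH: "H \<in> borel_measurable borel" by (rule borel_measurable_continuous_onI[OF contH])
  have iH: "integrable lborel H"
    by (rule integrable_decay_bound[OF mH order_refl b1])
  define s where "s n = inverse (real (Suc n))" for n
  have s: "\<And>n. s n > 0" "s \<longlonglongrightarrow> 0" "\<And>n. s n \<le> 1"
    unfolding s_def using LIMSEQ_inverse_real_of_nat by (auto simp: field_simps)
  have lim: "(\<lambda>n. LINT t|lborel. (H (t + s n *\<^sub>R e) - H t) /\<^sub>R s n) \<longlonglongrightarrow> (LINT t|lborel. H' t e)"
  \<comment> \<open>The steps have length at most 1, so Peetre's inequality costs at most
    2^k.\<close>
  proof (rule integral_dominated_convergence[where w = "\<lambda>t. C * 2 ^ ?k * decay ?k t"])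
    show "integrable lborel (\<lambda>t::'a. C * 2 ^ ?k * decay ?k t)"
      using integrable_decay[of ?k, where 'a = 'a] by simp
    show "AE t in lborel. (\<lambda>n. (H (t + s n *\<^sub>R e) - H t) /\<^sub>R s n) \<longlonglongrightarrow> H' t e"
      using has_derivative_directional_limit[OF d e s(1,2)] by (intro AE_I2) simp
    show "AE t in lborel. norm ((H (t + s n *\<^sub>R e) - H t) /\<^sub>R s n) \<le> C * 2 ^ ?k * decay ?k t" for n
    proof (rule AE_I2)
      fix t
      have "norm (H (t + s n *\<^sub>R e) - H t) \<le> C * 2 ^ ?k * decay ?k t * s n"
      proof (rule directional_increment_bound[OF d s(1)])
        fix r assume r: "0 \<le> r" "r \<le> s n"
        have "norm (H' (t + r *\<^sub>R e) e) \<le> C * decay ?k (t + r *\<^sub>R e)" by (rule b2)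
        also have "\<dots> \<le> C * ((1 + norm (r *\<^sub>R e)) ^ ?k * decay ?k t)"
          by (intro mult_left_mono decay_add_arg C)
        also have "\<dots> \<le> C * (2 ^ ?k * decay ?k t)"
        proof (intro mult_left_mono mult_right_mono power_mono C)
          show "1 + norm (r *\<^sub>R e) \<le> 2" using r s(3)[of n] e by simp
        qed auto
        finally show "norm (H' (t + r *\<^sub>R e) e) \<le> C * 2 ^ ?k * decay ?k t" by simp
      qed
      then show "norm ((H (t + s n *\<^sub>R e) - H t) /\<^sub>R s n) \<le> C * 2 ^ ?k * decay ?k t"
        using s(1)[of n] by (simp add: divide_inverse_commute[symmetric] pos_divide_le_eq)
    qed
    show "(\<lambda>t. (H (t + s n *\<^sub>R e) - H t) /\<^sub>R s n) \<in> borel_measurable lborel" for n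
      using mH by simp
    show "(\<lambda>t. H' t e) \<in> borel_measurable lborel"
      using borel_measurable_continuous_onI[OF cont] by simp
  qed
  have zero: "(LINT t|lborel. (H (t + s n *\<^sub>R e) - H t) /\<^sub>R s n) = 0" for n
    using iH integrable_translate[OF iH] lborel_integral_translate[OF mH] by simp
  from lim[unfolded zero] have "(\<lambda>n. 0) \<longlonglongrightarrow> (LINT t|lborel. H' t e)" .
  from LIMSEQ_unique[OF this tendsto_const] show ?thesis by simp
qed

text \<open>Peetre's inequality for x = t + (x - t): bumps around 0 and around x overlap little when
  x is large. It is the source of the decay in position.\<close>

lemma decay_triangle: "decay m (t::'a::real_normed_vector) * decay m (t - x) \<le> decay m x"
proof -
  have "1 + norm x \<le> (1 + norm t) * (1 + norm (t - x))"
    using one_plus_norm_add[of t "x - t"] by (simp add: norm_minus_commute)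
  then have "(1 + norm x) ^ m \<le> ((1 + norm t) * (1 + norm (t - x))) ^ m"
    by (intro power_mono) (auto simp: add_pos_nonneg)
  then have "1 / ((1 + norm t) * (1 + norm (t - x))) ^ m \<le> 1 / (1 + norm x) ^ m"
    by (intro divide_left_mono mult_pos_pos zero_less_power) (auto simp: add_pos_nonneg)
  then show ?thesis unfolding decay_def by (simp add: power_mult_distrib)
qed

text \<open>The integrals that arise from the short-time Fourier transform of \<open>\<psi>\<close> with window \<open>\<phi>\<close> by
  integration by parts.\<close>

definition stft_partial ::
    "('a::euclidean_space \<Rightarrow> complex) \<Rightarrow> ('a \<Rightarrow> complex) \<Rightarrow> 'a list \<Rightarrow> 'a list \<Rightarrow> 'a \<Rightarrow> 'a \<Rightarrow> complex" where
  "stft_partial \<psi> \<phi> as bs x \<omega> =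
     (LINT t|lborel. cis (\<omega> \<bullet> t) * (iter_partial as \<psi> t * cnj (iter_partial bs \<phi> (t - x))))"

context
  fixes \<psi> \<phi> :: "'a::euclidean_space \<Rightarrow> complex"
  assumes \<psi>: "schwartz \<psi>" and \<phi>: "schwartz \<phi>"
begin

text \<open>Of the d + 2 + m powers of decay of \<open>\<psi>\<close>, d + 2 keep the integrand
  integrable in t, and m are combined with the decay of \<open>\<phi>\<close> into decay in
  x.\<close>

lemma stft_integrand_bound:
  assumes "set as \<subseteq> Basis" "set bs \<subseteq> Basis"
  shows "\<exists>C\<ge>0. \<forall>t x. norm (iter_partial as \<psi> t * cnj (iter_partial bs \<phi> (t - x)))
      \<le> C * (decay (DIM('a) + 2) t * decay m x)"
proof -
  let ?k = "DIM('a) + 2"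
  obtain C1 C2 where C: "C1 > 0" "\<And>t. norm (iter_partial as \<psi> t) \<le> C1 * decay (?k + m) t"
    "C2 > 0" "\<And>t. norm (iter_partial bs \<phi> t) \<le> C2 * decay m t"
    using schwartz_decay[OF \<psi> assms(1), of "?k + m"] schwartz_decay[OF \<phi> assms(2), of m] by blast
  have "norm (iter_partial as \<psi> t * cnj (iter_partial bs \<phi> (t - x))) \<le> C1 * C2 * (decay ?k t * decay m x)" for t x
  proof -
    have "norm (iter_partial as \<psi> t * cnj (iter_partial bs \<phi> (t - x)))
       \<le> (C1 * decay (?k + m) t) * (C2 * decay m (t - x))"
      unfolding norm_mult complex_mod_cnj using C by (intro mult_mono) auto
    also have "\<dots> = C1 * C2 * (decay ?k t * (decay m t * decay m (t - x)))"
      by (simp only: decay_add mult_ac)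
    also have "\<dots> \<le> C1 * C2 * (decay ?k t * decay m x)"
      using C by (intro mult_left_mono decay_triangle) auto
    finally show ?thesis .
  qed
  then show ?thesis using C by (intro exI[of _ "C1 * C2"]) auto
qed

lemma stft_integrand_continuous:
  assumes "set as \<subseteq> Basis" "set bs \<subseteq> Basis"
  shows "continuous_on UNIV (\<lambda>t. cis (\<omega> \<bullet> t) * (iter_partial as \<psi> t * cnj (iter_partial bs \<phi> (t - x))))"
  by (intro continuous_intros schwartz_continuous[OF \<psi> assms(1)]
      continuous_on_compose2[OF schwartz_continuous[OF \<phi> assms(2), of UNIV]]) auto

lemma stft_integrand_integrable:
  assumes "set as \<subseteq> Basis" "set bs \<subseteq> Basis"
  shows "integrable lborel (\<lambda>t. cis (\<omega> \<bullet> t) * (iter_partial as \<psi> t * cnj (iter_partial bs \<phi> (t - x))))"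
proof -
  obtain C where "C \<ge> 0" "\<And>t x. norm (iter_partial as \<psi> t * cnj (iter_partial bs \<phi> (t - x)))
      \<le> C * (decay (DIM('a) + 2) t * decay 0 x)"
    using stft_integrand_bound[OF assms, of 0] by blast
  then show ?thesis
    by (intro integrable_decay_bound[where k = "DIM('a) + 2" and C = C]
        borel_measurable_continuous_onI stft_integrand_continuous assms) (auto simp: norm_mult)
qed

lemma stft_partial_decay_position:
  assumes "set as \<subseteq> Basis" "set bs \<subseteq> Basis"
  shows "\<exists>C\<ge>0. \<forall>x \<omega>. norm (stft_partial \<psi> \<phi> as bs x \<omega>) \<le> C * decay m x"
proof -
  let ?k = "DIM('a) + 2"
  obtain C where C: "C \<ge> 0" "\<And>t x. norm (iter_partial as \<psi> t * cnj (iter_partial bs \<phi> (t - x)))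
      \<le> C * (decay ?k t * decay m x)"
    using stft_integrand_bound[OF assms, of m] by blast
  let ?J = "LINT t|lborel. decay ?k (t::'a)"
  have J: "?J \<ge> 0" by (intro integral_nonneg_AE) auto
  have i: "integrable lborel (decay ?k :: 'a \<Rightarrow> real)" by (intro integrable_decay) simp
  have "norm (stft_partial \<psi> \<phi> as bs x \<omega>) \<le> C * ?J * decay m x" for x \<omega>
  proof -
    have "norm (stft_partial \<psi> \<phi> as bs x \<omega>)
      \<le> (LINT t|lborel. norm (cis (\<omega> \<bullet> t) * (iter_partial as \<psi> t * cnj (iter_partial bs \<phi> (t - x)))))"
      unfolding stft_partial_def by (rule integral_norm_bound)
    also have "\<dots> \<le> (LINT t|lborel. (C * decay m x) * decay ?k (t::'a))"
      using C(2) i by (intro integral_mono integrable_norm stft_integrand_integrable assms)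
         (auto simp: norm_mult mult_ac)
    also have "\<dots> = C * ?J * decay m x" by simp
    finally show ?thesis .
  qed
  then show ?thesis using C(1) J by (intro exI[of _ "C * ?J"]) auto
qed

text \<open>The product rule has three terms with total integral 0. Solving for the one in which the
  exponential is differentiated trades a factor of frequency for a derivative of
  \<open>\<psi>\<close> or \<open>\<phi>\<close>.\<close>

lemma stft_partial_by_parts:
  assumes e: "e \<in> Basis" and as: "set as \<subseteq> Basis" and bs: "set bs \<subseteq> Basis"
  shows "\<i> * complex_of_real (\<omega> \<bullet> e) * stft_partial \<psi> \<phi> as bs x \<omega>
    = - (stft_partial \<psi> \<phi> (e # as) bs x \<omega> + stft_partial \<psi> \<phi> as (e # bs) x \<omega>)"
proof -
  let ?k = "DIM('a) + 2"
  have as': "set (e # as) \<subseteq> Basis" and bs': "set (e # bs) \<subseteq> Basis" using e as bs by auto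
  let ?E = "\<lambda>t. cis (\<omega> \<bullet> t)" and ?P = "\<lambda>cs t. iter_partial cs \<psi> t" and ?Q = "\<lambda>cs t. cnj (iter_partial cs \<phi> (t - x))"
  let ?H = "\<lambda>t. ?E t * (?P as t * ?Q bs t)"
  let ?H' = "\<lambda>t h. ?E t * (?P as t * cnj (frechet_derivative (iter_partial bs \<phi>) (at (t - x)) h)
       + frechet_derivative (iter_partial as \<psi>) (at t) h * ?Q bs t)
     + \<i> * complex_of_real (\<omega> \<bullet> h) * ?E t * (?P as t * ?Q bs t)"
  let ?D = "\<lambda>t. ?E t * (?P as t * ?Q (e # bs) t) + ?E t * (?P (e # as) t * ?Q bs t)
     + \<i> * complex_of_real (\<omega> \<bullet> e) * (?E t * (?P as t * ?Q bs t))"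
  have H'e: "?H' t e = ?D t" for t by (simp add: algebra_simps)
  have d: "(?H has_derivative ?H' t) (at t)" for t
    by (intro has_derivative_mult has_derivative_cis_inner schwartz_has_derivative[OF \<psi> as]
        has_derivative_cnj schwartz_shift_has_derivative[OF \<phi> bs])
  obtain C0 where C0: "C0 \<ge> 0" "\<And>t x. norm (?P as t * cnj (iter_partial bs \<phi> (t - x))) \<le> C0 * (decay ?k t * decay 0 x)"
    using stft_integrand_bound[OF as bs, of 0] by blast
  obtain C1 where C1: "C1 \<ge> 0" "\<And>t x. norm (?P (e # as) t * cnj (iter_partial bs \<phi> (t - x))) \<le> C1 * (decay ?k t * decay 0 x)"
    using stft_integrand_bound[OF as' bs, of 0] by blast
  obtain C2 where C2: "C2 \<ge> 0" "\<And>t x. norm (?P as t * cnj (iter_partial (e # bs) \<phi> (t - x))) \<le> C2 * (decay ?k t * decay 0 x)"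
    using stft_integrand_bound[OF as bs', of 0] by blast
  \<comment> \<open>One constant has to dominate both the product and its derivative. It may depend
    on the frequency, since it serves only to justify that an integral vanishes.\<close>
  define C where "C = C0 + C1 + C2 + \<bar>\<omega> \<bullet> e\<bar> * C0"
  have "(LINT t|lborel. ?H' t e) = 0"
  proof (rule integral_directional_derivative_eq_0[OF d, where C = C])
    show "norm e = 1" using e by simp
    show "continuous_on UNIV (\<lambda>t. ?H' t e)"
      unfolding H'e by (intro continuous_on_add continuous_on_mult[OF continuous_on_const] stft_integrand_continuous as as' bs bs')
    fix t
    have n0: "norm (?E t * (?P as t * ?Q bs t)) \<le> C0 * decay ?k t"
      and n1: "norm (?E t * (?P (e # as) t * ?Q bs t)) \<le> C1 * decay ?k t"
      and n2: "norm (?E t * (?P as t * ?Q (e # bs) t)) \<le> C2 * decay ?k t"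
      using C0(2)[of t x] C1(2)[of t x] C2(2)[of t x] by (simp_all add: norm_mult del: iter_partial.simps)
    have "C0 \<le> C" unfolding C_def using C0(1) C1(1) C2(1) by simp
    from n0 mult_right_mono[OF this decay_nonneg[of ?k t]] show "norm (?H t) \<le> C * decay ?k t" by (rule order_trans)
    have n3: "norm (\<i> * complex_of_real (\<omega> \<bullet> e) * (?E t * (?P as t * ?Q bs t))) \<le> \<bar>\<omega> \<bullet> e\<bar> * (C0 * decay ?k t)"
      unfolding norm_mult[of "\<i> * complex_of_real (\<omega> \<bullet> e)"] using n0 by (simp add: norm_mult[of \<i>] mult_left_mono)
    have "norm (?H' t e) \<le> C2 * decay ?k t + C1 * decay ?k t + \<bar>\<omega> \<bullet> e\<bar> * (C0 * decay ?k t)"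
      unfolding H'e by (intro norm_triangle_mono n1 n2 n3)
    also have "\<dots> \<le> C * decay ?k t"
      unfolding C_def using C0(1) by (simp add: distrib_right)
    finally show "norm (?H' t e) \<le> C * decay ?k t" .
  qed
  then have "(LINT t|lborel. ?D t) = 0" unfolding H'e .
  moreover have "(LINT t|lborel. ?D t) = stft_partial \<psi> \<phi> as (e # bs) x \<omega> + stft_partial \<psi> \<phi> (e # as) bs x \<omega>
     + \<i> * complex_of_real (\<omega> \<bullet> e) * stft_partial \<psi> \<phi> as bs x \<omega>"
    unfolding stft_partial_def
    using stft_integrand_integrable[OF as bs, of \<omega> x] stft_integrand_integrable[OF as' bs, of \<omega> x] stft_integrand_integrable[OF as bs', of \<omega> x]
    by (simp del: iter_partial.simps)
  ultimately show ?thesis by (simp add: algebra_simps add_eq_0_iff)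
qed

text \<open>Every integration by parts gains one power and adds one derivative, so the induction has
  to vary \<open>as\<close> and \<open>bs\<close>.\<close>

lemma stft_partial_decay_direction:
  assumes e: "e \<in> Basis" and "set as \<subseteq> Basis" "set bs \<subseteq> Basis"
  shows "\<exists>C\<ge>0. \<forall>x \<omega>. \<bar>\<omega> \<bullet> e\<bar> ^ m * norm (stft_partial \<psi> \<phi> as bs x \<omega>) \<le> C"
  using assms(2,3)
proof (induction m arbitrary: as bs)
  case 0
  then show ?case using stft_partial_decay_position[of as bs 0] by simp
next
  case (Suc m)
  have as': "set (e # as) \<subseteq> Basis" and bs': "set (e # bs) \<subseteq> Basis" using e Suc.prems by auto
  obtain C1 C2 where C: "C1 \<ge> 0" "\<And>x \<omega>. \<bar>\<omega> \<bullet> e\<bar> ^ m * norm (stft_partial \<psi> \<phi> (e # as) bs x \<omega>) \<le> C1"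
    "C2 \<ge> 0" "\<And>x \<omega>. \<bar>\<omega> \<bullet> e\<bar> ^ m * norm (stft_partial \<psi> \<phi> as (e # bs) x \<omega>) \<le> C2"
    using Suc.IH[OF as' Suc.prems(2)] Suc.IH[OF Suc.prems(1) bs'] by blast
  have "\<bar>\<omega> \<bullet> e\<bar> ^ Suc m * norm (stft_partial \<psi> \<phi> as bs x \<omega>) \<le> C1 + C2" for x \<omega>
  proof -
    have "\<bar>\<omega> \<bullet> e\<bar> ^ Suc m * norm (stft_partial \<psi> \<phi> as bs x \<omega>)
       = \<bar>\<omega> \<bullet> e\<bar> ^ m * norm (\<i> * complex_of_real (\<omega> \<bullet> e) * stft_partial \<psi> \<phi> as bs x \<omega>)"
      by (simp add: norm_mult mult_ac)
    also have "\<dots> \<le> \<bar>\<omega> \<bullet> e\<bar> ^ m * (norm (stft_partial \<psi> \<phi> (e # as) bs x \<omega>) + norm (stft_partial \<psi> \<phi> as (e # bs) x \<omega>))"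
      unfolding stft_partial_by_parts[OF e Suc.prems] norm_minus_cancel
      by (intro mult_left_mono norm_triangle_ineq) auto
    also have "\<dots> \<le> C1 + C2" using C(2)[of \<omega> x] C(4)[of \<omega> x] by (simp add: distrib_left del: iter_partial.simps)
    finally show ?thesis .
  qed
  then show ?case using C(1,3) by (intro exI[of _ "C1 + C2"]) auto
qed

text \<open>Some coordinate carries at least 1/d of the norm of the frequency, so the directional
  estimates suffice once the norm exceeds 1; below that the uniform bound \<open>C0\<close> is
  enough. The factor 2 absorbs the 1 in \<open>1 + norm \<omega>\<close>.\<close>

lemma stft_partial_decay_frequency:
  assumes as: "set as \<subseteq> Basis" and bs: "set bs \<subseteq> Basis"
  shows "\<exists>C\<ge>0. \<forall>x \<omega>. norm (stft_partial \<psi> \<phi> as bs x \<omega>) \<le> C * decay m \<omega>"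
proof -
  obtain C0 where C0: "C0 \<ge> 0" "\<And>x \<omega>. norm (stft_partial \<psi> \<phi> as bs x \<omega>) \<le> C0"
    using stft_partial_decay_position[OF as bs, of 0] by auto
  have "\<forall>e\<in>Basis. \<exists>C. C \<ge> 0 \<and> (\<forall>x \<omega>. \<bar>\<omega> \<bullet> e\<bar> ^ m * norm (stft_partial \<psi> \<phi> as bs x \<omega>) \<le> C)"
    using stft_partial_decay_direction[OF _ as bs] by blast
  from bchoice[OF this] obtain c where
    c: "\<And>e. e \<in> Basis \<Longrightarrow> c e \<ge> 0" "\<And>e x \<omega>. e \<in> Basis \<Longrightarrow> \<bar>\<omega> \<bullet> e\<bar> ^ m * norm (stft_partial \<psi> \<phi> as bs x \<omega>) \<le> c e"
    by blast
  define D where "D = real (DIM('a))"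
  define K where "K = (C0 + (\<Sum>e\<in>Basis. c e))"
  have sum0: "(\<Sum>e\<in>Basis. c e) \<ge> 0" using c(1) by (intro sum_nonneg) auto
  have D1: "D \<ge> 1" unfolding D_def by (simp add: Suc_leI)
  have "norm (stft_partial \<psi> \<phi> as bs x \<omega>) \<le> (2 * D) ^ m * K * decay m \<omega>" for x \<omega>
  proof -
    let ?I = "norm (stft_partial \<psi> \<phi> as bs x \<omega>)"
    have "\<exists>e\<in>Basis. norm \<omega> \<le> D * \<bar>\<omega> \<bullet> e\<bar>"
    proof (rule ccontr)
      assume "\<not> ?thesis"
      then have "\<And>e. e \<in> Basis \<Longrightarrow> \<bar>\<omega> \<bullet> e\<bar> < norm \<omega> / D"
        using D1 by (auto simp: not_le field_simps)
      then have "(\<Sum>e\<in>Basis. \<bar>\<omega> \<bullet> e\<bar>) < (\<Sum>e\<in>(Basis::'a set). norm \<omega> / D)"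
        by (intro sum_strict_mono) auto
      also have "\<dots> = norm \<omega>" using D1 unfolding D_def by simp
      finally show False using norm_le_l1[of \<omega>] by simp
    qed
    then obtain e where e: "e \<in> Basis" "norm \<omega> \<le> D * \<bar>\<omega> \<bullet> e\<bar>" by blast
    have "(1 + norm \<omega>) ^ m * ?I \<le> (2 * D) ^ m * K"
    proof (cases "norm \<omega> \<le> 1")
      case True
      have "(1 + norm \<omega>) ^ m \<le> (2 * D) ^ m" using True D1 by (intro power_mono) auto
      moreover have "?I \<le> K" unfolding K_def using C0(2)[of x \<omega>] sum0 by linarith
      ultimately show ?thesis using D1 by (intro mult_mono) auto
    next
      case False
      have "(1 + norm \<omega>) ^ m \<le> (2 * D * \<bar>\<omega> \<bullet> e\<bar>) ^ m"
        using False e(2) by (intro power_mono) auto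
      then have "(1 + norm \<omega>) ^ m * ?I \<le> (2 * D) ^ m * (\<bar>\<omega> \<bullet> e\<bar> ^ m * ?I)"
        unfolding power_mult_distrib mult.assoc[symmetric] by (intro mult_right_mono) auto
      also have "\<dots> \<le> (2 * D) ^ m * c e" using c(2)[OF e(1)] D1 by (intro mult_left_mono) auto
      also have "\<dots> \<le> (2 * D) ^ m * K"
      proof (intro mult_left_mono)
        have "c e \<le> (\<Sum>e\<in>Basis. c e)" using c(1) e(1) by (intro member_le_sum) auto
        then show "c e \<le> K" unfolding K_def using C0(1) by linarith
      qed (use D1 in auto)
      finally show ?thesis .
    qed
    moreover have "(1 + norm \<omega>) ^ m > 0" by (simp add: add_pos_nonneg)
    ultimately show ?thesis unfolding decay_def by (simp add: pos_le_divide_eq mult.commute)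
  qed
  moreover have "(2 * D) ^ m * K \<ge> 0" unfolding K_def using C0(1) sum0 D1 by simp
  ultimately show ?thesis by blast
qed

lemma L2_inner_tf_shift_eq:
  "L2_inner \<psi> (tf_shift z \<phi>) = stft_partial \<psi> \<phi> [] [] (fst z) ((- 2 * pi) *\<^sub>R snd z)"
  unfolding L2_inner_def stft_partial_def
  by (intro Bochner_Integration.integral_cong) (simp_all add: tf_shift_def cis_cnj)

text \<open>The geometric mean of an estimate in position and one in frequency. Both start with
  exponent 4k, because taking the square root halves it and \<open>decay_Pair\<close> is stated for
  even exponents 2k.\<close>

theorem stft_schwartz_decay:
  "\<exists>C>0. \<forall>z. norm (L2_inner \<psi> (tf_shift z \<phi>)) \<le> C * decay k z"
proof -
  obtain C1 C2 where C: "C1 \<ge> 0" "\<And>x \<omega>. norm (stft_partial \<psi> \<phi> [] [] x \<omega>) \<le> C1 * decay (4 * k) x"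
    "C2 \<ge> 0" "\<And>x \<omega>. norm (stft_partial \<psi> \<phi> [] [] x \<omega>) \<le> C2 * decay (4 * k) \<omega>"
    using stft_partial_decay_position[of "[]" "[]" "4 * k"] stft_partial_decay_frequency[of "[]" "[]" "4 * k"] by auto
  have "norm (L2_inner \<psi> (tf_shift z \<phi>)) \<le> (C1 + C2 + 1) * decay k z" for z
  proof -
    obtain x \<omega> where z: "z = (x, \<omega>)" by force
    let ?I = "norm (L2_inner \<psi> (tf_shift z \<phi>))" and ?C = "C1 + C2 + 1"
    let ?dx = "decay (2 * k) x" and ?dw = "decay (2 * k) \<omega>"
    have sq: "decay (4 * k) y = (decay (2 * k) y)\<^sup>2" for y :: 'a
      using decay_add[of "2 * k" "2 * k" y] by (simp add: power2_eq_square)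
    have 1: "?I \<le> ?C * ?dx\<^sup>2"
      using C(2)[of x "(- 2 * pi) *\<^sub>R \<omega>"] mult_right_mono[of C1 ?C "decay (4 * k) x"] C(1,3)
      unfolding L2_inner_tf_shift_eq z sq by simp
    \<comment> \<open>The frequency variable of \<open>stft_partial\<close> is - 2 \<pi> \<omega>;
      enlarging the argument only strengthens the decay.\<close>
    have "norm \<omega> \<le> norm ((- 2 * pi) *\<^sub>R \<omega>)"
      using pi_gt3 mult_right_mono[of 1 "2 * pi" "norm \<omega>"] by simp
    from decay_norm_mono[OF this, of "4 * k"]
    have "C2 * decay (4 * k) ((- 2 * pi) *\<^sub>R \<omega>) \<le> ?C * decay (4 * k) \<omega>"
      using C(1,3) by (intro mult_mono) auto
    then have 2: "?I \<le> ?C * ?dw\<^sup>2"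
      using C(4)[of x "(- 2 * pi) *\<^sub>R \<omega>"] unfolding L2_inner_tf_shift_eq z sq by simp
    have "?I\<^sup>2 \<le> (?C * ?dx\<^sup>2) * (?C * ?dw\<^sup>2)"
      unfolding power2_eq_square[of ?I] using 1 2 C(1,3) by (intro mult_mono) auto
    also have "\<dots> = (?C * (?dx * ?dw))\<^sup>2" by (simp add: power2_eq_square mult_ac)
    finally have "?I \<le> ?C * (?dx * ?dw)"
      using C(1,3) by (intro power2_le_imp_le[of ?I]) auto
    also have "\<dots> \<le> ?C * decay (2 * k) z"
      unfolding z using C(1,3) by (intro mult_left_mono decay_Pair) auto
    also have "\<dots> \<le> ?C * decay k z" using C(1,3) by (intro mult_left_mono decay_mono) auto
    finally show ?thesis .
  qed
  then show ?thesis using C(1,3) by (intro exI[of _ "C1 + C2 + 1"]) auto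
qed

end

section \<open>Continuity of the short-time Fourier transform; square-integrable functions as
  distributions\<close>

lemma schwartz_family_tf_shift:
  assumes "schwartz \<phi>"
  shows "schwartz_family (\<lambda>z t. cnj (tf_shift z \<phi> t))"
proof
  show "schwartz (\<lambda>t. cnj (tf_shift z \<phi> t))" for z by (rule schwartz_tf_shift_cnj[OF assms])
  fix bs :: "'a list" assume bs: "set bs \<subseteq> Basis"
  show "continuous_on UNIV (\<lambda>(z, t). iter_partial bs (\<lambda>t. cnj (tf_shift z \<phi> t)) t)"
    by (rule iter_partial_tf_shift_continuous[OF assms bs])
  fix S :: "('a \<times> 'a) set" and k assume "compact S"
  then obtain B where B: "\<And>z. z \<in> S \<Longrightarrow> norm z \<le> B" using compact_imp_bounded bounded_iff by metis
  obtain C where C: "C > 0" "\<And>z t. norm (iter_partial bs (\<lambda>t. cnj (tf_shift z \<phi> t)) t)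
            \<le> C * (1 + norm z) ^ (length bs + k) * decay k t"
    using iter_partial_tf_shift_bound[OF assms bs, of k] by blast
  have "norm (iter_partial bs (\<lambda>t. cnj (tf_shift z \<phi> t)) t) \<le> C * (1 + B) ^ (length bs + k) * decay k t"
    if "z \<in> S" for z t
    using C(1) B[OF that] by (intro order_trans[OF C(2)] mult_right_mono mult_left_mono power_mono) auto
  then show "\<exists>C. \<forall>z\<in>S. \<forall>t. norm (iter_partial bs (\<lambda>t. cnj (tf_shift z \<phi> t)) t) \<le> C * decay k t"
    by blast
qed

lemma stft_continuous:
  assumes "schwartz \<phi>" "tempered_distribution u"
  shows "continuous_on UNIV (stft \<phi> u)"
  using schwartz_family.tempered_continuous[OF schwartz_family_tf_shift[OF assms(1)] assms(2)]
  by (simp add: stft_def)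

lemma integrable_mult_square:
  fixes f g :: "'a \<Rightarrow> complex"
  assumes [measurable]: "f \<in> borel_measurable M" "g \<in> borel_measurable M"
    and "integrable M (\<lambda>t. (norm (f t))\<^sup>2)" "integrable M (\<lambda>t. (norm (g t))\<^sup>2)"
  shows "integrable M (\<lambda>t. f t * g t)"
proof (rule Bochner_Integration.integrable_bound)
  show "integrable M (\<lambda>t. (norm (f t))\<^sup>2 + (norm (g t))\<^sup>2)" using assms(3,4) by simp
  have "norm (f t) * norm (g t) \<le> (norm (f t))\<^sup>2 + (norm (g t))\<^sup>2" for t
    using sum_squares_bound[of "norm (f t)" "norm (g t)"]
      mult_nonneg_nonneg[OF norm_ge_zero[of "f t"] norm_ge_zero[of "g t"]] by linarith
  then show "AE t in M. norm (f t * g t) \<le> norm ((norm (f t))\<^sup>2 + (norm (g t))\<^sup>2)"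
    by (simp add: norm_mult)
qed simp

lemma schwartz_measurable:
  assumes "schwartz f" shows "f \<in> borel_measurable borel"
  using borel_measurable_continuous_onI[OF schwartz_continuous[OF assms, of "[]"]] by simp

lemma schwartz_square_integrable:
  assumes "schwartz f" shows "integrable lborel (\<lambda>t. (norm (f t))\<^sup>2)"
proof -
  obtain C where C: "C > 0" "\<And>t. norm (f t) \<le> C * decay (DIM('a) + 2) t"
    using schwartz_decay[OF assms, of "[]" "DIM('a) + 2"] by auto
  have m: "(\<lambda>t. (norm (f t))\<^sup>2) \<in> borel_measurable borel" using schwartz_measurable[OF assms] by simp
  have "norm ((norm (f t))\<^sup>2) \<le> C\<^sup>2 * decay (DIM('a) + 2) t" for t
  proof -
    have "(norm (f t))\<^sup>2 \<le> (C * decay (DIM('a) + 2) t)\<^sup>2" using C(2) by (intro power_mono) auto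
    also have "\<dots> = C\<^sup>2 * (decay (DIM('a) + 2) t * decay (DIM('a) + 2) t)"
      by (simp add: power2_eq_square mult_ac)
    also have "\<dots> \<le> C\<^sup>2 * (decay (DIM('a) + 2) t * 1)"
      by (intro mult_left_mono decay_le_1) auto
    finally show ?thesis by simp
  qed
  then show ?thesis by (intro integrable_decay_bound[OF m order_refl])
qed

text \<open>The function times \<open>decay (d + 2)\<close> is a product of two square-integrable
  functions, hence integrable. A single seminorm, with weight exponent d + 2 and no derivatives,
  therefore controls the functional.\<close>

lemma tempered_fun_distribution:
  fixes f :: "'a::euclidean_space \<Rightarrow> complex"
  assumes m: "f \<in> borel_measurable borel" and i: "integrable lborel (\<lambda>t. (norm (f t))\<^sup>2)"
  shows "tempered_distribution (fun_distribution f)"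
proof -
  let ?k = "DIM('a) + 2"
  have im: "integrable lborel (\<lambda>t. f t * \<psi> t)" if "schwartz \<psi>" for \<psi>
    using m i schwartz_measurable[OF that] schwartz_square_integrable[OF that] by (intro integrable_mult_square) auto
  have id: "integrable lborel (\<lambda>t. f t * complex_of_real (decay ?k t))"
  proof (rule integrable_mult_square)
    have "(norm (complex_of_real (decay ?k t)))\<^sup>2 = decay (?k + ?k) t" for t :: 'a
      unfolding decay_add[of ?k ?k] by (simp add: power2_eq_square)
    note sq = this
    show "integrable lborel (\<lambda>t::'a. (norm (complex_of_real (decay ?k t)))\<^sup>2)"
      unfolding sq by (rule integrable_decay) simp
  qed (use m i in auto)
  define J where "J = (LINT t|lborel. norm (f t) * decay ?k t)"
  have iJ: "integrable lborel (\<lambda>t. norm (f t) * decay ?k t)"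
    using integrable_norm[OF id] by (simp add: norm_mult)
  have J0: "J \<ge> 0" unfolding J_def by (intro integral_nonneg_AE) auto
  have bound: "norm (fun_distribution f \<psi>) \<le> J * schwartz_seminorm ?k [] \<psi>" if \<psi>: "schwartz \<psi>" for \<psi>
  proof -
    let ?S = "schwartz_seminorm ?k [] \<psi>"
    have "bdd_above (range (\<lambda>t. (1 + norm t) ^ ?k * norm (iter_partial [] \<psi> t)))"
    proof -
      obtain C where C: "\<And>t. norm (\<psi> t) \<le> C * decay ?k t"
        using schwartz_decay[OF \<psi>, of "[]" ?k] by auto
      have "(1 + norm t) ^ ?k * norm (\<psi> t) \<le> C" for t
      proof -
        have "(1 + norm t) ^ ?k * norm (\<psi> t) \<le> (1 + norm t) ^ ?k * (C * decay ?k t)"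
          by (intro mult_left_mono C) simp
        also have "\<dots> = C" unfolding mult.left_commute[of _ C] decay_mult_power by simp
        finally show ?thesis .
      qed
      then show ?thesis by (intro bdd_aboveI2[where M = C]) simp
    qed
    then have S: "(1 + norm t) ^ ?k * norm (\<psi> t) \<le> ?S" for t
      unfolding schwartz_seminorm_def using cSUP_upper[of t UNIV "\<lambda>t. (1 + norm t) ^ ?k * norm (iter_partial [] \<psi> t)"] by simp
    have S': "norm (\<psi> t) \<le> ?S * decay ?k t" for t
    proof -
      have "norm (\<psi> t) = ((1 + norm t) ^ ?k * decay ?k t) * norm (\<psi> t)" unfolding decay_mult_power by simp
      also have "\<dots> = ((1 + norm t) ^ ?k * norm (\<psi> t)) * decay ?k t" by (simp only: mult_ac)
      also have "\<dots> \<le> ?S * decay ?k t" by (intro mult_right_mono S) simp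
      finally show ?thesis .
    qed
    have "norm (fun_distribution f \<psi>) \<le> (LINT t|lborel. norm (f t * \<psi> t))"
      unfolding fun_distribution_def by (rule integral_norm_bound)
    also have "\<dots> \<le> (LINT t|lborel. (norm (f t) * decay ?k t) * ?S)"
    proof (intro integral_mono integrable_norm im \<psi> integrable_mult_left iJ)
      fix t
      show "norm (f t * \<psi> t) \<le> (norm (f t) * decay ?k t) * ?S"
        using mult_left_mono[OF S'[of t], of "norm (f t)"] by (simp add: norm_mult mult_ac)
    qed
    also have "\<dots> = J * ?S" unfolding J_def by simp
    finally show ?thesis .
  qed
  have fin: "{bs :: 'a list. set bs \<subseteq> Basis \<and> length bs \<le> 0} = {[]}" by auto
  show ?thesis
    unfolding tempered_distribution_def
  proof (intro conjI allI impI)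
    fix \<psi> \<theta> :: "'a \<Rightarrow> complex" assume "schwartz \<psi>" "schwartz \<theta>"
    then show "fun_distribution f (\<lambda>t. \<psi> t + \<theta> t) = fun_distribution f \<psi> + fun_distribution f \<theta>"
      unfolding fun_distribution_def using im by (simp add: distrib_left)
  next
    fix c and \<psi> :: "'a \<Rightarrow> complex" assume "schwartz \<psi>"
    then show "fun_distribution f (\<lambda>t. c * \<psi> t) = c * fun_distribution f \<psi>"
      unfolding fun_distribution_def using im by (simp add: mult.left_commute[of _ c])
  next
    show "\<exists>C k m. \<forall>\<psi>. schwartz \<psi> \<longrightarrow>
        norm (fun_distribution f \<psi>) \<le> C * (\<Sum>bs | set bs \<subseteq> Basis \<and> length bs \<le> m. schwartz_seminorm k bs \<psi>)"
      by (rule exI[of _ J], rule exI[of _ ?k], rule exI[of _ 0]) (unfold fin, use bound in simp)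
  qed
qed

lemma stft_fun_distribution: "stft \<phi> (fun_distribution f) z = L2_inner f (tf_shift z \<phi>)"
  by (simp add: stft_def fun_distribution_def L2_inner_def)

lemma L2_inner_tf_shift_continuous:
  assumes "schwartz \<phi>" "f \<in> borel_measurable borel" "integrable lborel (\<lambda>t. (norm (f t))\<^sup>2)"
  shows "continuous_on UNIV (\<lambda>z. L2_inner f (tf_shift z \<phi>))"
  using stft_continuous[OF assms(1) tempered_fun_distribution[OF assms(2,3)]]
  by (simp add: stft_fun_distribution[abs_def, symmetric]) (simp add: stft_fun_distribution)


section \<open>Fourier inversion\<close>

text \<open>Lebesgue measure on a Euclidean space is the image of the product measure over
  \<open>Basis\<close> under the coordinate map, where product functions factor.\<close>

lemma
  fixes f :: "'a::euclidean_space \<Rightarrow> real \<Rightarrow> complex"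
  assumes f: "\<And>b. b \<in> Basis \<Longrightarrow> integrable lborel (f b)"
  shows lborel_integrable_prod_Basis: "integrable lborel (\<lambda>x::'a. \<Prod>b\<in>Basis. f b (x \<bullet> b))"
    and lborel_integral_prod_Basis: "(LINT x|(lborel::'a measure). (\<Prod>b\<in>Basis. f b (x \<bullet> b))) = (\<Prod>b\<in>Basis. (LINT s|lborel. f b s))"
proof -
  interpret finite_product_sigma_finite "\<lambda>_::'a. lborel :: real measure" "Basis :: 'a set"
    by standard simp
  have [measurable]: "f b \<in> borel_measurable borel" if "b \<in> Basis" for b
    using borel_measurable_integrable[OF f[OF that]] by simp
  let ?T = "\<lambda>y. \<Sum>b\<in>Basis. y b *\<^sub>R b :: 'a"
  have T: "?T \<in> measurable (Pi\<^sub>M Basis (\<lambda>_. lborel)) borel" by measurable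
  have m: "(\<lambda>x::'a. \<Prod>b\<in>Basis. f b (x \<bullet> b)) \<in> borel_measurable borel" by measurable
  have eq: "(\<Prod>b\<in>Basis. f b (?T y \<bullet> b)) = (\<Prod>b\<in>Basis. f b (y b))" for y
    by (intro prod.cong) simp_all
  show "integrable lborel (\<lambda>x::'a. \<Prod>b\<in>Basis. f b (x \<bullet> b))"
    by (subst lborel_eq, subst integrable_distr_eq[OF T m], unfold eq)
       (intro product_integrable_prod f finite_Basis)
  show "(LINT x|(lborel::'a measure). (\<Prod>b\<in>Basis. f b (x \<bullet> b))) = (\<Prod>b\<in>Basis. (LINT s|lborel. f b s))"
    by (subst lborel_eq, subst integral_distr[OF T m], unfold eq)
       (intro product_integral_prod f finite_Basis)
qed

section \<open>The Gaussian and its Fourier transform\<close>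

definition std_gauss :: "'a::euclidean_space \<Rightarrow> real" where
  "std_gauss x = (1 / sqrt (2 * pi)) ^ DIM('a) * exp (- (norm x)\<^sup>2 / 2)"

lemma std_gauss_nonneg [simp]: "std_gauss x \<ge> 0"
  by (simp add: std_gauss_def)

lemma std_gauss_prod: "std_gauss (x::'a::euclidean_space) = (\<Prod>b\<in>Basis. std_normal_density (x \<bullet> b))"
proof -
  have "- (norm x)\<^sup>2 / 2 = (\<Sum>b\<in>Basis. - (x \<bullet> b)\<^sup>2 / 2)"
    unfolding norm_eq_sqrt_inner euclidean_inner[of x x]
    by (simp add: sum_nonneg power2_eq_square sum_divide_distrib sum_negf)
  then have "exp (- (norm x)\<^sup>2 / 2) = (\<Prod>b\<in>Basis. exp (- (x \<bullet> b)\<^sup>2 / 2))"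
    by (simp only: exp_sum[OF finite_Basis])
  then show ?thesis
    unfolding std_gauss_def std_normal_density_def prod.distrib by simp
qed

lemma std_gauss_measurable [measurable]: "std_gauss \<in> borel_measurable borel"
  unfolding std_gauss_def[abs_def] by measurable

text \<open>The one-dimensional transform is the characteristic function of the standard normal
  distribution.\<close>

lemma std_normal_density_iexp:
  "integrable lborel (\<lambda>s. complex_of_real (std_normal_density s) * cis (t * s))"
  "(LINT s|lborel. complex_of_real (std_normal_density s) * cis (t * s)) = complex_of_real (exp (- t\<^sup>2 / 2))"
proof -
  have i: "integrable lborel std_normal_density"
    using integrable_std_normal_moment[of 0] by simp
  show "integrable lborel (\<lambda>s. complex_of_real (std_normal_density s) * cis (t * s))"
  proof (rule Bochner_Integration.integrable_bound[OF i])
    show "(\<lambda>s. complex_of_real (std_normal_density s) * cis (t * s)) \<in> borel_measurable lborel"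
      unfolding cis_conv_exp by measurable
  qed (simp add: norm_mult)
  have "char std_normal_distribution t = (LINT s|lborel. std_normal_density s *\<^sub>R iexp (t * s))"
    unfolding char_def by (subst integral_density) auto
  then show "(LINT s|lborel. complex_of_real (std_normal_density s) * cis (t * s)) = complex_of_real (exp (- t\<^sup>2 / 2))"
    by (simp add: char_std_normal_distribution cis_conv_exp scaleR_conv_of_real)
qed

lemma
  fixes \<omega> :: "'a::euclidean_space"
  shows std_gauss_integrable_cis: "integrable lborel (\<lambda>x. complex_of_real (std_gauss x) * cis (\<omega> \<bullet> x))"
    and std_gauss_fourier: "(LINT x|lborel. complex_of_real (std_gauss x) * cis (\<omega> \<bullet> x)) = complex_of_real (exp (- (norm \<omega>)\<^sup>2 / 2))"
proof -
  let ?f = "\<lambda>b s. complex_of_real (std_normal_density s) * cis ((\<omega> \<bullet> b) * s)"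
  have eq: "complex_of_real (std_gauss x) * cis (\<omega> \<bullet> x) = (\<Prod>b\<in>Basis. ?f b (x \<bullet> b))" for x
    unfolding std_gauss_prod euclidean_inner[of \<omega> x] cis_conv_exp
    by (simp add: prod.distrib exp_sum sum_distrib_left)
  have "integrable lborel (?f b)" for b by (rule std_normal_density_iexp)
  then show "integrable lborel (\<lambda>x. complex_of_real (std_gauss x) * cis (\<omega> \<bullet> x))"
    unfolding eq by (intro lborel_integrable_prod_Basis)
  have "(LINT x|lborel. complex_of_real (std_gauss x) * cis (\<omega> \<bullet> x)) = (\<Prod>b\<in>Basis. complex_of_real (exp (- (\<omega> \<bullet> b)\<^sup>2 / 2)))"
    unfolding eq by (subst lborel_integral_prod_Basis) (simp_all only: std_normal_density_iexp)
  also have "\<dots> = complex_of_real (exp (\<Sum>b\<in>Basis. - (\<omega> \<bullet> b)\<^sup>2 / 2))"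
    by (simp add: exp_sum)
  also have "(\<Sum>b\<in>Basis. - (\<omega> \<bullet> b)\<^sup>2 / 2) = - (norm \<omega>)\<^sup>2 / 2"
    unfolding norm_eq_sqrt_inner euclidean_inner[of \<omega> \<omega>]
    by (simp add: sum_nonneg power2_eq_square sum_divide_distrib sum_negf)
  finally show "(LINT x|lborel. complex_of_real (std_gauss x) * cis (\<omega> \<bullet> x)) = complex_of_real (exp (- (norm \<omega>)\<^sup>2 / 2))" .
qed

lemma std_gauss_integrable: "integrable lborel (std_gauss :: 'a::euclidean_space \<Rightarrow> real)"
proof -
  have "integrable lborel (\<lambda>x. norm (complex_of_real (std_gauss x) * cis ((0::'a) \<bullet> x)))"
    by (intro integrable_norm std_gauss_integrable_cis)
  then show ?thesis by (simp add: norm_mult)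
qed

lemma std_gauss_integral: "(LINT x|lborel. std_gauss (x::'a::euclidean_space)) = 1"
proof -
  have "complex_of_real (LINT x|lborel. std_gauss (x::'a)) = (LINT x|lborel. complex_of_real (std_gauss x) * cis ((0::'a) \<bullet> x))"
    by simp
  also have "\<dots> = 1" unfolding std_gauss_fourier by simp
  finally show ?thesis by (metis of_real_eq_1_iff)
qed

lemma std_gauss_nn_integral: "(\<integral>\<^sup>+x. ennreal (std_gauss (x::'a::euclidean_space)) \<partial>lborel) = 1"
  by (subst nn_integral_eq_integral) (auto simp: std_gauss_integrable std_gauss_integral)

text \<open>The Gaussian regulariser on the frequency side; its inverse Fourier transform is the Gaussian
  approximate identity of width \<open>\<epsilon>\<close>.\<close>

definition gauss_weight :: "real \<Rightarrow> 'a::euclidean_space \<Rightarrow> real" where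
  "gauss_weight \<epsilon> \<omega> = exp (- (norm ((2 * pi * \<epsilon>) *\<^sub>R \<omega>))\<^sup>2 / 2)"

lemma gauss_weight_pos [simp]: "gauss_weight \<epsilon> \<omega> > 0"
  by (simp add: gauss_weight_def)

lemma gauss_weight_le_1: "gauss_weight \<epsilon> \<omega> \<le> 1"
  by (simp add: gauss_weight_def)

lemma gauss_weight_nonneg [simp]: "gauss_weight \<epsilon> \<omega> \<ge> 0"
  by (simp add: gauss_weight_def)

lemma gauss_weight_measurable [measurable]: "gauss_weight \<epsilon> \<in> borel_measurable borel"
  unfolding gauss_weight_def[abs_def] by measurable

lemma gauss_weight_eq:
  "gauss_weight \<epsilon> (\<omega>::'a::euclidean_space) = sqrt (2 * pi) ^ DIM('a) * std_gauss ((2 * pi * \<epsilon>) *\<^sub>R \<omega>)"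
  by (simp add: gauss_weight_def std_gauss_def power_one_over)

lemma gauss_weight_integrable:
  assumes "\<epsilon> > 0"
  shows "integrable lborel (gauss_weight \<epsilon> :: 'a::euclidean_space \<Rightarrow> real)"
  using integrable_euclidean_affine[OF std_gauss_integrable, of "2 * pi * \<epsilon>" 0] assms
  unfolding gauss_weight_eq[abs_def] by simp

lemma gauss_weight_tendsto: "(\<lambda>n. gauss_weight (inverse (real (Suc n))) \<omega>) \<longlonglongrightarrow> 1"
proof -
  have "(\<lambda>n. exp (- (norm ((2 * pi * inverse (real (Suc n))) *\<^sub>R \<omega>))\<^sup>2 / 2))
     \<longlonglongrightarrow> exp (- (norm ((2 * pi * 0) *\<^sub>R \<omega>))\<^sup>2 / 2)"
    by (intro tendsto_intros LIMSEQ_inverse_real_of_nat) simp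
  then show ?thesis by (simp add: gauss_weight_def)
qed

text \<open>The substitution \<omega> = x / (2 \<pi> \<epsilon>) turns the weight into the standard
  Gaussian, whose transform is known, here evaluated at s / \<epsilon>.\<close>

lemma gauss_weight_inverse_fourier:
  fixes s :: "'a::euclidean_space"
  assumes "\<epsilon> > 0"
  shows "(LINT \<omega>|lborel. cis (2 * pi * (\<omega> \<bullet> s)) * complex_of_real (gauss_weight \<epsilon> \<omega>))
    = complex_of_real (std_gauss ((1 / \<epsilon>) *\<^sub>R s) / \<epsilon> ^ DIM('a))"
proof -
  let ?c = "1 / (2 * pi * \<epsilon>)" and ?D = "DIM('a)"
  have c: "?c > 0" "?c \<noteq> 0" using assms by simp_all
  have m: "(\<lambda>\<omega>. cis (2 * pi * (\<omega> \<bullet> s)) * complex_of_real (gauss_weight \<epsilon> \<omega>)) \<in> borel_measurable borel"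
    unfolding cis_conv_exp by measurable
  have eq: "cis (2 * pi * ((0 + ?c *\<^sub>R x) \<bullet> s)) * complex_of_real (gauss_weight \<epsilon> (0 + ?c *\<^sub>R x))
     = complex_of_real (sqrt (2 * pi) ^ ?D) * (complex_of_real (std_gauss x) * cis (((1 / \<epsilon>) *\<^sub>R s) \<bullet> x))" for x
    using assms by (simp add: gauss_weight_eq inner_commute)
  have "(LINT \<omega>|lborel. cis (2 * pi * (\<omega> \<bullet> s)) * complex_of_real (gauss_weight \<epsilon> \<omega>))
     = \<bar>?c\<bar> ^ ?D *\<^sub>R (LINT x|lborel. cis (2 * pi * ((0 + ?c *\<^sub>R x) \<bullet> s)) * complex_of_real (gauss_weight \<epsilon> (0 + ?c *\<^sub>R x)))"
    by (intro lborel_integral_euclidean_affine m c)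
  also have "\<dots> = \<bar>?c\<bar> ^ ?D *\<^sub>R (complex_of_real (sqrt (2 * pi) ^ ?D) * complex_of_real (exp (- (norm ((1 / \<epsilon>) *\<^sub>R s))\<^sup>2 / 2)))"
    unfolding eq integral_mult_right_zero std_gauss_fourier ..
  also have "\<dots> = complex_of_real (?c ^ ?D * sqrt (2 * pi) ^ ?D * exp (- (norm ((1 / \<epsilon>) *\<^sub>R s))\<^sup>2 / 2))"
    using c by (simp add: scaleR_conv_of_real)
  also have "?c ^ ?D * sqrt (2 * pi) ^ ?D = (1 / sqrt (2 * pi)) ^ ?D / \<epsilon> ^ ?D"
  proof -
    have "sqrt (2 * pi) * sqrt (2 * pi) = 2 * pi" by simp
    then have "?c * sqrt (2 * pi) = (1 / sqrt (2 * pi)) / \<epsilon>"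
      using assms by (simp add: field_simps)
    then show ?thesis by (metis power_mult_distrib power_divide)
  qed
  finally show ?thesis by (simp add: std_gauss_def)
qed

section \<open>Gaussian smoothing and the inversion formula\<close>

definition gauss_smooth :: "real \<Rightarrow> ('a::euclidean_space \<Rightarrow> complex) \<Rightarrow> 'a \<Rightarrow> complex" where
  "gauss_smooth \<epsilon> h t = (LINT y|lborel. complex_of_real (std_gauss y) * h (t - \<epsilon> *\<^sub>R y))"

definition fourier :: "('a::euclidean_space \<Rightarrow> complex) \<Rightarrow> 'a \<Rightarrow> complex" where
  "fourier h \<omega> = (LINT t|lborel. cis (- 2 * pi * (\<omega> \<bullet> t)) * h t)"

lemma cis_inner_measurable [measurable (raw)]:
  "f \<in> borel_measurable M \<Longrightarrow> (\<lambda>x. cis (f x)) \<in> borel_measurable M"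
  unfolding cis_conv_exp by measurable

lemma cnj_measurable [measurable (raw)]:
  "f \<in> borel_measurable M \<Longrightarrow> (\<lambda>x. cnj (f x)) \<in> borel_measurable M"
  by (rule borel_measurable_continuous_on[OF continuous_on_cnj[OF continuous_on_id]])

lemma fourier_measurable [measurable]:
  assumes [measurable]: "h \<in> borel_measurable borel"
  shows "fourier h \<in> borel_measurable borel"
  unfolding fourier_def[abs_def] by measurable

lemma gauss_smooth_measurable [measurable]:
  assumes [measurable]: "h \<in> borel_measurable borel"
  shows "gauss_smooth \<epsilon> h \<in> borel_measurable borel"
  unfolding gauss_smooth_def[abs_def] by measurable

lemma fourier_bound:
  assumes h: "integrable lborel h"
  shows "norm (fourier h \<omega>) \<le> (LINT t|lborel. norm (h t))"
  unfolding fourier_def by (rule order_trans[OF integral_norm_bound]) (simp add: norm_mult)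

lemma integrable_pair_product:
  fixes f :: "'a::euclidean_space \<Rightarrow> complex" and g :: "'b::euclidean_space \<Rightarrow> complex"
  assumes f: "integrable lborel f" and g: "integrable lborel g"
    and m: "k \<in> borel_measurable (lborel \<Otimes>\<^sub>M lborel)"
    and le: "\<And>x y. norm (k (x, y)) \<le> norm (f x) * norm (g y)"
  shows "integrable (lborel \<Otimes>\<^sub>M lborel) (k :: 'a \<times> 'b \<Rightarrow> complex)"
proof (rule integrableI_bounded)
  have [measurable]: "f \<in> borel_measurable borel" "g \<in> borel_measurable borel" using f g by auto
  have "(\<integral>\<^sup>+z. ennreal (norm (k z)) \<partial>(lborel \<Otimes>\<^sub>M lborel)) = (\<integral>\<^sup>+x. \<integral>\<^sup>+y. ennreal (norm (k (x, y))) \<partial>lborel \<partial>lborel)"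
    using m by (intro lborel.nn_integral_fst[symmetric]) simp
  also have "\<dots> \<le> (\<integral>\<^sup>+x. \<integral>\<^sup>+y. ennreal (norm (f x)) * ennreal (norm (g y)) \<partial>lborel \<partial>lborel)"
    using le by (intro nn_integral_mono) (simp add: ennreal_mult[symmetric] ennreal_leI)
  also have "\<dots> = (\<integral>\<^sup>+x. ennreal (norm (f x)) \<partial>lborel) * (\<integral>\<^sup>+y. ennreal (norm (g y)) \<partial>lborel)"
    by (simp add: nn_integral_cmult nn_integral_multc)
  also have "\<dots> < \<infinity>"
    using f g unfolding integrable_iff_bounded by (simp add: ennreal_mult_less_top)
  finally show "(\<integral>\<^sup>+z. ennreal (norm (k z)) \<partial>(lborel \<Otimes>\<^sub>M lborel)) < \<infinity>" .
qed (rule m)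

text \<open>The weight makes the double integral absolutely convergent, so Fubini's theorem applies
  and the inner integral becomes the Gaussian approximate identity.\<close>

lemma fourier_gauss_inverse:
  fixes h :: "'a::euclidean_space \<Rightarrow> complex"
  assumes h: "integrable lborel h" and e: "\<epsilon> > 0"
  shows "(LINT \<omega>|lborel. cis (2 * pi * (\<omega> \<bullet> t)) * (fourier h \<omega> * complex_of_real (gauss_weight \<epsilon> \<omega>))) = gauss_smooth \<epsilon> h t"
proof -
  have [measurable]: "h \<in> borel_measurable borel" using h by auto
  have W: "integrable lborel (\<lambda>\<omega>::'a. complex_of_real (gauss_weight \<epsilon> \<omega>))"
    using gauss_weight_integrable[OF e, where 'a = 'a] by simp
  let ?k = "\<lambda>\<omega> s. cis (2 * pi * (\<omega> \<bullet> t)) * (cis (- 2 * pi * (\<omega> \<bullet> s)) * h s * complex_of_real (gauss_weight \<epsilon> \<omega>))"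
  have int: "integrable (lborel \<Otimes>\<^sub>M lborel) (case_prod ?k)"
  proof (rule integrable_pair_product[OF W h])
    show "case_prod ?k \<in> borel_measurable (lborel \<Otimes>\<^sub>M lborel)" by measurable
  qed (simp add: norm_mult)
  have "(LINT \<omega>|lborel. cis (2 * pi * (\<omega> \<bullet> t)) * (fourier h \<omega> * complex_of_real (gauss_weight \<epsilon> \<omega>)))
      = (LINT \<omega>|lborel. LINT s|lborel. ?k \<omega> s)"
    unfolding fourier_def by simp
  also have "\<dots> = (LINT s|lborel. LINT \<omega>|lborel. ?k \<omega> s)"
    by (rule lborel_pair.Fubini_integral[OF int, symmetric])
  also have "\<dots> = (LINT s|lborel. h s * complex_of_real (std_gauss ((1 / \<epsilon>) *\<^sub>R (t - s)) / \<epsilon> ^ DIM('a)))"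
  proof (rule Bochner_Integration.integral_cong[OF refl])
    fix s
    have "(LINT \<omega>|lborel. ?k \<omega> s) = (LINT \<omega>|lborel. h s * (cis (2 * pi * (\<omega> \<bullet> (t - s))) * complex_of_real (gauss_weight \<epsilon> \<omega>)))"
    proof (rule Bochner_Integration.integral_cong[OF refl])
      fix \<omega>
      have "cis (2 * pi * (\<omega> \<bullet> (t - s))) = cis (2 * pi * (\<omega> \<bullet> t)) * cis (- 2 * pi * (\<omega> \<bullet> s))"
        by (simp add: cis_mult inner_diff_right algebra_simps)
      then show "?k \<omega> s = h s * (cis (2 * pi * (\<omega> \<bullet> (t - s))) * complex_of_real (gauss_weight \<epsilon> \<omega>))"
        by (simp add: mult_ac)
    qed
    also have "\<dots> = h s * complex_of_real (std_gauss ((1 / \<epsilon>) *\<^sub>R (t - s)) / \<epsilon> ^ DIM('a))"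
      unfolding integral_mult_right_zero gauss_weight_inverse_fourier[OF e] ..
    finally show "(LINT \<omega>|lborel. ?k \<omega> s) = h s * complex_of_real (std_gauss ((1 / \<epsilon>) *\<^sub>R (t - s)) / \<epsilon> ^ DIM('a))" .
  qed
  \<comment> \<open>Substituting s = t - \<epsilon> y; the Jacobian cancels the normalising power of
    \<epsilon>.\<close>
  also have "\<dots> = \<bar>- \<epsilon>\<bar> ^ DIM('a) *\<^sub>R (LINT y|lborel. h (t + (- \<epsilon>) *\<^sub>R y) *
      complex_of_real (std_gauss ((1 / \<epsilon>) *\<^sub>R (t - (t + (- \<epsilon>) *\<^sub>R y))) / \<epsilon> ^ DIM('a)))"
    using e by (intro lborel_integral_euclidean_affine) (auto simp: divide_inverse)
  also have "\<dots> = gauss_smooth \<epsilon> h t"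
    unfolding gauss_smooth_def integral_scaleR_right[symmetric]
    using e by (intro Bochner_Integration.integral_cong) (simp_all add: scaleR_conv_of_real field_simps)
  finally show ?thesis .
qed

text \<open>The regularised inversion integral is computed in two ways as the width tends to 0:
  removing the weight is dominated by the integrable transform, and the Gaussian averages converge
  to h(t) because \<open>h\<close> is continuous and bounded.\<close>

theorem fourier_inversion:
  fixes h :: "'a::euclidean_space \<Rightarrow> complex"
  assumes h: "integrable lborel h" and cont: "continuous_on UNIV h" and b: "\<And>t. norm (h t) \<le> B"
    and F: "integrable lborel (fourier h)"
  shows "h t = (LINT \<omega>|lborel. cis (2 * pi * (\<omega> \<bullet> t)) * fourier h \<omega>)"
proof -
  have [measurable]: "h \<in> borel_measurable borel" using h by auto
  define e where "e n = inverse (real (Suc n))" for n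
  have e: "\<And>n. e n > 0" "e \<longlonglongrightarrow> 0"
    unfolding e_def using LIMSEQ_inverse_real_of_nat by auto
  have 1: "(\<lambda>n. LINT \<omega>|lborel. cis (2 * pi * (\<omega> \<bullet> t)) * (fourier h \<omega> * complex_of_real (gauss_weight (e n) \<omega>)))
    \<longlonglongrightarrow> (LINT \<omega>|lborel. cis (2 * pi * (\<omega> \<bullet> t)) * fourier h \<omega>)"
  proof (rule integral_dominated_convergence[where w = "\<lambda>\<omega>. norm (fourier h \<omega>)"])
    show "AE \<omega> in lborel. (\<lambda>n. cis (2 * pi * (\<omega> \<bullet> t)) * (fourier h \<omega> * complex_of_real (gauss_weight (e n) \<omega>)))
        \<longlonglongrightarrow> cis (2 * pi * (\<omega> \<bullet> t)) * fourier h \<omega>"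
    proof (rule AE_I2)
      fix \<omega> :: 'a
      have "(\<lambda>n. cis (2 * pi * (\<omega> \<bullet> t)) * (fourier h \<omega> * complex_of_real (gauss_weight (e n) \<omega>)))
        \<longlonglongrightarrow> cis (2 * pi * (\<omega> \<bullet> t)) * (fourier h \<omega> * complex_of_real 1)"
        unfolding e_def by (intro tendsto_intros gauss_weight_tendsto)
      then show "(\<lambda>n. cis (2 * pi * (\<omega> \<bullet> t)) * (fourier h \<omega> * complex_of_real (gauss_weight (e n) \<omega>)))
        \<longlonglongrightarrow> cis (2 * pi * (\<omega> \<bullet> t)) * fourier h \<omega>" by simp
    qed
    show "AE \<omega> in lborel. norm (cis (2 * pi * (\<omega> \<bullet> t)) * (fourier h \<omega> * complex_of_real (gauss_weight (e n) \<omega>))) \<le> norm (fourier h \<omega>)" for n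
      by (intro AE_I2) (simp add: norm_mult mult_left_le gauss_weight_le_1)
  qed (use F in \<open>auto intro!: integrable_norm\<close>)
  have 2: "(\<lambda>n. gauss_smooth (e n) h t) \<longlonglongrightarrow> (LINT y|lborel. complex_of_real (std_gauss (y::'a)) * h t)"
    unfolding gauss_smooth_def
  \<comment> \<open>Smoothing is written with the width in the argument of \<open>h\<close>, not in
    the kernel, so the majorant does not depend on n.\<close>
  proof (rule integral_dominated_convergence[where w = "\<lambda>y. B * std_gauss y"])
    show "AE y in lborel. (\<lambda>n. complex_of_real (std_gauss y) * h (t - e n *\<^sub>R y)) \<longlonglongrightarrow> complex_of_real (std_gauss y) * h t"
    proof (rule AE_I2)
      fix y :: 'a
      have "(\<lambda>n. t - e n *\<^sub>R y) \<longlonglongrightarrow> t - 0 *\<^sub>R y" by (intro tendsto_intros e)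
      then have "(\<lambda>n. h (t - e n *\<^sub>R y)) \<longlonglongrightarrow> h t"
        using cont by (intro continuous_on_tendsto_compose[OF cont]) auto
      then show "(\<lambda>n. complex_of_real (std_gauss y) * h (t - e n *\<^sub>R y)) \<longlonglongrightarrow> complex_of_real (std_gauss y) * h t"
        by (intro tendsto_intros)
    qed
    show "AE y in lborel. norm (complex_of_real (std_gauss y) * h (t - e n *\<^sub>R y)) \<le> B * std_gauss y" for n
    proof (rule AE_I2)
      fix y :: 'a
      show "norm (complex_of_real (std_gauss y) * h (t - e n *\<^sub>R y)) \<le> B * std_gauss y"
        using mult_right_mono[OF b[of "t - e n *\<^sub>R y"] std_gauss_nonneg[of y]] by (simp add: norm_mult mult.commute)
    qed
  qed (use std_gauss_integrable[where 'a = 'a] in \<open>auto\<close>)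
  have "(LINT y|lborel. complex_of_real (std_gauss (y::'a)) * h t) = h t"
    using std_gauss_integral[where 'a = 'a] by simp
  from 2[unfolded this] have "(\<lambda>n. gauss_smooth (e n) h t) \<longlonglongrightarrow> h t" .
  with 1 show ?thesis unfolding fourier_gauss_inverse[OF h e(1)] by (rule LIMSEQ_unique[rotated])
qed

text \<open>With the weight, the energy of the transform is the inner product of \<open>h\<close>
  with its smoothing. The elementary bound 2ab \<le> a^2 + b^2 and translation invariance estimate
  this by the energy of \<open>h\<close>. Working in \<open>ennreal\<close> allows that energy to be
  infinite.\<close>

lemma plancherel_regularised:
  fixes h :: "'a::euclidean_space \<Rightarrow> complex"
  assumes h: "integrable lborel h" and e: "\<epsilon> > 0"
  shows "(\<integral>\<^sup>+\<omega>. ennreal ((norm (fourier h \<omega>))\<^sup>2 * gauss_weight \<epsilon> \<omega>) \<partial>lborel) \<le> (\<integral>\<^sup>+t. ennreal ((norm (h t))\<^sup>2) \<partial>lborel)"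
proof -
  have [measurable]: "h \<in> borel_measurable borel" using h by auto
  define J where "J = (LINT t|lborel. norm (h t))"
  have J: "J \<ge> 0" unfolding J_def by (intro integral_nonneg_AE) auto
  have FJ: "norm (fourier h \<omega>) \<le> J" for \<omega> unfolding J_def by (rule fourier_bound[OF h])
  let ?W = "gauss_weight \<epsilon> :: 'a \<Rightarrow> real"
  have W: "integrable lborel ?W" by (rule gauss_weight_integrable[OF e])
  let ?k = "\<lambda>\<omega> t. cnj (h t) * (cis (2 * pi * (\<omega> \<bullet> t)) * (fourier h \<omega> * complex_of_real (?W \<omega>)))"
  have int: "integrable (lborel \<Otimes>\<^sub>M lborel) (case_prod ?k)"
  proof (rule integrable_pair_product[OF _ h])
    show "integrable lborel (\<lambda>\<omega>::'a. complex_of_real (J * ?W \<omega>))" using W by simp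
    show "case_prod ?k \<in> borel_measurable (lborel \<Otimes>\<^sub>M lborel)" by measurable
    show "norm (case_prod ?k (\<omega>, t)) \<le> norm (complex_of_real (J * ?W \<omega>)) * norm (h t)" for \<omega> t
      using FJ[of \<omega>] J by (simp add: norm_mult mult.commute mult_left_mono mult_right_mono)
  qed
  have i2: "integrable lborel (\<lambda>\<omega>. (norm (fourier h \<omega>))\<^sup>2 * ?W \<omega>)"
  proof (rule Bochner_Integration.integrable_bound[where f = "\<lambda>\<omega>. J\<^sup>2 * ?W \<omega>"])
    have "(norm (fourier h \<omega>))\<^sup>2 \<le> J\<^sup>2" for \<omega> using FJ by (intro power_mono) auto
    then show "AE \<omega> in lborel. norm ((norm (fourier h \<omega>))\<^sup>2 * ?W \<omega>) \<le> norm (J\<^sup>2 * ?W \<omega>)"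
      by (intro AE_I2) (simp add: mult_right_mono)
  qed (use W in auto)
  have "complex_of_real (LINT \<omega>|lborel. (norm (fourier h \<omega>))\<^sup>2 * ?W \<omega>) = (LINT \<omega>|lborel. LINT t|lborel. ?k \<omega> t)"
    unfolding integral_complex_of_real[symmetric]
  proof (rule Bochner_Integration.integral_cong[OF refl])
    fix \<omega>
    have "cnj (fourier h \<omega>) = (LINT t|lborel. cis (2 * pi * (\<omega> \<bullet> t)) * cnj (h t))"
      unfolding fourier_def by (subst Bochner_Integration.integral_cnj[symmetric]) (simp add: cis_cnj)
    then have "cnj (fourier h \<omega>) * (fourier h \<omega> * complex_of_real (?W \<omega>))
      = (LINT t|lborel. (cis (2 * pi * (\<omega> \<bullet> t)) * cnj (h t)) * (fourier h \<omega> * complex_of_real (?W \<omega>)))"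
      by simp
    also have "\<dots> = (LINT t|lborel. ?k \<omega> t)" by (simp add: mult_ac)
    finally have "cnj (fourier h \<omega>) * (fourier h \<omega> * complex_of_real (?W \<omega>)) = (LINT t|lborel. ?k \<omega> t)" .
    moreover have "complex_of_real ((norm (fourier h \<omega>))\<^sup>2 * ?W \<omega>) = cnj (fourier h \<omega>) * (fourier h \<omega> * complex_of_real (?W \<omega>))"
      by (simp only: of_real_mult complex_norm_square mult_ac)
    ultimately show "complex_of_real ((norm (fourier h \<omega>))\<^sup>2 * ?W \<omega>) = (LINT t|lborel. ?k \<omega> t)"
      by simp
  qed
  also have "\<dots> = (LINT t|lborel. LINT \<omega>|lborel. ?k \<omega> t)"
    by (rule lborel_pair.Fubini_integral[OF int, symmetric])
  also have "\<dots> = (LINT t|lborel. cnj (h t) * gauss_smooth \<epsilon> h t)"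
    by (simp add: fourier_gauss_inverse[OF h e])
  finally have eq: "complex_of_real (LINT \<omega>|lborel. (norm (fourier h \<omega>))\<^sup>2 * ?W \<omega>) = (LINT t|lborel. cnj (h t) * gauss_smooth \<epsilon> h t)" .
  let ?N = "\<lambda>t. ennreal ((norm (h t))\<^sup>2)"
  have "(\<integral>\<^sup>+\<omega>. ennreal ((norm (fourier h \<omega>))\<^sup>2 * ?W \<omega>) \<partial>lborel) = ennreal (LINT \<omega>|lborel. (norm (fourier h \<omega>))\<^sup>2 * ?W \<omega>)"
    by (intro nn_integral_eq_integral i2) auto
  also have "\<dots> \<le> ennreal (norm (LINT t|lborel. cnj (h t) * gauss_smooth \<epsilon> h t))"
    unfolding eq[symmetric] by (intro ennreal_leI) (simp add: abs_ge_self)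
  also have "\<dots> \<le> (\<integral>\<^sup>+t. ennreal (norm (cnj (h t) * gauss_smooth \<epsilon> h t)) \<partial>lborel)"
    \<comment> \<open>If the integrand is not integrable, its Bochner integral is 0 by convention
      and the inequality is trivial.\<close>
    by (cases "integrable lborel (\<lambda>t. cnj (h t) * gauss_smooth \<epsilon> h t)")
       (auto intro: integral_norm_bound_ennreal simp: not_integrable_integral_eq)
  also have "\<dots> \<le> (\<integral>\<^sup>+t. \<integral>\<^sup>+y. ennreal (std_gauss y) * (ennreal (1/2) * ?N t + ennreal (1/2) * ?N (t - \<epsilon> *\<^sub>R y)) \<partial>lborel \<partial>lborel)"
  proof (intro nn_integral_mono)
    fix t
    have "ennreal (norm (gauss_smooth \<epsilon> h t)) \<le> (\<integral>\<^sup>+y. ennreal (norm (complex_of_real (std_gauss y) * h (t - \<epsilon> *\<^sub>R y))) \<partial>lborel)"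
      unfolding gauss_smooth_def
      by (cases "integrable lborel (\<lambda>y. complex_of_real (std_gauss y) * h (t - \<epsilon> *\<^sub>R y))")
         (auto intro: integral_norm_bound_ennreal simp: not_integrable_integral_eq)
    then have "ennreal (norm (h t)) * ennreal (norm (gauss_smooth \<epsilon> h t))
       \<le> ennreal (norm (h t)) * (\<integral>\<^sup>+y. ennreal (norm (complex_of_real (std_gauss y) * h (t - \<epsilon> *\<^sub>R y))) \<partial>lborel)"
      by (intro mult_left_mono) auto
    also have "\<dots> = (\<integral>\<^sup>+y. ennreal (norm (h t)) * ennreal (norm (complex_of_real (std_gauss y) * h (t - \<epsilon> *\<^sub>R y))) \<partial>lborel)"
      by (intro nn_integral_cmult[symmetric]) measurable
    also have "\<dots> \<le> (\<integral>\<^sup>+y. ennreal (std_gauss y) * (ennreal (1/2) * ?N t + ennreal (1/2) * ?N (t - \<epsilon> *\<^sub>R y)) \<partial>lborel)"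
    proof (intro nn_integral_mono)
      fix y
      let ?a = "norm (h t)" and ?b = "norm (h (t - \<epsilon> *\<^sub>R y))"
      have "std_gauss y * (?a * ?b) \<le> std_gauss y * (1/2 * ?a\<^sup>2 + 1/2 * ?b\<^sup>2)"
        using sum_squares_bound[of ?a ?b] by (intro mult_left_mono) auto
      from ennreal_leI[OF this]
      show "ennreal ?a * ennreal (norm (complex_of_real (std_gauss y) * h (t - \<epsilon> *\<^sub>R y)))
         \<le> ennreal (std_gauss y) * (ennreal (1/2) * ?N t + ennreal (1/2) * ?N (t - \<epsilon> *\<^sub>R y))"
      proof -
        have "ennreal (std_gauss y * (1/2 * ?a\<^sup>2 + 1/2 * ?b\<^sup>2)) = ennreal (std_gauss y) * ennreal (1/2 * ?a\<^sup>2 + 1/2 * ?b\<^sup>2)"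
          by (rule ennreal_mult) auto
        also have "ennreal (1/2 * ?a\<^sup>2 + 1/2 * ?b\<^sup>2) = ennreal (1/2 * ?a\<^sup>2) + ennreal (1/2 * ?b\<^sup>2)"
          by (rule ennreal_plus) auto
        also have "ennreal (1/2 * ?a\<^sup>2) = ennreal (1/2) * ennreal (?a\<^sup>2)" by (rule ennreal_mult) auto
        also have "ennreal (1/2 * ?b\<^sup>2) = ennreal (1/2) * ennreal (?b\<^sup>2)" by (rule ennreal_mult) auto
        finally show ?thesis
          using \<open>ennreal (std_gauss y * (?a * ?b)) \<le> _\<close>
          by (simp only: norm_mult norm_of_real abs_of_nonneg[OF std_gauss_nonneg] ennreal_mult[symmetric] norm_ge_zero
              mult_nonneg_nonneg std_gauss_nonneg mult.left_commute[of ?a])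
      qed
    qed
    finally show "ennreal (norm (cnj (h t) * gauss_smooth \<epsilon> h t))
      \<le> (\<integral>\<^sup>+y. ennreal (std_gauss y) * (ennreal (1/2) * ?N t + ennreal (1/2) * ?N (t - \<epsilon> *\<^sub>R y)) \<partial>lborel)"
      by (simp add: norm_mult ennreal_mult)
  qed
  also have "\<dots> = (\<integral>\<^sup>+y. \<integral>\<^sup>+t. ennreal (std_gauss y) * (ennreal (1/2) * ?N t + ennreal (1/2) * ?N (t - \<epsilon> *\<^sub>R y)) \<partial>lborel \<partial>lborel)"
    by (rule lborel_pair.Fubini') measurable
  also have "\<dots> = (\<integral>\<^sup>+y. ennreal (std_gauss (y::'a)) * (\<integral>\<^sup>+t. ?N t \<partial>lborel) \<partial>lborel)"
  proof (rule nn_integral_cong)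
    fix y :: 'a
    have tr: "(\<integral>\<^sup>+t. ?N (t - \<epsilon> *\<^sub>R y) \<partial>lborel) = (\<integral>\<^sup>+t. ?N t \<partial>lborel)"
      using nn_integral_translate[of ?N "- (\<epsilon> *\<^sub>R y)"] by simp
    have half: "inverse 2 * x + inverse 2 * x = x" for x :: ennreal
    proof -
      have "ennreal (1/2) + ennreal (1/2) = 1" by (subst ennreal_plus[symmetric]) auto
      then have "inverse 2 + inverse 2 = (1::ennreal)" by simp
      then show ?thesis by (simp only: distrib_right[symmetric]) simp
    qed
    show "(\<integral>\<^sup>+t. ennreal (std_gauss y) * (ennreal (1/2) * ?N t + ennreal (1/2) * ?N (t - \<epsilon> *\<^sub>R y)) \<partial>lborel)
       = ennreal (std_gauss y) * (\<integral>\<^sup>+t. ?N t \<partial>lborel)"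
      by (simp add: nn_integral_cmult nn_integral_add tr half)
  qed
  also have "\<dots> = (\<integral>\<^sup>+t. ?N t \<partial>lborel)"
    by (subst nn_integral_multc) (auto simp: std_gauss_nn_integral)
  finally show ?thesis .
qed

text \<open>Fatou's lemma removes the weight.\<close>

lemma plancherel_le:
  fixes h :: "'a::euclidean_space \<Rightarrow> complex"
  assumes h: "integrable lborel h"
  shows "(\<integral>\<^sup>+\<omega>. ennreal ((norm (fourier h \<omega>))\<^sup>2) \<partial>lborel) \<le> (\<integral>\<^sup>+t. ennreal ((norm (h t))\<^sup>2) \<partial>lborel)"
proof -
  have [measurable]: "h \<in> borel_measurable borel" using h by auto
  define e where "e n = inverse (real (Suc n))" for n
  have lim: "(\<lambda>n. ennreal ((norm (fourier h \<omega>))\<^sup>2 * gauss_weight (e n) \<omega>)) \<longlonglongrightarrow> ennreal ((norm (fourier h \<omega>))\<^sup>2 * 1)" for \<omega>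
    unfolding e_def by (intro tendsto_ennrealI tendsto_intros gauss_weight_tendsto)
  have "(\<integral>\<^sup>+\<omega>. ennreal ((norm (fourier h \<omega>))\<^sup>2) \<partial>lborel)
     = (\<integral>\<^sup>+\<omega>. liminf (\<lambda>n. ennreal ((norm (fourier h \<omega>))\<^sup>2 * gauss_weight (e n) \<omega>)) \<partial>lborel)"
    using lim_imp_Liminf[OF sequentially_bot lim] by simp
  also have "\<dots> \<le> liminf (\<lambda>n. \<integral>\<^sup>+\<omega>. ennreal ((norm (fourier h \<omega>))\<^sup>2 * gauss_weight (e n) \<omega>) \<partial>lborel)"
    by (intro nn_integral_liminf) measurable
  also have "\<dots> \<le> (\<integral>\<^sup>+t. ennreal ((norm (h t))\<^sup>2) \<partial>lborel)"
    by (intro Liminf_le) (auto intro!: always_eventually plancherel_regularised[OF h] simp: e_def)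
  finally show ?thesis .
qed


section \<open>Plancherel's theorem and Moyal's identity\<close>

lemma integral_indicator_translate:
  fixes A :: "'a::euclidean_space set"
  assumes [measurable]: "A \<in> sets borel"
  shows "(LINT t|lborel. indicat_real A (t + v)) = measure lborel A"
    and "emeasure lborel A < \<infinity> \<Longrightarrow> integrable lborel (\<lambda>t. indicat_real A (t + v))"
proof -
  show "(LINT t|lborel. indicat_real A (t + v)) = measure lborel A"
    using lborel_integral_translate[of "indicat_real A" v] by simp
  assume "emeasure lborel A < \<infinity>"
  then have "integrable lborel (indicat_real A)" by (simp add: integrable_indicator_iff)
  from integrable_translate[OF this] show "integrable lborel (\<lambda>t. indicat_real A (t + v))" .
qed

text \<open>For an open set \<open>U\<close> the negative part of \<open>1\<^sub>U (t + v) - 1\<^sub>U t\<close> tends to \<open>0\<close> pointwise,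
  and the total integral of the difference vanishes.\<close>

lemma L1_translation_open:
  fixes U :: "'a::euclidean_space set"
  assumes U: "open U" and fin: "emeasure lborel U < \<infinity>" and v: "v \<longlonglongrightarrow> 0"
  shows "(\<lambda>n. LINT t|lborel. \<bar>indicat_real U (t + v n) - indicat_real U t\<bar>) \<longlonglongrightarrow> 0"
proof -
  have [measurable]: "U \<in> sets borel" using U by simp
  let ?f = "indicat_real U" and ?g = "\<lambda>n t. indicat_real U (t + v n)"
  let ?p = "\<lambda>n t. max (?f t - ?g n t) 0"
  have f: "integrable lborel ?f" using fin by (simp add: integrable_indicator_iff)
  have g: "integrable lborel (?g n)" for n using integral_indicator_translate(2)[OF _ fin] by simp
  have p: "integrable lborel (?p n)" for n
    by (rule Bochner_Integration.integrable_bound[OF f]) (auto simp: indicator_def)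
  have "(\<lambda>n. LINT t|lborel. ?p n t) \<longlonglongrightarrow> (LINT t|(lborel::'a measure). 0)"
  proof (rule integral_dominated_convergence[where w = ?f])
    show "AE t in lborel. (\<lambda>n. ?p n t) \<longlonglongrightarrow> 0"
    proof (rule AE_I2)
      fix t
      show "(\<lambda>n. ?p n t) \<longlonglongrightarrow> 0"
      proof (cases "t \<in> U")
        case True
        have "(\<lambda>n. t + v n) \<longlonglongrightarrow> t + 0" by (intro tendsto_intros v)
        then have "\<forall>\<^sub>F n in sequentially. t + v n \<in> U"
          using U True topological_tendstoD by fastforce
        then have "\<forall>\<^sub>F n in sequentially. ?p n t = 0"
          by eventually_elim (simp add: True)
        then show ?thesis by (rule tendsto_eventually)
      qed simp
    qed
  qed (use f in \<open>auto simp: indicator_def\<close>)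
  then have "(\<lambda>n. 2 * (LINT t|lborel. ?p n t)) \<longlonglongrightarrow> 2 * 0" by (intro tendsto_intros) simp
  \<comment> \<open>For functions of equal integral, positive and negative part of the difference
    have the same mass.\<close>
  moreover have "(LINT t|lborel. \<bar>?g n t - ?f t\<bar>) = 2 * (LINT t|lborel. ?p n t)" for n
  proof -
    have "(LINT t|lborel. \<bar>?g n t - ?f t\<bar>) = (LINT t|lborel. 2 * ?p n t + (?g n t - ?f t))"
      by (intro Bochner_Integration.integral_cong) (auto simp: indicator_def)
    also have "\<dots> = 2 * (LINT t|lborel. ?p n t) + ((LINT t|lborel. ?g n t) - (LINT t|lborel. ?f t))"
      using p f g by simp
    finally show ?thesis using integral_indicator_translate(1)[of U "v n"] by simp
  qed
  ultimately show ?thesis by simp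
qed

text \<open>Outer regularity reduces to an open superset \<open>U\<close>. The excess
  \<open>U - A\<close> enters twice, once translated and once in place, and each occurrence costs
  less than e/4.\<close>

lemma L1_translation_indicator:
  fixes A :: "'a::euclidean_space set"
  assumes A [measurable]: "A \<in> sets borel" and fin: "emeasure lborel A < \<infinity>" and v: "v \<longlonglongrightarrow> 0"
  shows "(\<lambda>n. LINT t|lborel. \<bar>indicat_real A (t + v n) - indicat_real A t\<bar>) \<longlonglongrightarrow> 0"
proof (rule LIMSEQ_I)
  fix e :: real assume e: "e > 0"
  obtain U where U: "open U" "A \<subseteq> U" "emeasure lborel (U - A) < e / 4"
    using outer_regular_lborel[OF A, of "e / 4"] e by auto
  have [measurable]: "U \<in> sets borel" using U by simp
  let ?E = "U - A"
  have finE: "emeasure lborel ?E < \<infinity>" using U(3) by (rule less_trans) simp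
  have mE: "measure lborel ?E < e / 4"
    using U(3) e finE by (simp add: emeasure_eq_ennreal_measure ennreal_less_iff)
  have "emeasure lborel U \<le> emeasure lborel A + emeasure lborel ?E"
    using emeasure_subadditive[of A lborel ?E] U(2) by (simp add: Un_absorb1)
  also have "\<dots> < \<infinity>" using fin finE by simp
  finally have finU: "emeasure lborel U < \<infinity>" .
  obtain N where N: "\<And>n. n \<ge> N \<Longrightarrow> norm ((LINT t|lborel. \<bar>indicat_real U (t + v n) - indicat_real U t\<bar>) - 0) < e / 2"
    using LIMSEQ_D[OF L1_translation_open[OF U(1) finU v], of "e / 2"] e by auto
  have i: "integrable lborel (\<lambda>t. indicat_real B (t + v n)) \<and> integrable lborel (indicat_real B)"
    if "B \<in> sets borel" "emeasure lborel B < \<infinity>" for B n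
    using integral_indicator_translate(2)[OF that] that by (auto simp: integrable_indicator_iff)
  have "norm ((LINT t|lborel. \<bar>indicat_real A (t + v n) - indicat_real A t\<bar>) - 0) < e" if "n \<ge> N" for n
  proof -
    have "(LINT t|lborel. \<bar>indicat_real A (t + v n) - indicat_real A t\<bar>)
      \<le> (LINT t|lborel. \<bar>indicat_real U (t + v n) - indicat_real U t\<bar> + (indicat_real ?E (t + v n) + indicat_real ?E t))"
      using U(2) by (intro integral_mono integrable_abs Bochner_Integration.integrable_add Bochner_Integration.integrable_diff
          i[THEN conjunct1] i[THEN conjunct2] fin finU finE)
        (auto simp: indicator_def)
    also have "\<dots> = (LINT t|lborel. \<bar>indicat_real U (t + v n) - indicat_real U t\<bar>) + (measure lborel ?E + measure lborel ?E)"
      using i[of U n] i[of ?E n] finU finE integral_indicator_translate(1)[of ?E "v n"] by simp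
    also have "\<dots> < e" using N[OF that] mE by simp
    finally have "(LINT t|lborel. \<bar>indicat_real A (t + v n) - indicat_real A t\<bar>) < e" .
    moreover have "(LINT t|lborel. \<bar>indicat_real A (t + v n) - indicat_real A t\<bar>) \<ge> 0"
      by (intro integral_nonneg_AE) auto
    ultimately show ?thesis by simp
  qed
  then show "\<exists>no. \<forall>n\<ge>no. norm ((LINT t|lborel. \<bar>indicat_real A (t + v n) - indicat_real A t\<bar>) - 0) < e" by blast
qed

text \<open>Induction over integrable functions: multiples of indicators, sums, dominated limits. In
  the limit case translation invariance makes the translated approximation error equal to the
  untranslated one, which leaves three errors of e/3.\<close>

lemma L1_translation_continuous:
  fixes h :: "'a::euclidean_space \<Rightarrow> complex"
  assumes h: "integrable lborel h" and v: "v \<longlonglongrightarrow> 0"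
  shows "(\<lambda>n. LINT t|lborel. norm (h (t + v n) - h t)) \<longlonglongrightarrow> 0"
  using h
proof (induction rule: integrable_induct)
  case (base A c)
  have "norm (indicat_real A (t + v n) *\<^sub>R c - indicat_real A t *\<^sub>R c) = norm c * \<bar>indicat_real A (t + v n) - indicat_real A t\<bar>" for t n
    by (simp add: scaleR_diff_left[symmetric] mult.commute)
  moreover have "(\<lambda>n. norm c * (LINT t|lborel. \<bar>indicat_real A (t + v n) - indicat_real A t\<bar>)) \<longlonglongrightarrow> norm c * 0"
    using base by (intro tendsto_mult tendsto_const L1_translation_indicator v) auto
  ultimately show ?case by simp
next
  case (add f g)
  show ?case
  proof (rule tendsto_sandwich[OF _ _ tendsto_const])
    show "(\<lambda>n. (LINT t|lborel. norm (f (t + v n) - f t)) + (LINT t|lborel. norm (g (t + v n) - g t))) \<longlonglongrightarrow> 0"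
      using tendsto_add[OF add.IH] by simp
    have "(LINT t|lborel. norm (f (t + v n) + g (t + v n) - (f t + g t)))
       \<le> (LINT t|lborel. norm (f (t + v n) - f t)) + (LINT t|lborel. norm (g (t + v n) - g t))" for n
    proof -
      note i = add.hyps integrable_translate[OF add.hyps(1)] integrable_translate[OF add.hyps(2)]
      have "(LINT t|lborel. norm (f (t + v n) + g (t + v n) - (f t + g t)))
        \<le> (LINT t|lborel. norm (f (t + v n) - f t) + norm (g (t + v n) - g t))"
        using i by (intro integral_mono) (auto simp: norm_diff_triangle_ineq)
      also have "\<dots> = (LINT t|lborel. norm (f (t + v n) - f t)) + (LINT t|lborel. norm (g (t + v n) - g t))"
        using i by (intro Bochner_Integration.integral_add) auto
      finally show ?thesis .
    qed
    then show "\<forall>\<^sub>F n in sequentially. (LINT t|lborel. norm (f (t + v n) + g (t + v n) - (f t + g t)))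
       \<le> (LINT t|lborel. norm (f (t + v n) - f t)) + (LINT t|lborel. norm (g (t + v n) - g t))" by simp
    show "\<forall>\<^sub>F n in sequentially. 0 \<le> (LINT t|lborel. norm (f (t + v n) + g (t + v n) - (f t + g t)))"
      by (intro always_eventually allI integral_nonneg_AE) auto
  qed
next
  case (lim f s)
  have [measurable]: "f \<in> borel_measurable borel" "s i \<in> borel_measurable borel" for i using lim.hyps by auto
  have "(\<lambda>i. LINT t|lborel. norm (s i t - f t)) \<longlonglongrightarrow> (LINT t|(lborel::'a measure). 0)"
  proof (rule integral_dominated_convergence[where w = "\<lambda>t. 3 * norm (f t)"])
    show "AE t in lborel. (\<lambda>i. norm (s i t - f t)) \<longlonglongrightarrow> 0"
      using lim.hyps(2) by (intro AE_I2 tendsto_norm_zero LIM_zero) simp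
    show "AE t in lborel. norm (norm (s i t - f t)) \<le> 3 * norm (f t)" for i
    proof (rule AE_I2)
      fix t show "norm (norm (s i t - f t)) \<le> 3 * norm (f t)"
        using norm_triangle_ineq4[of "s i t" "f t"] lim.hyps(3)[of t i] by simp
    qed
  qed (use lim.hyps in auto)
  then have conv: "(\<lambda>i. LINT t|lborel. norm (s i t - f t)) \<longlonglongrightarrow> 0" by simp
  show ?case
  proof (rule LIMSEQ_I)
    fix e :: real assume e: "e > 0"
    obtain j where j: "norm ((LINT t|lborel. norm (s j t - f t)) - 0) < e / 3"
      using LIMSEQ_D[OF conv, of "e / 3"] e by auto
    obtain N where N: "\<And>n. n \<ge> N \<Longrightarrow> norm ((LINT t|lborel. norm (s j (t + v n) - s j t)) - 0) < e / 3"
      using LIMSEQ_D[OF lim.IH[of j], of "e / 3"] e by auto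
    have "norm ((LINT t|lborel. norm (f (t + v n) - f t)) - 0) < e" if "n \<ge> N" for n
    proof -
      note i = lim.hyps(1)[of j] lim.hyps(4) integrable_translate[OF lim.hyps(1)[of j]] integrable_translate[OF lim.hyps(4)]
      have "(LINT t|lborel. norm (f (t + v n) - f t))
        \<le> (LINT t|lborel. norm (s j (t + v n) - f (t + v n)) + (norm (s j (t + v n) - s j t) + norm (s j t - f t)))"
      proof (rule integral_mono)
        fix t
        have "f (t + v n) - f t = - (s j (t + v n) - f (t + v n)) + ((s j (t + v n) - s j t) + (s j t - f t))" by simp
        also have "norm \<dots> \<le> norm (s j (t + v n) - f (t + v n)) + (norm (s j (t + v n) - s j t) + norm (s j t - f t))"
          by (intro order_trans[OF norm_triangle_ineq] add_mono norm_triangle_ineq) (auto simp: norm_minus_commute)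
        finally show "norm (f (t + v n) - f t) \<le> norm (s j (t + v n) - f (t + v n)) + (norm (s j (t + v n) - s j t) + norm (s j t - f t))" .
      qed (use i in auto)
      also have "\<dots> = (LINT t|lborel. norm (s j (t + v n) - f (t + v n))) + ((LINT t|lborel. norm (s j (t + v n) - s j t)) + (LINT t|lborel. norm (s j t - f t)))"
        using i by simp
      also have "(LINT t|lborel. norm (s j (t + v n) - f (t + v n))) = (LINT t|lborel. norm (s j t - f t))"
        by (rule lborel_integral_translate[of "\<lambda>t. norm (s j t - f t)"]) simp
      also have "\<dots> + ((LINT t|lborel. norm (s j (t + v n) - s j t)) + (LINT t|lborel. norm (s j t - f t))) < e"
        using N[OF that] j by simp
      finally have "(LINT t|lborel. norm (f (t + v n) - f t)) < e" .
      moreover have "(LINT t|lborel. norm (f (t + v n) - f t)) \<ge> 0" by (intro integral_nonneg_AE) auto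
      ultimately show ?thesis by simp
    qed
    then show "\<exists>no. \<forall>n\<ge>no. norm ((LINT t|lborel. norm (f (t + v n) - f t)) - 0) < e" by blast
  qed
qed

text \<open>The Gaussian has mass 1, so smoothed minus original is a Gaussian average of differences
  h(t - \<epsilon> y) - h(t); Tonelli's theorem then exchanges the integrations.\<close>

lemma gauss_smooth_error:
  fixes h :: "'a::euclidean_space \<Rightarrow> complex"
  assumes h: "integrable lborel h"
  shows "(\<integral>\<^sup>+t. ennreal (norm (gauss_smooth \<epsilon> h t - h t)) \<partial>lborel)
    \<le> (\<integral>\<^sup>+y. ennreal (std_gauss y * (LINT t|lborel. norm (h (t - \<epsilon> *\<^sub>R y) - h t))) \<partial>lborel)"
proof -
  have [measurable]: "h \<in> borel_measurable borel" using h by auto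
  let ?g = "\<lambda>t y. complex_of_real (std_gauss y) * (h (t - \<epsilon> *\<^sub>R y) - h t)"
  have "ennreal (norm (gauss_smooth \<epsilon> h t - h t)) \<le> (\<integral>\<^sup>+y. ennreal (norm (?g t y)) \<partial>lborel)" for t
  proof (cases "integrable lborel (?g t)")
    case True
    have c: "integrable lborel (\<lambda>y::'a. complex_of_real (std_gauss y) * h t)"
      using std_gauss_integrable[where 'a = 'a] by (intro integrable_mult_left integrable_of_real)
    have "gauss_smooth \<epsilon> h t = (LINT y|lborel. ?g t y + complex_of_real (std_gauss y) * h t)"
      unfolding gauss_smooth_def by (simp add: algebra_simps)
    also have "\<dots> = (LINT y|lborel. ?g t y) + h t"
      using True c std_gauss_integral[where 'a = 'a] by simp
    finally have "gauss_smooth \<epsilon> h t - h t = (LINT y|lborel. ?g t y)" by simp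
    then show ?thesis using integral_norm_bound_ennreal[OF True] by simp
  next
    case False
    have "\<not> (\<integral>\<^sup>+y. ennreal (norm (?g t y)) \<partial>lborel) < \<infinity>"
      using False unfolding integrable_iff_bounded by simp
    then show ?thesis by (simp add: not_less top_unique)
  qed
  then have "(\<integral>\<^sup>+t. ennreal (norm (gauss_smooth \<epsilon> h t - h t)) \<partial>lborel) \<le> (\<integral>\<^sup>+t. \<integral>\<^sup>+y. ennreal (norm (?g t y)) \<partial>lborel \<partial>lborel)"
    by (intro nn_integral_mono)
  also have "\<dots> = (\<integral>\<^sup>+y. \<integral>\<^sup>+t. ennreal (norm (?g t y)) \<partial>lborel \<partial>lborel)"
    by (rule lborel_pair.Fubini') measurable
  also have "\<dots> = (\<integral>\<^sup>+y. ennreal (std_gauss y * (LINT t|lborel. norm (h (t - \<epsilon> *\<^sub>R y) - h t))) \<partial>lborel)"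
  proof (rule nn_integral_cong)
    fix y :: 'a
    have i: "integrable lborel (\<lambda>t. norm (h (t - \<epsilon> *\<^sub>R y) - h t))"
      using integrable_translate[OF h, of "- (\<epsilon> *\<^sub>R y)"] h by simp
    have "(\<integral>\<^sup>+t. ennreal (norm (?g t y)) \<partial>lborel) = (\<integral>\<^sup>+t. ennreal (std_gauss y) * ennreal (norm (h (t - \<epsilon> *\<^sub>R y) - h t)) \<partial>lborel)"
      by (simp add: norm_mult ennreal_mult)
    also have "\<dots> = ennreal (std_gauss y) * (\<integral>\<^sup>+t. ennreal (norm (h (t - \<epsilon> *\<^sub>R y) - h t)) \<partial>lborel)"
      by (intro nn_integral_cmult) measurable
    also have "(\<integral>\<^sup>+t. ennreal (norm (h (t - \<epsilon> *\<^sub>R y) - h t)) \<partial>lborel) = ennreal (LINT t|lborel. norm (h (t - \<epsilon> *\<^sub>R y) - h t))"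
      by (intro nn_integral_eq_integral i) auto
    finally show "(\<integral>\<^sup>+t. ennreal (norm (?g t y)) \<partial>lborel) = ennreal (std_gauss y * (LINT t|lborel. norm (h (t - \<epsilon> *\<^sub>R y) - h t)))"
      by (simp add: ennreal_mult)
  qed
  finally show ?thesis .
qed

text \<open>The mean translation error \<open>m n y\<close> tends to 0 for each y and never exceeds
  twice the L^1 norm, so its Gaussian average tends to 0 by dominated convergence.\<close>

lemma gauss_smooth_L1:
  fixes h :: "'a::euclidean_space \<Rightarrow> complex"
  assumes h: "integrable lborel h"
  defines "u \<equiv> \<lambda>n t. gauss_smooth (inverse (real (Suc n))) h t - h t"
  shows "integrable lborel (u n)" and "(\<lambda>n. LINT t|lborel. norm (u n t)) \<longlonglongrightarrow> 0"
proof -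
  have [measurable]: "h \<in> borel_measurable borel" using h by auto
  define e where "e n = inverse (real (Suc n))" for n
  have e: "e \<longlonglongrightarrow> 0" unfolding e_def using LIMSEQ_inverse_real_of_nat by auto
  define J where "J = (LINT t|lborel. norm (h t))"
  define m where "m n y = (LINT t|lborel. norm (h (t - e n *\<^sub>R y) - h t))" for n y
  have m0: "m n y \<ge> 0" for n y unfolding m_def by (intro integral_nonneg_AE) auto
  have mJ: "m n y \<le> 2 * J" for n y
  proof -
    note i = h integrable_translate[OF h, of "- (e n *\<^sub>R y)"]
    have "m n y \<le> (LINT t|lborel. norm (h (t - e n *\<^sub>R y)) + norm (h t))"
      unfolding m_def using i by (intro integral_mono) (auto simp: norm_triangle_ineq4)
    also have "\<dots> = (LINT t|lborel. norm (h (t - e n *\<^sub>R y))) + J"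
      unfolding J_def using i by (intro Bochner_Integration.integral_add) auto
    also have "(LINT t|lborel. norm (h (t - e n *\<^sub>R y))) = J"
      unfolding J_def using lborel_integral_translate[of "\<lambda>t. norm (h t)" "- (e n *\<^sub>R y)"] by simp
    finally show ?thesis by simp
  qed
  have [measurable]: "m n \<in> borel_measurable borel" for n unfolding m_def[abs_def] by measurable
  have J0: "J \<ge> 0" unfolding J_def by (intro integral_nonneg_AE) auto
  have iJ: "integrable lborel (\<lambda>y::'a. std_gauss y * (2 * J))" using std_gauss_integrable[where 'a = 'a] by simp
  have ig: "integrable lborel (\<lambda>y. std_gauss y * m n y)" for n
    by (rule Bochner_Integration.integrable_bound[OF iJ]) (use m0 mJ J0 in \<open>auto intro!: mult_left_mono\<close>)
  have "(\<lambda>n. LINT y|lborel. std_gauss y * m n y) \<longlonglongrightarrow> (LINT y|(lborel::'a measure). 0)"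
  proof (rule integral_dominated_convergence[OF _ _ iJ])
    show "AE y in lborel. (\<lambda>n. std_gauss y * m n y) \<longlonglongrightarrow> 0"
    proof (rule AE_I2)
      fix y :: 'a
      have "(\<lambda>n. - (e n *\<^sub>R y)) \<longlonglongrightarrow> - (0 *\<^sub>R y)" by (intro tendsto_intros e)
      then have "(\<lambda>n. m n y) \<longlonglongrightarrow> 0"
        unfolding m_def using L1_translation_continuous[OF h, of "\<lambda>n. - (e n *\<^sub>R y)"] by simp
      from tendsto_mult[OF tendsto_const this, of "std_gauss y"] show "(\<lambda>n. std_gauss y * m n y) \<longlonglongrightarrow> 0" by simp
    qed
    show "AE y in lborel. norm (std_gauss y * m n y) \<le> std_gauss y * (2 * J)" for n
      using m0 mJ by (intro AE_I2) (auto simp: abs_mult intro!: mult_left_mono)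
  qed auto
  then have lim: "(\<lambda>n. LINT y|lborel. std_gauss y * m n y) \<longlonglongrightarrow> 0" by simp
  have le: "(\<integral>\<^sup>+t. ennreal (norm (u n t)) \<partial>lborel) \<le> ennreal (LINT y|lborel. std_gauss y * m n y)" for n
    using gauss_smooth_error[OF h, of "e n"] nn_integral_eq_integral[OF ig[of n]] m0
    unfolding u_def e_def[symmetric] m_def[symmetric] by simp
  have i: "integrable lborel (u n)" for n
    using le[of n] by (intro integrableI_bounded) (auto simp: u_def less_top[symmetric] top_unique)
  then show "integrable lborel (u n)" .
  have "(LINT t|lborel. norm (u n t)) \<le> (LINT y|lborel. std_gauss y * m n y)" for n
  proof -
    have "ennreal (LINT t|lborel. norm (u n t)) = (\<integral>\<^sup>+t. ennreal (norm (u n t)) \<partial>lborel)"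
      by (intro nn_integral_eq_integral[symmetric] integrable_norm i) auto
    with le[of n] have "ennreal (LINT t|lborel. norm (u n t)) \<le> ennreal (LINT y|lborel. std_gauss y * m n y)" by simp
    moreover have "(LINT y|lborel. std_gauss y * m n y) \<ge> 0" using m0 by (intro integral_nonneg_AE) auto
    ultimately show ?thesis by (simp add: ennreal_le_iff)
  qed
  then show "(\<lambda>n. LINT t|lborel. norm (u n t)) \<longlonglongrightarrow> 0"
    by (intro tendsto_sandwich[OF _ _ tendsto_const lim] always_eventually allI integral_nonneg_AE) auto
qed

text \<open>The opposite inequality comes from the first one, applied on the frequency side: up to
  reflection, the smoothed \<open>h\<close> is the Fourier transform of the damped transform
  \<open>k\<close>. Smoothing is then removed by Fatou's lemma.\<close>

lemma plancherel_ge: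
  fixes h :: "'a::euclidean_space \<Rightarrow> complex"
  assumes h: "integrable lborel h"
  shows "(\<integral>\<^sup>+t. ennreal ((norm (h t))\<^sup>2) \<partial>lborel) \<le> (\<integral>\<^sup>+\<omega>. ennreal ((norm (fourier h \<omega>))\<^sup>2) \<partial>lborel)"
proof -
  have [measurable]: "h \<in> borel_measurable borel" using h by auto
  let ?F = "\<integral>\<^sup>+\<omega>. ennreal ((norm (fourier h \<omega>))\<^sup>2) \<partial>lborel"
  define e where "e n = inverse (real (Suc n))" for n
  have e: "e n > 0" for n by (simp add: e_def)
  have smooth: "(\<integral>\<^sup>+t. ennreal ((norm (gauss_smooth (e n) h t))\<^sup>2) \<partial>lborel) \<le> ?F" for n
  proof -
    define k where "k \<omega> = fourier h \<omega> * complex_of_real (gauss_weight (e n) \<omega>)" for \<omega> :: 'a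
    have [measurable]: "k \<in> borel_measurable borel" unfolding k_def[abs_def] by measurable
    have ik: "integrable lborel k"
    proof (rule Bochner_Integration.integrable_bound)
      show "integrable lborel (\<lambda>\<omega>::'a. (LINT t|lborel. norm (h t)) * gauss_weight (e n) \<omega>)"
        using gauss_weight_integrable[OF e, where 'a = 'a] by simp
      show "AE \<omega> in lborel. norm (k \<omega>) \<le> norm ((LINT t|lborel. norm (h t)) * gauss_weight (e n) \<omega>)"
        unfolding k_def using fourier_bound[OF h]
        by (intro AE_I2) (auto simp: norm_mult abs_mult intro!: mult_right_mono order_trans[OF _ abs_ge_self])
    qed simp
    have "gauss_smooth (e n) h t = fourier k (0 - t)" for t
      unfolding fourier_gauss_inverse[OF h e, symmetric] fourier_def k_def[abs_def] by (simp add: inner_commute)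
    then have "(\<integral>\<^sup>+t. ennreal ((norm (gauss_smooth (e n) h t))\<^sup>2) \<partial>lborel) = (\<integral>\<^sup>+t. ennreal ((norm (fourier k (0 - t)))\<^sup>2) \<partial>lborel)"
      by simp
    also have "\<dots> = (\<integral>\<^sup>+t. ennreal ((norm (fourier k t))\<^sup>2) \<partial>lborel)"
      by (rule nn_integral_reflect[where f = "\<lambda>t. ennreal ((norm (fourier k t))\<^sup>2)"]) measurable
    also have "\<dots> \<le> (\<integral>\<^sup>+\<omega>. ennreal ((norm (k \<omega>))\<^sup>2) \<partial>lborel)" by (rule plancherel_le[OF ik])
    also have "\<dots> \<le> ?F"
    proof (intro nn_integral_mono ennreal_leI power_mono)
      fix \<omega> :: 'a
      show "norm (k \<omega>) \<le> norm (fourier h \<omega>)"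
        unfolding k_def by (simp add: norm_mult mult_left_le gauss_weight_le_1)
    qed auto
    finally show ?thesis .
  qed
  \<comment> \<open>Since \<open>h\<close> may be discontinuous, pointwise convergence is available
    only almost everywhere and along a subsequence.\<close>
  obtain r where r: "strict_mono r" "AE t in lborel. (\<lambda>n. gauss_smooth (e (r n)) h t - h t) \<longlonglongrightarrow> 0"
    using tendsto_L1_AE_subseq[OF gauss_smooth_L1[OF h]] unfolding e_def by blast
  have "(\<integral>\<^sup>+t. ennreal ((norm (h t))\<^sup>2) \<partial>lborel) = (\<integral>\<^sup>+t. liminf (\<lambda>n. ennreal ((norm (gauss_smooth (e (r n)) h t))\<^sup>2)) \<partial>lborel)"
  proof (rule nn_integral_cong_AE)
    show "AE t in lborel. ennreal ((norm (h t))\<^sup>2) = liminf (\<lambda>n. ennreal ((norm (gauss_smooth (e (r n)) h t))\<^sup>2))"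
      using r(2)
    proof eventually_elim
      case (elim t)
      then have "(\<lambda>n. gauss_smooth (e (r n)) h t) \<longlonglongrightarrow> h t" by (rule LIM_zero_cancel)
      then have "(\<lambda>n. ennreal ((norm (gauss_smooth (e (r n)) h t))\<^sup>2)) \<longlonglongrightarrow> ennreal ((norm (h t))\<^sup>2)"
        by (intro tendsto_ennrealI tendsto_intros)
      from lim_imp_Liminf[OF sequentially_bot this] show ?case by simp
    qed
  qed
  also have "\<dots> \<le> liminf (\<lambda>n. \<integral>\<^sup>+t. ennreal ((norm (gauss_smooth (e (r n)) h t))\<^sup>2) \<partial>lborel)"
    by (intro nn_integral_liminf) measurable
  also have "\<dots> \<le> ?F" by (intro Liminf_le) (auto intro!: always_eventually smooth)
  finally show ?thesis .
qed

theorem plancherel: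
  fixes h :: "'a::euclidean_space \<Rightarrow> complex"
  assumes "integrable lborel h"
  shows "(\<integral>\<^sup>+\<omega>. ennreal ((norm (fourier h \<omega>))\<^sup>2) \<partial>lborel) = (\<integral>\<^sup>+t. ennreal ((norm (h t))\<^sup>2) \<partial>lborel)"
  using plancherel_le[OF assms] plancherel_ge[OF assms] by (rule antisym)

section \<open>From Plancherel's theorem to Moyal's identity\<close>

lemma L2_inner_tf_shift_fourier:
  "L2_inner f (tf_shift (x, \<omega>) \<phi>) = fourier (\<lambda>t. f t * cnj (\<phi> (t - x))) \<omega>"
  unfolding L2_inner_def fourier_def
  by (intro Bochner_Integration.integral_cong) (simp_all add: tf_shift_def cis_cnj mult_ac)

text \<open>For fixed position the transform is, in the frequency variable, the Fourier transform of
  an integrable product. Plancherel's theorem handles the frequency and Tonelli's theorem separates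
  the remaining integrals over x and t.\<close>

theorem moyal:
  fixes f \<phi> :: "'a::euclidean_space \<Rightarrow> complex"
  assumes [measurable]: "f \<in> borel_measurable borel" and f: "integrable lborel (\<lambda>t. (norm (f t))\<^sup>2)"
    and \<phi>: "schwartz \<phi>"
  shows "(\<integral>\<^sup>+z. ennreal ((norm (L2_inner f (tf_shift z \<phi>)))\<^sup>2) \<partial>lborel)
    = (\<integral>\<^sup>+t. ennreal ((norm (f t))\<^sup>2) \<partial>lborel) * (\<integral>\<^sup>+t. ennreal ((norm (\<phi> t))\<^sup>2) \<partial>lborel)"
proof -
  have [measurable]: "\<phi> \<in> borel_measurable borel" by (rule schwartz_measurable[OF \<phi>])
  have int: "integrable lborel (\<lambda>t. f t * cnj (\<phi> (t - x)))" for x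
  proof (rule integrable_mult_square)
    show "integrable lborel (\<lambda>t. (norm (cnj (\<phi> (t - x))))\<^sup>2)"
      using integrable_translate[OF schwartz_square_integrable[OF \<phi>], of "- x"] by simp
  qed (use f in auto)
  have "continuous_on UNIV (\<lambda>z. L2_inner f (tf_shift z \<phi>))"
    using f by (intro L2_inner_tf_shift_continuous \<phi>) auto
  then have [measurable]: "(\<lambda>z. L2_inner f (tf_shift z \<phi>)) \<in> borel_measurable borel"
    by (rule borel_measurable_continuous_onI)
  have "(\<integral>\<^sup>+z. ennreal ((norm (L2_inner f (tf_shift z \<phi>)))\<^sup>2) \<partial>lborel)
     = (\<integral>\<^sup>+z. ennreal ((norm (L2_inner f (tf_shift z \<phi>)))\<^sup>2) \<partial>(lborel \<Otimes>\<^sub>M lborel))"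
    by (simp only: lborel_prod)
  also have "\<dots> = (\<integral>\<^sup>+x. \<integral>\<^sup>+\<omega>. ennreal ((norm (L2_inner f (tf_shift (x, \<omega>) \<phi>)))\<^sup>2) \<partial>lborel \<partial>lborel)"
    by (rule lborel.nn_integral_fst[symmetric]) (simp add: lborel_prod)
  also have "\<dots> = (\<integral>\<^sup>+x. \<integral>\<^sup>+t. ennreal ((norm (f t * cnj (\<phi> (t - x))))\<^sup>2) \<partial>lborel \<partial>lborel)"
    unfolding L2_inner_tf_shift_fourier plancherel[OF int] ..
  also have "\<dots> = (\<integral>\<^sup>+t. \<integral>\<^sup>+x. ennreal ((norm (f t * cnj (\<phi> (t - x))))\<^sup>2) \<partial>lborel \<partial>lborel)"
    by (rule lborel_pair.Fubini') measurable
  also have "\<dots> = (\<integral>\<^sup>+t. ennreal ((norm (f t))\<^sup>2) * (\<integral>\<^sup>+x. ennreal ((norm (\<phi> x))\<^sup>2) \<partial>lborel) \<partial>lborel)"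
  proof (rule nn_integral_cong)
    fix t
    have "(\<integral>\<^sup>+x. ennreal ((norm (f t * cnj (\<phi> (t - x))))\<^sup>2) \<partial>lborel)
       = (\<integral>\<^sup>+x. ennreal ((norm (f t))\<^sup>2) * ennreal ((norm (\<phi> (t - x)))\<^sup>2) \<partial>lborel)"
      by (simp add: norm_mult power_mult_distrib ennreal_mult)
    also have "\<dots> = ennreal ((norm (f t))\<^sup>2) * (\<integral>\<^sup>+x. ennreal ((norm (\<phi> (t - x)))\<^sup>2) \<partial>lborel)"
      by (intro nn_integral_cmult) measurable
    also have "(\<integral>\<^sup>+x. ennreal ((norm (\<phi> (t - x)))\<^sup>2) \<partial>lborel) = (\<integral>\<^sup>+x. ennreal ((norm (\<phi> x))\<^sup>2) \<partial>lborel)"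
      by (rule nn_integral_reflect[where f = "\<lambda>x. ennreal ((norm (\<phi> x))\<^sup>2)"]) measurable
    finally show "(\<integral>\<^sup>+x. ennreal ((norm (f t * cnj (\<phi> (t - x))))\<^sup>2) \<partial>lborel)
       = ennreal ((norm (f t))\<^sup>2) * (\<integral>\<^sup>+x. ennreal ((norm (\<phi> x))\<^sup>2) \<partial>lborel)" .
  qed
  also have "\<dots> = (\<integral>\<^sup>+t. ennreal ((norm (f t))\<^sup>2) \<partial>lborel) * (\<integral>\<^sup>+t. ennreal ((norm (\<phi> t))\<^sup>2) \<partial>lborel)"
    by (rule nn_integral_multc) measurable
  finally show ?thesis .
qed


section \<open>The reproducing formula\<close>

locale schwartz_window =
  fixes \<phi> :: "'a::euclidean_space \<Rightarrow> complex"
  assumes schwartz_window: "schwartz \<phi>" and window_nonzero: "\<phi> \<noteq> (\<lambda>_. 0)"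
begin

definition energy :: real where
  "energy = (LINT t|lborel. (norm (\<phi> t))\<^sup>2)"

lemma L2_inner_window: "L2_inner \<phi> \<phi> = complex_of_real energy"
  unfolding L2_inner_def energy_def integral_complex_of_real[symmetric]
  by (intro Bochner_Integration.integral_cong) (simp_all only: complex_norm_square)

lemma window_measurable [measurable]: "\<phi> \<in> borel_measurable borel"
  by (rule schwartz_measurable[OF schwartz_window])

lemma window_continuous: "continuous_on S \<phi>"
  using schwartz_continuous[OF schwartz_window, of "[]"] by simp

lemma energy_eq_nn_integral: "ennreal energy = (\<integral>\<^sup>+t. ennreal ((norm (\<phi> t))\<^sup>2) \<partial>lborel)"
  unfolding energy_def by (intro nn_integral_eq_integral[symmetric] schwartz_square_integrable[OF schwartz_window]) auto

lemma energy_pos: "energy > 0"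
proof -
  obtain t0 where t0: "\<phi> t0 \<noteq> 0" using window_nonzero by blast
  \<comment> \<open>A continuous window that is nonzero at a point is nonzero on a ball, and balls
    have positive measure.\<close>
  have "open (\<phi> -` (- {0}))"
    using window_continuous by (intro open_vimage) (auto simp: open_Compl)
  then obtain r where r: "r > 0" "ball t0 r \<subseteq> \<phi> -` (- {0})"
    using t0 unfolding open_contains_ball by blast
  have "energy \<noteq> 0"
  proof
    assume "energy = 0"
    then have "AE t in lborel. (norm (\<phi> t))\<^sup>2 = 0"
      using integral_nonneg_eq_0_iff_AE[OF schwartz_square_integrable[OF schwartz_window]] unfolding energy_def by simp
    then have "AE t in lborel. t \<notin> ball t0 r"
      by eventually_elim (use r(2) in auto)
    then have "emeasure lborel (ball t0 r) = 0"
      by (subst (asm) AE_iff_measurable[where N = "ball t0 r"]) auto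
    then show False using content_ball_pos[OF r(1), of t0] by (simp add: measure_def)
  qed
  moreover have "energy \<ge> 0" unfolding energy_def by (intro integral_nonneg_AE) auto
  ultimately show ?thesis by simp
qed

lemma L2_inner_continuous:
  assumes "schwartz \<psi>"
  shows "continuous_on UNIV (\<lambda>z. L2_inner \<psi> (tf_shift z \<phi>))"
  by (intro L2_inner_tf_shift_continuous schwartz_window schwartz_measurable schwartz_square_integrable assms)

text \<open>For fixed position x, Fourier inversion in the frequency recovers the product of
  \<open>\<psi>\<close> with the conjugate translated window at t. Multiplying by the window and
  integrating over x produces the energy. The identity holds at every point, as its use under a
  distribution requires.\<close>

lemma stft_inversion:
  assumes \<psi>: "schwartz \<psi>"
  shows "complex_of_real energy * \<psi> t = (LINT w|lborel. L2_inner \<psi> (tf_shift w \<phi>) * tf_shift w \<phi> t)"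
proof -
  have [measurable]: "\<psi> \<in> borel_measurable borel" by (rule schwartz_measurable[OF \<psi>])
  have [measurable]: "(\<lambda>w. L2_inner \<psi> (tf_shift w \<phi>)) \<in> borel_measurable borel"
    by (intro borel_measurable_continuous_onI L2_inner_continuous \<psi>)
  let ?f = "\<lambda>w. L2_inner \<psi> (tf_shift w \<phi>) * tf_shift w \<phi> t"
  obtain B where B: "B > 0" "\<And>t. norm (\<phi> t) \<le> B"
    using schwartz_decay[OF schwartz_window, of "[]" 0] by auto
  obtain B' where B': "B' > 0" "\<And>t. norm (\<psi> t) \<le> B'"
    using schwartz_decay[OF \<psi>, of "[]" 0] by auto
  obtain C where C: "C > 0" "\<And>w. norm (L2_inner \<psi> (tf_shift w \<phi>)) \<le> C * decay (DIM('a \<times> 'a) + 2) w"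
    using stft_schwartz_decay[OF \<psi> schwartz_window] by blast
  have mf: "?f \<in> borel_measurable borel"
  proof -
    have "continuous_on UNIV (\<lambda>w. tf_shift w \<phi> t)"
      unfolding tf_shift_def by (intro continuous_intros continuous_on_compose2[OF window_continuous[of UNIV]]) auto
    from borel_measurable_continuous_onI[OF this] show ?thesis by measurable
  qed
  have "integrable lborel ?f"
  proof (rule integrable_decay_bound[OF mf order_refl])
    fix w
    have "norm (?f w) \<le> (C * decay (DIM('a \<times> 'a) + 2) w) * B"
      unfolding norm_mult by (intro mult_mono C) (auto simp: tf_shift_def norm_mult B C less_imp_le)
    then show "norm (?f w) \<le> (C * B) * decay (DIM('a \<times> 'a) + 2) w" by (simp add: mult_ac)
  qed
  then have int: "integrable (lborel \<Otimes>\<^sub>M lborel) ?f" by (simp only: lborel_prod)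
  have "(LINT w|lborel. ?f w) = (LINT w|(lborel \<Otimes>\<^sub>M lborel). ?f w)" by (simp only: lborel_prod)
  also have "\<dots> = (LINT x|lborel. (LINT \<omega>|lborel. ?f (x, \<omega>)))"
    by (rule lborel_pair.integral_fst'[OF int, symmetric])
  also have "\<dots> = (LINT x|lborel. \<psi> t * complex_of_real ((norm (\<phi> (t - x)))\<^sup>2))"
  proof (rule Bochner_Integration.integral_cong[OF refl])
    fix x
    let ?h = "\<lambda>s. \<psi> s * cnj (\<phi> (s - x))"
    have inv: "?h t = (LINT \<omega>|lborel. cis (2 * pi * (\<omega> \<bullet> t)) * fourier ?h \<omega>)"
    proof (rule fourier_inversion)
      show "integrable lborel ?h"
        using stft_integrand_integrable[OF \<psi> schwartz_window, of "[]" "[]" 0 x] by simp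
      show "continuous_on UNIV ?h"
        using stft_integrand_continuous[OF \<psi> schwartz_window, of "[]" "[]" 0 x] by simp
      show "norm (?h s) \<le> B' * B" for s
        unfolding norm_mult complex_mod_cnj using B B' by (intro mult_mono) (auto intro: less_imp_le)
      \<comment> \<open>Inversion needs an integrable transform; the joint decay in (x, \<omega>)
        implies decay in \<omega> alone.\<close>
      show "integrable lborel (fourier ?h)"
      proof (rule integrable_decay_bound)
        show "fourier ?h \<in> borel_measurable borel" by measurable
        show "DIM('a) + 2 \<le> DIM('a \<times> 'a) + 2" by simp
        fix \<omega> :: 'a
        have "norm (fourier ?h \<omega>) \<le> C * decay (DIM('a \<times> 'a) + 2) (x, \<omega>)"
          unfolding L2_inner_tf_shift_fourier[symmetric] by (rule C(2))
        also have "\<dots> \<le> C * decay (DIM('a \<times> 'a) + 2) \<omega>"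
          using C(1) by (intro mult_left_mono decay_norm_mono norm_snd_le) auto
        finally show "norm (fourier ?h \<omega>) \<le> C * decay (DIM('a \<times> 'a) + 2) \<omega>" .
      qed
    qed
    have "(LINT \<omega>|lborel. ?f (x, \<omega>)) = (LINT \<omega>|lborel. \<phi> (t - x) * (cis (2 * pi * (\<omega> \<bullet> t)) * fourier ?h \<omega>))"
      unfolding L2_inner_tf_shift_fourier
      by (intro Bochner_Integration.integral_cong) (simp_all add: tf_shift_def mult_ac)
    also have "\<dots> = \<phi> (t - x) * ?h t" unfolding integral_mult_right_zero inv[symmetric] ..
    also have "\<dots> = \<psi> t * complex_of_real ((norm (\<phi> (t - x)))\<^sup>2)"
      by (simp only: complex_norm_square mult_ac)
    finally show "(LINT \<omega>|lborel. ?f (x, \<omega>)) = \<psi> t * complex_of_real ((norm (\<phi> (t - x)))\<^sup>2)" .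
  qed
  also have "\<dots> = \<psi> t * complex_of_real (LINT x|lborel. (norm (\<phi> (t - x)))\<^sup>2)"
    unfolding integral_mult_right_zero integral_complex_of_real ..
  also have "(LINT x|lborel. (norm (\<phi> (t - x)))\<^sup>2) = energy"
    unfolding energy_def by (rule lborel_integral_reflect[where f = "\<lambda>x. (norm (\<phi> x))\<^sup>2"]) measurable
  finally show ?thesis by (simp add: mult.commute)
qed

text \<open>The inversion formula converges in the Schwartz topology, so a tempered distribution may be
  applied under the integral.\<close>

lemma
  assumes u: "tempered_distribution u" and \<psi>: "schwartz \<psi>"
  shows reproducing_integrable: "integrable lborel (\<lambda>w. stft \<phi> u w * cnj (L2_inner \<psi> (tf_shift w \<phi>)))"
    and reproducing_formula: "complex_of_real energy * u (\<lambda>t. cnj (\<psi> t))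
      = (LINT w|lborel. stft \<phi> u w * cnj (L2_inner \<psi> (tf_shift w \<phi>)))"
proof -
  let ?m = "\<lambda>w. cnj (L2_inner \<psi> (tf_shift w \<phi>))" and ?e = "\<lambda>w t. cnj (tf_shift w \<phi> t)"
  \<comment> \<open>The conjugated integrand of the inversion formula: \<open>stft\<close> evaluates
    \<open>u\<close> at conjugates of shifted windows.\<close>
  define G where "G w t = ?m w * ?e w t" for w t
  have sch: "schwartz (?e w)" for w by (rule schwartz_tf_shift_cnj[OF schwartz_window])
  have scale: "u (\<lambda>t. c * f t) = c * u f" if "schwartz f" for c f
    using u that by (auto simp: tempered_distribution_def)
  have schG: "schwartz (G w)" for w
    using schwartz_linear[OF sch schwartz_zero, of "?m w" w] unfolding G_def[abs_def] by simp
  have part: "iter_partial bs (G w) t = ?m w * iter_partial bs (?e w) t" if "set bs \<subseteq> Basis" for bs w t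
    using iter_partial_linear[OF sch schwartz_zero that, of "?m w" w] unfolding G_def[abs_def] by (simp add: iter_partial_zero)
  have contm: "continuous_on UNIV ?m" by (intro continuous_on_cnj L2_inner_continuous \<psi>)
  let ?K = "DIM('a \<times> 'a) + 2"
  have bound: "\<exists>C. \<forall>w t. norm (iter_partial bs (G w) t) \<le> C * decay ?K w * decay k t" if bs: "set bs \<subseteq> Basis" for bs k
  proof -
    let ?M = "length bs + k"
    obtain C1 where C1: "C1 > 0" "\<And>w t. norm (iter_partial bs (?e w) t) \<le> C1 * (1 + norm w) ^ ?M * decay k t"
      using iter_partial_tf_shift_bound[OF schwartz_window bs, of k] by blast
    \<comment> \<open>The \<open>?M\<close> additional powers of decay cancel the polynomial growth
      of the derivatives of the shifted window and leave an integrable weight.\<close>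
    obtain C2 where C2: "C2 > 0" "\<And>w. norm (L2_inner \<psi> (tf_shift w \<phi>)) \<le> C2 * decay (?K + ?M) w"
      using stft_schwartz_decay[OF \<psi> schwartz_window] by blast
    have "norm (iter_partial bs (G w) t) \<le> C1 * C2 * decay ?K w * decay k t" for w t
    proof -
      have "norm (iter_partial bs (G w) t) \<le> (C2 * decay (?K + ?M) w) * (C1 * (1 + norm w) ^ ?M * decay k t)"
        unfolding part[OF bs] norm_mult complex_mod_cnj using C1(1) C2(1) by (intro mult_mono C1 C2) auto
      also have "\<dots> = C1 * C2 * decay ?K w * ((1 + norm w) ^ ?M * decay ?M w) * decay k t"
        by (simp only: decay_add mult_ac)
      finally show ?thesis unfolding decay_mult_power by simp
    qed
    then show ?thesis by blast
  qed
  interpret integrable_schwartz_family G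
  proof
    show "schwartz (G w)" for w by (rule schG)
    fix bs :: "'a list" assume bs: "set bs \<subseteq> Basis"
    show "continuous_on UNIV (\<lambda>(w, t). iter_partial bs (G w) t)"
      unfolding part[OF bs] case_prod_unfold
      using iter_partial_tf_shift_continuous[OF schwartz_window bs]
      by (intro continuous_on_mult continuous_on_compose2[OF contm]) (auto intro!: continuous_intros simp: case_prod_unfold)
    show "\<exists>C. \<forall>w t. norm (iter_partial bs (G w) t) \<le> C * decay ?K w * decay k t" for k by (rule bound[OF bs])
    fix S :: "('a \<times> 'a) set" and k
    obtain C where C: "\<And>w t. norm (iter_partial bs (G w) t) \<le> C * decay ?K w * decay k t" using bound[OF bs] by blast
    have "norm (iter_partial bs (G w) t) \<le> \<bar>C\<bar> * decay k t" for w t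
    proof -
      have "C * decay ?K w \<le> \<bar>C\<bar> * 1" by (intro mult_mono decay_le_1) auto
      then have "C * decay ?K w * decay k t \<le> \<bar>C\<bar> * decay k t" by (intro mult_right_mono) auto
      with C[of w t] show ?thesis by (rule order_trans)
    qed
    then show "\<exists>C. \<forall>w\<in>S. \<forall>t. norm (iter_partial bs (G w) t) \<le> C * decay k t" by blast
  qed
  have uG: "u (G w) = stft \<phi> u w * ?m w" for w
    unfolding G_def[abs_def] scale[OF sch] stft_def by simp
  have s\<psi>: "schwartz (\<lambda>t. complex_of_real energy * cnj (\<psi> t))"
    using schwartz_linear[OF schwartz_cnj[OF \<psi>] schwartz_zero] by simp
  have "complex_of_real energy * cnj (\<psi> t) = (LINT w|lborel. G w t)" for t
  proof -
    have "complex_of_real energy * cnj (\<psi> t) = cnj (complex_of_real energy * \<psi> t)" by simp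
    also have "\<dots> = (LINT w|lborel. cnj (L2_inner \<psi> (tf_shift w \<phi>) * tf_shift w \<phi> t))"
      unfolding stft_inversion[OF \<psi>] by (rule Bochner_Integration.integral_cnj[symmetric])
    finally show ?thesis by (simp add: G_def)
  qed
  from tempered_distribution_integral[OF u s\<psi> this]
  show "integrable lborel (\<lambda>w. stft \<phi> u w * ?m w)"
    "complex_of_real energy * u (\<lambda>t. cnj (\<psi> t)) = (LINT w|lborel. stft \<phi> u w * ?m w)"
    unfolding uG scale[OF schwartz_cnj[OF \<psi>]] by auto
qed

text \<open>The normalisation of the pairing is the constant of the reproducing formula, so for
  Schwartz windows the extended bracket reduces to evaluating the distribution.\<close>

lemma modulation_pairing_schwartz:
  assumes "tempered_distribution u" "schwartz \<psi>"
  shows "modulation_pairing \<phi> u \<psi> = u (\<lambda>t. cnj (\<psi> t))"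
  using energy_pos
  by (simp add: modulation_pairing_def stft_fun_distribution L2_inner_window reproducing_formula[OF assms, symmetric])

text \<open>Time-frequency shifts compose only up to a phase. It does not depend on t and therefore
  disappears from absolute values of coefficients.\<close>

lemma tf_shift_tf_shift:
  "tf_shift z (tf_shift w \<phi>) = (\<lambda>t. cis (- 2 * pi * (snd w \<bullet> fst z)) * tf_shift (z + w) \<phi> t)"
proof
  fix t
  have "cis (2 * pi * (snd z \<bullet> t)) * cis (2 * pi * (snd w \<bullet> (t - fst z)))
     = cis (- 2 * pi * (snd w \<bullet> fst z)) * cis (2 * pi * (snd (z + w) \<bullet> t))"
    by (simp add: cis_mult inner_simps algebra_simps)
  then show "tf_shift z (tf_shift w \<phi>) t = cis (- 2 * pi * (snd w \<bullet> fst z)) * tf_shift (z + w) \<phi> t"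
    unfolding tf_shift_def by (simp only: mult.assoc[symmetric] diff_diff_eq fst_add)
qed

lemma norm_pairing_shifted_window:
  assumes u: "tempered_distribution u"
  shows "norm (modulation_pairing \<phi> u (tf_shift z (tf_shift w \<phi>))) = norm (stft \<phi> u (z + w))"
proof -
  have s: "schwartz (tf_shift z (tf_shift w \<phi>))" by (intro schwartz_tf_shift schwartz_window)
  have "u (\<lambda>t. cnj (tf_shift z (tf_shift w \<phi>) t))
     = cnj (cis (- 2 * pi * (snd w \<bullet> fst z))) * u (\<lambda>t. cnj (tf_shift (z + w) \<phi> t))"
    using u schwartz_tf_shift_cnj[OF schwartz_window, of "z + w"]
    unfolding tf_shift_tf_shift complex_cnj_mult tempered_distribution_def by blast
  then show ?thesis
    unfolding modulation_pairing_schwartz[OF u s] stft_def by (simp add: norm_mult)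
qed

lemma norm_L2_inner_shifted_window:
  "norm (L2_inner f (tf_shift z (tf_shift w \<phi>))) = norm (L2_inner f (tf_shift (z + w) \<phi>))"
proof -
  have "L2_inner f (tf_shift z (tf_shift w \<phi>))
     = (LINT t|lborel. cnj (cis (- 2 * pi * (snd w \<bullet> fst z))) * (f t * cnj (tf_shift (z + w) \<phi> t)))"
    unfolding L2_inner_def tf_shift_tf_shift by (simp add: mult_ac)
  also have "\<dots> = cnj (cis (- 2 * pi * (snd w \<bullet> fst z))) * L2_inner f (tf_shift (z + w) \<phi>)"
    unfolding L2_inner_def by (rule integral_mult_right_zero)
  finally show ?thesis by (simp add: norm_mult)
qed

definition autocorr :: "'a \<times> 'a \<Rightarrow> complex" where
  "autocorr z = L2_inner \<phi> (tf_shift z \<phi>)"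

text \<open>Substituting t + \<open>fst w\<close> for t exhibits the reproducing kernel as a phase
  times a function of the difference v - w: the twisted convolution structure.\<close>

lemma L2_inner_tf_shifts:
  "cnj (L2_inner (tf_shift v \<phi>) (tf_shift w \<phi>)) = cis (- 2 * pi * ((snd v - snd w) \<bullet> fst w)) * autocorr (v - w)"
proof -
  obtain x \<omega> y \<eta> where w: "w = (x, \<omega>)" and v: "v = (y, \<eta>)" by force
  have "cnj (L2_inner (tf_shift v \<phi>) (tf_shift w \<phi>)) = (LINT t|lborel. tf_shift w \<phi> t * cnj (tf_shift v \<phi> t))"
    unfolding L2_inner_def by (subst Bochner_Integration.integral_cnj[symmetric]) (simp add: mult.commute)
  also have "\<dots> = (LINT t|lborel. tf_shift w \<phi> (t + x) * cnj (tf_shift v \<phi> (t + x)))"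
    by (rule lborel_integral_translate[symmetric]) (simp add: tf_shift_def)
  also have "\<dots> = (LINT t|lborel. cis (- 2 * pi * ((\<eta> - \<omega>) \<bullet> x)) * (\<phi> t * cnj (tf_shift (v - w) \<phi> t)))"
  proof (rule Bochner_Integration.integral_cong[OF refl])
    fix t
    have "cis (2 * pi * (\<omega> \<bullet> (t + x))) * cis (- (2 * pi * (\<eta> \<bullet> (t + x))))
       = cis (- 2 * pi * ((\<eta> - \<omega>) \<bullet> x)) * cis (- (2 * pi * ((\<eta> - \<omega>) \<bullet> t)))"
      by (simp add: cis_mult inner_simps algebra_simps)
    then have "cis (2 * pi * (\<omega> \<bullet> (t + x))) * (cis (- (2 * pi * (\<eta> \<bullet> (t + x)))) * (\<phi> t * cnj (\<phi> (t + x - y))))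
       = cis (- 2 * pi * ((\<eta> - \<omega>) \<bullet> x)) * (cis (- (2 * pi * ((\<eta> - \<omega>) \<bullet> t))) * (\<phi> t * cnj (\<phi> (t + x - y))))"
      by (simp only: mult.assoc[symmetric])
    then show "tf_shift w \<phi> (t + x) * cnj (tf_shift v \<phi> (t + x))
       = cis (- 2 * pi * ((\<eta> - \<omega>) \<bullet> x)) * (\<phi> t * cnj (tf_shift (v - w) \<phi> t))"
      by (simp add: tf_shift_def w v cis_cnj mult_ac diff_diff_eq2)
  qed
  also have "\<dots> = cis (- 2 * pi * ((\<eta> - \<omega>) \<bullet> x)) * autocorr (v - w)"
    unfolding autocorr_def L2_inner_def by (rule integral_mult_right_zero)
  finally show ?thesis by (simp add: w v)
qed

text \<open>The factor \<open>cis (2 * pi * (snd q \<bullet> fst v))\<close> compensates the phase by which the reproducing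
  kernel fails to be a convolution kernel; without it the oscillation would grow with \<open>v\<close>.\<close>

lemma stft_oscillation:
  assumes "e > 0"
  shows "\<exists>\<delta>>0. \<forall>u v q. tempered_distribution u \<longrightarrow> norm q < \<delta> \<longrightarrow>
     ennreal (norm (cis (2 * pi * (snd q \<bullet> fst v)) * stft \<phi> u (v + q) - stft \<phi> u v))
       \<le> (\<integral>\<^sup>+w. ennreal (norm (stft \<phi> u w) * (e * decay (DIM('a \<times> 'a) + 2) (v - w))) \<partial>lborel)"
proof -
  let ?K = "DIM('a \<times> 'a) + 2"
  \<comment> \<open>The kernel perturbed by q, with its phase corrected, as a function of the
    difference z = v - w alone.\<close>
  let ?A = "\<lambda>q z. cis (2 * pi * (snd q \<bullet> fst z)) * autocorr (z + q)"
  obtain C where C: "C > 0" "\<And>z. norm (autocorr z) \<le> C * decay (?K + 1) z"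
    using stft_schwartz_decay[OF schwartz_window schwartz_window] unfolding autocorr_def by blast
  have conta: "continuous_on UNIV autocorr" unfolding autocorr_def[abs_def] by (rule L2_inner_continuous[OF schwartz_window])
  have "\<exists>d>0. \<forall>q\<in>cball 0 1. \<forall>q'\<in>cball 0 1. dist q q' < d \<longrightarrow> (\<forall>z. norm (?A q z - ?A q' z) \<le> (e * energy) * decay ?K z)"
  proof (rule weighted_uniform_continuity)
    show "continuous_on UNIV (\<lambda>(q, z). ?A q z)"
      unfolding case_prod_unfold by (intro continuous_intros continuous_on_compose2[OF conta]) auto
    show "e * energy > 0" using assms energy_pos by simp
    fix q z :: "'a \<times> 'a" assume "q \<in> cball 0 1"
    then have q: "norm q \<le> 1" by simp
    have "norm (?A q z) \<le> C * decay (?K + 1) (z + q)" using C(2) by (simp add: norm_mult)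
    also have "\<dots> \<le> C * (2 ^ (?K + 1) * decay (?K + 1) z)"
    proof (intro mult_left_mono)
      have "(1 + norm q) ^ (?K + 1) * decay (?K + 1) z \<le> 2 ^ (?K + 1) * decay (?K + 1) z"
        using q by (intro mult_right_mono power_mono) auto
      with decay_add_arg[of "?K + 1" z q] show "decay (?K + 1) (z + q) \<le> 2 ^ (?K + 1) * decay (?K + 1) z" by (rule order_trans)
    qed (use C(1) in simp)
    finally show "norm (?A q z) \<le> (C * 2 ^ (?K + 1)) * decay (?K + 1) z" by (simp only: mult.assoc)
  qed simp
  then obtain d where d: "d > 0" "\<And>q q' z. q \<in> cball 0 1 \<Longrightarrow> q' \<in> cball 0 1 \<Longrightarrow> dist q q' < d \<Longrightarrow>
      norm (?A q z - ?A q' z) \<le> (e * energy) * decay ?K z" by metis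
  have "ennreal (norm (cis (2 * pi * (snd q \<bullet> fst v)) * stft \<phi> u (v + q) - stft \<phi> u v))
       \<le> (\<integral>\<^sup>+w. ennreal (norm (stft \<phi> u w) * (e * decay ?K (v - w))) \<partial>lborel)"
    if u: "tempered_distribution u" and q: "norm q < min d 1" for u v q
  proof -
    let ?F = "stft \<phi> u" and ?c = "cis (2 * pi * (snd q \<bullet> fst v))"
    let ?k = "\<lambda>v w. cnj (L2_inner (tf_shift v \<phi>) (tf_shift w \<phi>))"
    have rep: "complex_of_real energy * ?F v = (LINT w|lborel. ?F w * ?k v w)" "integrable lborel (\<lambda>w. ?F w * ?k v w)" for v
      using reproducing_formula[OF u schwartz_tf_shift[OF schwartz_window]] reproducing_integrable[OF u schwartz_tf_shift[OF schwartz_window]]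
      by (simp_all add: stft_def)
    have "norm (?c * ?k (v + q) w - ?k v w) \<le> e * energy * decay ?K (v - w)" for w
    proof -
      let ?p = "cis (- 2 * pi * ((snd v - snd w) \<bullet> fst w))"
      \<comment> \<open>The compensating phase replaces the absolute position \<open>fst w\<close>
        in the q-dependent part by the relative position \<open>fst (v - w)\<close>, where decay of
        the kernel dominates.\<close>
      have "?c * cis (- 2 * pi * ((snd (v + q) - snd w) \<bullet> fst w)) = ?p * cis (2 * pi * (snd q \<bullet> fst (v - w)))"
        by (simp add: cis_mult inner_simps algebra_simps)
      then have "?c * ?k (v + q) w = ?p * ?A q (v - w)"
        unfolding L2_inner_tf_shifts by (simp add: mult.assoc[symmetric] add_diff_eq diff_add_eq)
      moreover have "?k v w = ?p * ?A 0 (v - w)" unfolding L2_inner_tf_shifts by simp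
      ultimately have "norm (?c * ?k (v + q) w - ?k v w) = norm (?p * (?A q (v - w) - ?A 0 (v - w)))"
        by (simp only: right_diff_distrib)
      also have "\<dots> = norm (?A q (v - w) - ?A 0 (v - w))" by (simp add: norm_mult)
      also have "\<dots> \<le> e * energy * decay ?K (v - w)" using q by (intro d(2)) auto
      finally show ?thesis .
    qed
    note kb = this
    have i: "integrable lborel (\<lambda>w. ?c * (?F w * ?k (v + q) w) - ?F w * ?k v w)"
      by (intro Bochner_Integration.integrable_diff integrable_mult_right rep)
    have "complex_of_real energy * (?c * ?F (v + q) - ?F v) = (LINT w|lborel. ?c * (?F w * ?k (v + q) w) - ?F w * ?k v w)"
      using rep by (simp add: right_diff_distrib mult.left_commute[of _ ?c])
    then have "ennreal (norm (complex_of_real energy * (?c * ?F (v + q) - ?F v)))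
       \<le> (\<integral>\<^sup>+w. ennreal (norm (?c * (?F w * ?k (v + q) w) - ?F w * ?k v w)) \<partial>lborel)"
      using integral_norm_bound_ennreal[OF i] by simp
    also have "\<dots> \<le> (\<integral>\<^sup>+w. ennreal energy * ennreal (norm (?F w) * (e * decay ?K (v - w))) \<partial>lborel)"
    proof (intro nn_integral_mono)
      fix w
      have "?c * (?F w * ?k (v + q) w) - ?F w * ?k v w = ?F w * (?c * ?k (v + q) w - ?k v w)"
        by (simp add: algebra_simps)
      then have "norm (?c * (?F w * ?k (v + q) w) - ?F w * ?k v w) \<le> norm (?F w) * (e * energy * decay ?K (v - w))"
        using kb[of w] by (simp only: norm_mult) (intro mult_left_mono, auto)
      from ennreal_leI[OF this]
      show "ennreal (norm (?c * (?F w * ?k (v + q) w) - ?F w * ?k v w)) \<le> ennreal energy * ennreal (norm (?F w) * (e * decay ?K (v - w)))"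
        using energy_pos assms by (simp add: ennreal_mult[symmetric] mult_ac)
    qed
    also have "\<dots> = ennreal energy * (\<integral>\<^sup>+w. ennreal (norm (?F w) * (e * decay ?K (v - w))) \<partial>lborel)"
    proof (rule nn_integral_cmult)
      have [measurable]: "?F \<in> borel_measurable borel"
        by (intro borel_measurable_continuous_onI stft_continuous schwartz_window u)
      show "(\<lambda>w. ennreal (norm (?F w) * (e * decay ?K (v - w)))) \<in> borel_measurable lborel" by measurable
    qed
    finally have "ennreal energy * ennreal (norm (?c * ?F (v + q) - ?F v)) \<le> ennreal energy * (\<integral>\<^sup>+w. ennreal (norm (?F w) * (e * decay ?K (v - w))) \<partial>lborel)"
      using energy_pos by (simp add: norm_mult ennreal_mult)
    then show ?thesis using energy_pos by (simp add: ennreal_mult_le_mult_iff)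
  qed
  then show ?thesis using d(1) by (intro exI[of _ "min d 1"]) auto
qed

end


section \<open>Sampling\<close>

lemma emeasure_ball_translate:
  "emeasure lborel (ball (c::'b::euclidean_space) r) = ennreal (measure lborel (ball (0::'b) r))"
proof (cases "r \<ge> 0")
  case True
  then have "emeasure lborel (ball c r) = emeasure lborel (ball (0::'b) r)" by (simp add: emeasure_ball)
  also have "\<dots> = ennreal (measure lborel (ball (0::'b) r))"
    using emeasure_lborel_ball_finite[of "0::'b" r] by (intro emeasure_eq_ennreal_measure) (simp add: less_top)
  finally show ?thesis .
next
  case False
  then have e: "ball c r = {}" "ball (0::'b) r = {}" by (simp_all add: ball_empty)
  show ?thesis unfolding e by simp
qed

lemma borel_measurable_nn_integral_count_space:
  fixes f :: "'i \<Rightarrow> 'a \<Rightarrow> ennreal"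
  assumes I: "countable I" and f: "\<And>i. i \<in> I \<Longrightarrow> f i \<in> borel_measurable M"
  shows "(\<lambda>x. \<integral>\<^sup>+i. f i x \<partial>count_space I) \<in> borel_measurable M"
proof -
  interpret sigma_finite_measure "count_space I" by (rule sigma_finite_measure_count_space_countable[OF I])
  have "case_prod (\<lambda>x i. f i x) \<in> borel_measurable (M \<Otimes>\<^sub>M count_space I)"
    unfolding case_prod_unfold
    by (rule measurable_compose_countable'[OF _ measurable_snd I]) (use f in measurable)
  then show ?thesis by (rule borel_measurable_nn_integral)
qed

lemma measurable_times_indicator_ball:
  fixes g :: "'b::euclidean_space \<Rightarrow> ennreal"
  assumes "g \<in> borel_measurable borel"
  shows "(\<lambda>v. g v * indicator (ball a r) v) \<in> borel_measurable lborel"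
  using assms by (intro borel_measurable_times_ennreal borel_measurable_indicator) simp_all

text \<open>A convex power lies above its tangent at m. For positive arguments this is Young's
  inequality in y = x / m with exponents p and its conjugate. Integrating it against a probability
  density gives Jensen's inequality.\<close>

lemma powr_tangent_le:
  fixes x m p :: real
  assumes p: "p \<ge> 1" and "x \<ge> 0" "m \<ge> 0"
  shows "m powr p + p * m powr (p - 1) * (x - m) \<le> x powr p"
proof (cases "x = 0 \<or> m = 0")
  case True
  then show ?thesis
  \<comment> \<open>For m = 0 the left side is 0, because \<open>0 powr a = 0\<close> for every a,
    including a = 0.\<close>
  proof (cases "m = 0")
    case False
    then have m: "m > 0" using assms by simp
    have "m powr (p - 1) * m = m powr p"
      using m powr_add[of m "p - 1" 1] by simp
    then have "m powr p + p * m powr (p - 1) * (0 - m) = (1 - p) * m powr p" by (simp add: algebra_simps)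
    also have "\<dots> \<le> 0" using p by (intro mult_nonpos_nonneg) auto
    finally show ?thesis using True False by simp
  qed simp
next
  case False
  then have x: "x > 0" and m: "m > 0" using assms by auto
  define y where "y = x / m"
  have y: "y > 0" unfolding y_def using x m by simp
  have "(y powr p) powr (1 / p) * 1 powr (1 - 1 / p) \<le> 1 / p * y powr p + (1 - 1 / p) * 1"
    using p y by (intro Youngs_inequality_0) auto
  then have "y \<le> 1 / p * y powr p + (1 - 1 / p)" using p y by (simp add: powr_powr)
  from mult_left_mono[OF this, of p] have "p * y \<le> y powr p + (p - 1)" using p by (simp add: algebra_simps)
  then have "m powr p * (1 + p * (y - 1)) \<le> m powr p * y powr p" by (intro mult_left_mono) (auto simp: algebra_simps)
  also have "m powr p * y powr p = x powr p" unfolding y_def using x m by (simp add: powr_divide)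
  also have "m powr p * (1 + p * (y - 1)) = m powr p + p * m powr (p - 1) * (x - m)"
  proof -
    have "m powr p = m powr (p - 1) * m" using m powr_add[of m "p - 1" 1] by simp
    then show ?thesis unfolding y_def using m by (simp add: field_simps)
  qed
  finally show ?thesis .
qed

text \<open>\<open>J\<close> dominates the local variation of \<open>F\<close> by an average of \<open>\<bar>F\<bar>\<close>; the factor \<open>1/4\<close> is
  what lets the error be absorbed for all exponents \<open>p\<close> with the same \<open>\<delta>\<close>, because
  \<open>2\<^sup>p 4\<^sup>-\<^sup>p \<le> 1/2\<close>.\<close>

definition locally_controlled ::
    "('b::euclidean_space \<Rightarrow> real) \<Rightarrow> real \<Rightarrow> ('b \<Rightarrow> complex) \<Rightarrow> bool" where
  "locally_controlled \<rho> \<delta> F \<longleftrightarrow> continuous_on UNIV F \<and>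
     (\<forall>v v'. dist v v' < \<delta> \<longrightarrow>
        (let J = \<integral>\<^sup>+w. ennreal (norm (F w) * (\<rho> (v - w) / 4)) \<partial>lborel
         in ennreal (norm (F v)) \<le> ennreal (norm (F v')) + J \<and>
            ennreal (norm (F v')) \<le> ennreal (norm (F v)) + J))"

text \<open>A probability density on phase space: averaging against it preserves total mass, and
  Jensen's inequality applies at every point.\<close>

locale unit_kernel =
  fixes \<rho> :: "'b::euclidean_space \<Rightarrow> real"
  assumes kernel_measurable [measurable]: "\<rho> \<in> borel_measurable borel"
    and kernel_nonneg: "\<rho> x \<ge> 0"
    and kernel_nn_integral: "(\<integral>\<^sup>+x. ennreal (\<rho> x) \<partial>lborel) = 1"
begin

lemma kernel_integrable: "integrable lborel \<rho>"
  using kernel_nonneg kernel_nn_integral by (intro integrableI_nonneg) auto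

lemma kernel_reflected:
  "integrable lborel (\<lambda>w. \<rho> (v - w))" "(LINT w|lborel. \<rho> (v - w)) = 1"
proof -
  show "integrable lborel (\<lambda>w. \<rho> (v - w))" by (rule integrable_reflect[OF kernel_integrable])
  have "ennreal (LINT x|lborel. \<rho> x) = 1"
    using nn_integral_eq_integral[OF kernel_integrable] kernel_nonneg kernel_nn_integral by simp
  then have "(LINT x|lborel. \<rho> x) = 1" by (simp add: ennreal_eq_1)
  then show "(LINT w|lborel. \<rho> (v - w)) = 1" by (subst lborel_integral_reflect) auto
qed

definition average_power :: "real \<Rightarrow> ('b \<Rightarrow> complex) \<Rightarrow> 'b \<Rightarrow> ennreal" where
  "average_power p F v = (\<integral>\<^sup>+w. ennreal (norm (F w) powr p * \<rho> (v - w)) \<partial>lborel)"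

lemma average_power_measurable [measurable]:
  assumes [measurable]: "F \<in> borel_measurable borel"
  shows "average_power p F \<in> borel_measurable borel"
  unfolding average_power_def[abs_def] by measurable

lemma nn_integral_average_power:
  assumes [measurable]: "F \<in> borel_measurable borel"
  shows "(\<integral>\<^sup>+v. average_power p F v \<partial>lborel) = (\<integral>\<^sup>+w. ennreal (norm (F w) powr p) \<partial>lborel)"
proof -
  have "(\<integral>\<^sup>+v. average_power p F v \<partial>lborel) = (\<integral>\<^sup>+w. \<integral>\<^sup>+v. ennreal (norm (F w) powr p * \<rho> (v - w)) \<partial>lborel \<partial>lborel)"
    unfolding average_power_def by (rule lborel_pair.Fubini') measurable
  also have "\<dots> = (\<integral>\<^sup>+w. ennreal (norm (F w) powr p) \<partial>lborel)"
  proof (rule nn_integral_cong)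
    fix w
    have "(\<integral>\<^sup>+v. ennreal (norm (F w) powr p * \<rho> (v - w)) \<partial>lborel) = (\<integral>\<^sup>+v. ennreal (norm (F w) powr p) * ennreal (\<rho> (v - w)) \<partial>lborel)"
      by (simp add: ennreal_mult kernel_nonneg)
    also have "\<dots> = ennreal (norm (F w) powr p) * (\<integral>\<^sup>+v. ennreal (\<rho> (v - w)) \<partial>lborel)"
      by (intro nn_integral_cmult) measurable
    also have "(\<integral>\<^sup>+v. ennreal (\<rho> (v - w)) \<partial>lborel) = 1"
      using nn_integral_translate[of "\<lambda>v. ennreal (\<rho> v)" "- w"] kernel_nn_integral by simp
    finally show "(\<integral>\<^sup>+v. ennreal (norm (F w) powr p * \<rho> (v - w)) \<partial>lborel) = ennreal (norm (F w) powr p)" by simp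
  qed
  finally show ?thesis .
qed

text \<open>Jensen's inequality bounds the p-th power of the averaged |F| by the average of |F|^p;
  the sum b + m/4 is at most twice its maximum, which gives 2^p and leaves the small factor 4^-p on
  the average.\<close>

lemma power_of_perturbation_le:
  assumes [measurable]: "F \<in> borel_measurable borel" and p: "p \<ge> 1" and a: "a \<ge> 0" and b: "b \<ge> 0"
    and le: "ennreal a \<le> ennreal b + (\<integral>\<^sup>+w. ennreal (norm (F w) * (\<rho> (v - w) / 4)) \<partial>lborel)"
  shows "ennreal (a powr p) \<le> ennreal (2 powr p) * (ennreal (b powr p) + ennreal (4 powr (- p)) * average_power p F v)"
proof (cases "average_power p F v = \<infinity>")
  case True
  then show ?thesis by (simp add: ennreal_mult_top ennreal_top_mult ennreal_zero_less_mult_iff)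
next
  case False
  let ?r = "\<lambda>w. \<rho> (v - w)"
  have ip: "integrable lborel (\<lambda>w. norm (F w) powr p * ?r w)"
    using False kernel_nonneg unfolding average_power_def by (intro integrableI_nonneg) (auto simp: less_top)
  have i1: "integrable lborel (\<lambda>w. norm (F w) * ?r w)"
  proof (rule Bochner_Integration.integrable_bound)
    show "integrable lborel (\<lambda>w. ?r w + norm (F w) powr p * ?r w)" using ip kernel_reflected by simp
    show "AE w in lborel. norm (norm (F w) * ?r w) \<le> norm (?r w + norm (F w) powr p * ?r w)"
    proof (rule AE_I2)
      fix w
      \<comment> \<open>Integrability of |F| against the density follows from that of |F|^p, since
        the density has finite mass.\<close>
      have "norm (F w) \<le> 1 + norm (F w) powr p"
      proof (cases "norm (F w) \<le> 1")
        case False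
        then have "norm (F w) powr 1 \<le> norm (F w) powr p" using p by (intro powr_mono) auto
        then show ?thesis using False by simp
      qed (simp add: add_increasing2)
      from mult_right_mono[OF this kernel_nonneg[of "v - w"]]
      show "norm (norm (F w) * ?r w) \<le> norm (?r w + norm (F w) powr p * ?r w)"
        using kernel_nonneg[of "v - w"] by (simp add: distrib_right)
    qed
  qed simp
  define m where "m = (LINT w|lborel. norm (F w) * ?r w)"
  define q where "q = (LINT w|lborel. norm (F w) powr p * ?r w)"
  have m0: "m \<ge> 0" unfolding m_def using kernel_nonneg by (intro integral_nonneg_AE) auto
  have q0: "q \<ge> 0" unfolding q_def using kernel_nonneg by (intro integral_nonneg_AE) auto
  have Q: "average_power p F v = ennreal q"
    unfolding average_power_def q_def using kernel_nonneg by (intro nn_integral_eq_integral ip) auto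
  have J: "(\<integral>\<^sup>+w. ennreal (norm (F w) * (?r w / 4)) \<partial>lborel) = ennreal (m / 4)"
  proof -
    have "(\<integral>\<^sup>+w. ennreal (norm (F w) * (?r w / 4)) \<partial>lborel) = ennreal (LINT w|lborel. norm (F w) * (?r w / 4))"
      using i1 kernel_nonneg by (intro nn_integral_eq_integral) auto
    then show ?thesis unfolding m_def by simp
  qed
  have jensen: "m powr p \<le> q"
  proof -
    let ?c = "p * m powr (p - 1)"
    have "(LINT w|lborel. m powr p * ?r w + ?c * (norm (F w) * ?r w - m * ?r w)) \<le> q"
      unfolding q_def
    proof (rule integral_mono[OF _ ip])
      show "integrable lborel (\<lambda>w. m powr p * ?r w + ?c * (norm (F w) * ?r w - m * ?r w))"
        using i1 kernel_reflected by simp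
      fix w
      have "(m powr p + ?c * (norm (F w) - m)) * ?r w \<le> norm (F w) powr p * ?r w"
        using kernel_nonneg m0 by (intro mult_right_mono powr_tangent_le p) auto
      then show "m powr p * ?r w + ?c * (norm (F w) * ?r w - m * ?r w) \<le> norm (F w) powr p * ?r w"
        by (simp add: algebra_simps)
    qed
    moreover have "(LINT w|lborel. m powr p * ?r w + ?c * (norm (F w) * ?r w - m * ?r w)) = m powr p"
      using i1 kernel_reflected by (simp add: m_def[symmetric])
    ultimately show ?thesis by simp
  qed
  have "a \<le> b + m / 4"
    using le b m0 unfolding J by (simp add: ennreal_plus[symmetric] del: ennreal_plus)
  then have "a \<le> 2 * max b (m / 4)" by simp
  then have "a powr p \<le> (2 * max b (m / 4)) powr p" using a p by (intro powr_mono2) auto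
  also have "\<dots> = 2 powr p * (max b (m / 4)) powr p" using b by (intro powr_mult)
  also have "\<dots> \<le> 2 powr p * (b powr p + (m / 4) powr p)"
    by (intro mult_left_mono) (auto simp: max_def)
  also have "(m / 4) powr p = 4 powr (- p) * m powr p"
    using m0 by (simp add: powr_divide powr_minus_divide)
  also have "2 powr p * (b powr p + 4 powr (- p) * m powr p) \<le> 2 powr p * (b powr p + 4 powr (- p) * q)"
    using jensen by (intro mult_left_mono add_left_mono) auto
  finally have "ennreal (a powr p) \<le> ennreal (2 powr p * (b powr p + 4 powr (- p) * q))" by (rule ennreal_leI)
  also have "\<dots> = ennreal (2 powr p) * (ennreal (b powr p) + ennreal (4 powr (- p)) * average_power p F v)"
    using q0 unfolding Q by (simp add: ennreal_mult ennreal_plus)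
  finally show ?thesis .
qed

lemma locally_controlledD:
  assumes "locally_controlled \<rho> \<delta> F"
  shows "continuous_on UNIV F" "F \<in> borel_measurable borel"
    and "dist v v' < \<delta> \<Longrightarrow> ennreal (norm (F v)) \<le> ennreal (norm (F v')) + (\<integral>\<^sup>+w. ennreal (norm (F w) * (\<rho> (v - w) / 4)) \<partial>lborel)"
    and "dist v v' < \<delta> \<Longrightarrow> ennreal (norm (F v')) \<le> ennreal (norm (F v)) + (\<integral>\<^sup>+w. ennreal (norm (F w) * (\<rho> (v - w) / 4)) \<partial>lborel)"
  using assms unfolding locally_controlled_def Let_def by (auto intro: borel_measurable_continuous_onI)

text \<open>Each v is compared with one nearby sample, and that sample is majorised by the sum over
  all samples within \<delta>; integration turns each into the volume of a ball. The averaged term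
  carries 2^p 4^-p = 2^-p \<le> 1/2 and moves to the left, which is possible since the integral
  there is finite.\<close>

lemma sampling_lower:
  fixes \<gamma> :: "'i \<Rightarrow> 'b"
  assumes F: "locally_controlled \<rho> \<delta> F" and p: "p \<ge> 1" and I: "countable I"
    and cover: "\<And>v. \<exists>j\<in>I. dist v (\<gamma> j) < \<delta>"
    and fin: "(\<integral>\<^sup>+v. ennreal (norm (F v) powr p) \<partial>lborel) < \<infinity>"
  shows "(\<integral>\<^sup>+v. ennreal (norm (F v) powr p) \<partial>lborel)
    \<le> ennreal (2 * 2 powr p * measure lborel (ball (0::'b) \<delta>)) * (\<integral>\<^sup>+j. ennreal (norm (F (\<gamma> j)) powr p) \<partial>count_space I)"
proof -
  note [measurable] = locally_controlledD(2)[OF F]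
  let ?N = "\<lambda>v. ennreal (norm (F v) powr p)"
  let ?X = "\<integral>\<^sup>+v. ?N v \<partial>lborel" and ?S = "\<integral>\<^sup>+j. ?N (\<gamma> j) \<partial>count_space I"
  let ?V = "measure lborel (ball (0::'b) \<delta>)"
  let ?s = "\<lambda>v. \<integral>\<^sup>+j. ?N (\<gamma> j) * indicator (ball (\<gamma> j) \<delta>) v \<partial>count_space I"
  have [measurable]: "?s \<in> borel_measurable lborel"
    by (intro borel_measurable_nn_integral_count_space I measurable_times_indicator_ball) simp
  have pw: "?N v \<le> ennreal (2 powr p) * (?s v + ennreal (4 powr (- p)) * average_power p F v)" for v
  proof -
    obtain j where j: "j \<in> I" "dist v (\<gamma> j) < \<delta>" using cover by blast
    have "?N v \<le> ennreal (2 powr p) * (?N (\<gamma> j) + ennreal (4 powr (- p)) * average_power p F v)"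
      by (intro power_of_perturbation_le p locally_controlledD(3)[OF F j(2)]) auto
    also have "?N (\<gamma> j) \<le> ?s v"
      using nn_integral_ge_point[OF j(1), of "\<lambda>i. ?N (\<gamma> i) * indicator (ball (\<gamma> i) \<delta>) v"] j(2)
      by (simp add: dist_commute)
    finally show ?thesis by (simp add: add_right_mono mult_left_mono)
  qed
  have "?X \<le> (\<integral>\<^sup>+v. ennreal (2 powr p) * (?s v + ennreal (4 powr (- p)) * average_power p F v) \<partial>lborel)"
    by (intro nn_integral_mono pw)
  also have "\<dots> = ennreal (2 powr p) * ((\<integral>\<^sup>+v. ?s v \<partial>lborel) + ennreal (4 powr (- p)) * ?X)"
    by (simp add: nn_integral_cmult nn_integral_add nn_integral_average_power)
  also have "(\<integral>\<^sup>+v. ?s v \<partial>lborel) = ennreal ?V * ?S"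
  proof -
    have "(\<integral>\<^sup>+v. ?s v \<partial>lborel) = (\<integral>\<^sup>+j. \<integral>\<^sup>+v. ?N (\<gamma> j) * indicator (ball (\<gamma> j) \<delta>) v \<partial>lborel \<partial>count_space I)"
      by (intro nn_integral_count_space_nn_integral[OF I] measurable_times_indicator_ball) simp
    also have "\<dots> = (\<integral>\<^sup>+j. ennreal ?V * ?N (\<gamma> j) \<partial>count_space I)"
      by (intro nn_integral_cong, subst nn_integral_cmult_indicator)
         (simp_all add: emeasure_ball_translate mult.commute)
    also have "\<dots> = ennreal ?V * ?S" by (intro nn_integral_cmult) simp
    finally show ?thesis .
  qed
  finally have main: "?X \<le> ennreal (2 powr p) * (ennreal ?V * ?S + ennreal (4 powr (- p)) * ?X)" .
  \<comment> \<open>An infinite sample sum makes the right side infinite, because the ball has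
    positive volume.\<close>
  show ?thesis
  proof (cases "?S = \<infinity>")
    case True
    have "?V > 0"
    proof -
      obtain j where "dist (0::'b) (\<gamma> j) < \<delta>" using cover by blast
      then have "\<delta> > 0" using zero_le_dist[of "0::'b" "\<gamma> j"] by linarith
      then show ?thesis by (rule content_ball_pos)
    qed
    then have "ennreal (2 * 2 powr p * ?V) * ?S = \<infinity>"
      unfolding True by (simp add: ennreal_mult_top)
    then show ?thesis by simp
  next
    case False
    obtain x where x: "?X = ennreal x" "x \<ge> 0" using fin by (cases ?X) auto
    obtain s where s: "?S = ennreal s" "s \<ge> 0" using False by (cases ?S) auto
    have "ennreal x \<le> ennreal (2 powr p * (?V * s + 4 powr (- p) * x))"
      using main x(2) s(2) unfolding x(1) s(1) by (simp add: ennreal_mult ennreal_plus)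
    then have "x \<le> 2 powr p * (?V * s + 4 powr (- p) * x)"
      using x(2) s(2) by (subst (asm) ennreal_le_iff) auto
    also have "\<dots> = 2 powr p * ?V * s + (2 powr p * 4 powr (- p)) * x" by (simp add: algebra_simps)
    also have "2 powr p * 4 powr (- p) = (2::real) powr (- p)"
    proof -
      have "(4::real) powr (- p) = 2 powr (2 * (- p))" using powr_powr[of 2 2 "- p"] by simp
      then show ?thesis by (simp add: powr_add[symmetric])
    qed
    also have "2 powr (- p) * x \<le> (1/2) * x"
    proof (intro mult_right_mono x(2))
      have "2 powr (- p) \<le> 2 powr (-1::real)" using p by (intro powr_mono) auto
      then show "2 powr (- p) \<le> (1/2::real)" by (simp add: powr_minus_divide)
    qed
    finally have "x \<le> 2 * 2 powr p * ?V * s" by simp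
    then have "ennreal x \<le> ennreal (2 * 2 powr p * ?V * s)" by (rule ennreal_leI)
    then show ?thesis unfolding x(1) s(1) using s(2) by (simp add: ennreal_mult)
  qed
qed

text \<open>Roles are exchanged: each sample is compared with all v in its ball and integrated over
  that ball. The overlap count bounds the sum of the integrals. The radius \<delta>' is separate
  from \<delta> because it is limited by the separation of the samples.\<close>

lemma sampling_upper:
  fixes \<gamma> :: "'i \<Rightarrow> 'b"
  assumes F: "locally_controlled \<rho> \<delta> F" and p: "p \<ge> 1" and I: "countable I" and \<delta>': "\<delta>' \<le> \<delta>"
    and overlap: "\<And>v. emeasure (count_space I) {j \<in> I. dist (\<gamma> j) v < \<delta>'} \<le> ennreal N"
  shows "ennreal (measure lborel (ball (0::'b) \<delta>')) * (\<integral>\<^sup>+j. ennreal (norm (F (\<gamma> j)) powr p) \<partial>count_space I)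
    \<le> ennreal N * (ennreal (2 * 2 powr p) * (\<integral>\<^sup>+v. ennreal (norm (F v) powr p) \<partial>lborel))"
proof -
  note [measurable] = locally_controlledD(2)[OF F]
  let ?N = "\<lambda>v. ennreal (norm (F v) powr p)"
  let ?X = "\<integral>\<^sup>+v. ?N v \<partial>lborel" and ?S = "\<integral>\<^sup>+j. ?N (\<gamma> j) \<partial>count_space I"
  let ?V = "measure lborel (ball (0::'b) \<delta>')"
  let ?H = "\<lambda>v. ennreal (2 powr p) * (?N v + ennreal (4 powr (- p)) * average_power p F v)"
  have [measurable]: "?H \<in> borel_measurable borel" by measurable
  have pw: "?N (\<gamma> j) * indicator (ball (\<gamma> j) \<delta>') v \<le> ?H v * indicator (ball (\<gamma> j) \<delta>') v" for j v
  proof (cases "v \<in> ball (\<gamma> j) \<delta>'")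
    case True
    then have "dist v (\<gamma> j) < \<delta>" using \<delta>' by (simp add: dist_commute)
    then have "?N (\<gamma> j) \<le> ?H v"
      by (intro power_of_perturbation_le p locally_controlledD(4)[OF F]) auto
    then show ?thesis by (intro mult_right_mono) auto
  qed simp
  have "ennreal ?V * ?S = (\<integral>\<^sup>+j. ennreal ?V * ?N (\<gamma> j) \<partial>count_space I)"
    by (intro nn_integral_cmult[symmetric]) simp
  also have "\<dots> = (\<integral>\<^sup>+j. \<integral>\<^sup>+v. ?N (\<gamma> j) * indicator (ball (\<gamma> j) \<delta>') v \<partial>lborel \<partial>count_space I)"
    by (intro nn_integral_cong, subst nn_integral_cmult_indicator)
       (simp_all add: emeasure_ball_translate mult.commute)
  also have "\<dots> \<le> (\<integral>\<^sup>+j. \<integral>\<^sup>+v. ?H v * indicator (ball (\<gamma> j) \<delta>') v \<partial>lborel \<partial>count_space I)"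
    by (intro nn_integral_mono pw)
  also have "\<dots> = (\<integral>\<^sup>+v. \<integral>\<^sup>+j. ?H v * indicator (ball (\<gamma> j) \<delta>') v \<partial>count_space I \<partial>lborel)"
    by (intro nn_integral_count_space_nn_integral[OF I, symmetric] measurable_times_indicator_ball) simp
  also have "\<dots> \<le> (\<integral>\<^sup>+v. ennreal N * ?H v \<partial>lborel)"
  proof (intro nn_integral_mono)
    fix v
    have "(\<integral>\<^sup>+j. ?H v * indicator (ball (\<gamma> j) \<delta>') v \<partial>count_space I)
        = ?H v * (\<integral>\<^sup>+j. indicator (ball (\<gamma> j) \<delta>') v \<partial>count_space I)"
      by (intro nn_integral_cmult) simp
    also have "(\<integral>\<^sup>+j. indicator (ball (\<gamma> j) \<delta>') v \<partial>count_space I) = (\<integral>\<^sup>+j. indicator {j \<in> I. dist (\<gamma> j) v < \<delta>'} j \<partial>count_space I)"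
      by (intro nn_integral_cong) (auto split: split_indicator)
    also have "\<dots> = emeasure (count_space I) {j \<in> I. dist (\<gamma> j) v < \<delta>'}"
      by (intro nn_integral_indicator) auto
    also have "?H v * \<dots> \<le> ?H v * ennreal N" by (intro mult_left_mono overlap) auto
    finally show "(\<integral>\<^sup>+j. ?H v * indicator (ball (\<gamma> j) \<delta>') v \<partial>count_space I) \<le> ennreal N * ?H v"
      by (simp add: mult.commute)
  qed
  also have "\<dots> = ennreal N * (ennreal (2 powr p) * (?X + ennreal (4 powr (- p)) * ?X))"
    by (simp add: nn_integral_cmult nn_integral_add nn_integral_average_power)
  also have "\<dots> \<le> ennreal N * (ennreal (2 powr p) * (?X + 1 * ?X))"
  proof (intro mult_left_mono add_left_mono mult_right_mono)
    have "4 powr (- p) \<le> 4 powr (0::real)" using p by (intro powr_mono) auto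
    then show "ennreal (4 powr (- p)) \<le> 1" by (simp add: ennreal_le_1)
  qed auto
  also have "ennreal (2 powr p) * (?X + 1 * ?X) = ennreal (2 * 2 powr p) * ?X"
  proof -
    have "?X + 1 * ?X = 2 * ?X" by (metis mult_2 mult_1)
    then show ?thesis by (simp add: ennreal_mult mult_ac)
  qed
  finally show ?thesis .
qed

theorem sampling:
  fixes \<gamma> :: "'i \<Rightarrow> 'b"
  assumes p: "p \<ge> 1" and I: "countable I" and \<delta>': "0 < \<delta>'" "\<delta>' \<le> \<delta>" and N: "N > 0"
    and cover: "\<And>v. \<exists>j\<in>I. dist v (\<gamma> j) < \<delta>"
    and overlap: "\<And>v. emeasure (count_space I) {j \<in> I. dist (\<gamma> j) v < \<delta>'} \<le> ennreal N"
  obtains A B where "A > 0" "B > 0"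
    "\<And>F. locally_controlled \<rho> \<delta> F \<Longrightarrow> (\<integral>\<^sup>+v. ennreal (norm (F v) powr p) \<partial>lborel) < \<infinity> \<Longrightarrow>
      (\<integral>\<^sup>+v. ennreal (norm (F v) powr p) \<partial>lborel)
        \<le> ennreal A * (\<integral>\<^sup>+j. ennreal (norm (F (\<gamma> j)) powr p) \<partial>count_space I)"
    "\<And>F. locally_controlled \<rho> \<delta> F \<Longrightarrow>
      (\<integral>\<^sup>+j. ennreal (norm (F (\<gamma> j)) powr p) \<partial>count_space I)
        \<le> ennreal B * (\<integral>\<^sup>+v. ennreal (norm (F v) powr p) \<partial>lborel)"
proof
  let ?V = "measure lborel (ball (0::'b) \<delta>)" and ?V' = "measure lborel (ball (0::'b) \<delta>')"
  have V: "?V > 0" "?V' > 0" using \<delta>' by (auto intro: content_ball_pos)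
  show "2 * 2 powr p * ?V > 0" using V by simp
  show "1 / ?V' * (N * (2 * 2 powr p)) > 0" using V N by simp
  fix F :: "'b \<Rightarrow> complex" assume F: "locally_controlled \<rho> \<delta> F"
  let ?X = "\<integral>\<^sup>+v. ennreal (norm (F v) powr p) \<partial>lborel"
  let ?S = "\<integral>\<^sup>+j. ennreal (norm (F (\<gamma> j)) powr p) \<partial>count_space I"
  show "?X \<le> ennreal (2 * 2 powr p * ?V) * ?S" if "?X < \<infinity>"
    by (rule sampling_lower[OF F p I cover that])
  have "ennreal (1 / ?V') * (ennreal ?V' * ?S) \<le> ennreal (1 / ?V') * (ennreal N * (ennreal (2 * 2 powr p) * ?X))"
    by (intro mult_left_mono sampling_upper[OF F p I \<delta>'(2) overlap]) auto
  moreover have "ennreal (1 / ?V') * (ennreal ?V' * ?S) = ?S"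
    using V by (simp add: mult.assoc[symmetric] ennreal_mult[symmetric])
  moreover have "ennreal (1 / ?V') * (ennreal N * (ennreal (2 * 2 powr p) * ?X)) = ennreal (1 / ?V' * (N * (2 * 2 powr p))) * ?X"
  proof -
    have "ennreal (1 / ?V' * (N * (2 * 2 powr p))) = ennreal (1 / ?V') * (ennreal N * ennreal (2 * 2 powr p))"
      using V N by (subst ennreal_mult, simp, simp, subst ennreal_mult) simp_all
    then show ?thesis by (simp only: mult.assoc)
  qed
  ultimately show "?S \<le> ennreal (1 / ?V' * (N * (2 * 2 powr p))) * ?X" by simp
qed

text \<open>Continuity turns the essential supremum E into a pointwise bound, since an excess at one
  point persists on a ball. The error is then at most E/4, so E \<le> S + E/4 for the supremum S
  over the samples, which gives 4/3 and a fortiori 2.\<close>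

lemma sampling_sup:
  fixes \<gamma> :: "'i \<Rightarrow> 'b"
  assumes F: "locally_controlled \<rho> \<delta> F" and cover: "\<And>v. \<exists>j\<in>I. dist v (\<gamma> j) < \<delta>"
  shows "esssup lborel (\<lambda>v. ennreal (norm (F v))) < \<infinity> \<Longrightarrow>
      esssup lborel (\<lambda>v. ennreal (norm (F v))) \<le> 2 * esssup (count_space I) (\<lambda>j. ennreal (norm (F (\<gamma> j))))"
    and "esssup (count_space I) (\<lambda>j. ennreal (norm (F (\<gamma> j)))) \<le> esssup lborel (\<lambda>v. ennreal (norm (F v)))"
proof -
  note [measurable] = locally_controlledD(2)[OF F]
  let ?E = "esssup lborel (\<lambda>v. ennreal (norm (F v)))" and ?S = "esssup (count_space I) (\<lambda>j. ennreal (norm (F (\<gamma> j))))"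
  have point: "ennreal (norm (F v)) \<le> ?E" for v
  proof (rule ccontr)
    assume "\<not> ?thesis"
    then have v: "?E < ennreal (norm (F v))" by simp
    then obtain s where s: "?E = ennreal s" "s \<ge> 0" by (cases ?E) auto
    have sv: "s < norm (F v)" using v s by (simp add: ennreal_less_iff)
    have "open {w. s < norm (F w)}"
      using locally_controlledD(1)[OF F] by (intro open_Collect_less continuous_intros)
    then obtain r where r: "r > 0" "ball v r \<subseteq> {w. s < norm (F w)}"
      using sv unfolding open_contains_ball by blast
    have "AE w in lborel. ennreal (norm (F w)) \<le> ?E" by (rule esssup_AE)
    then have "AE w in lborel. w \<notin> ball v r"
    proof eventually_elim
      case (elim w)
      then have "norm (F w) \<le> s" using s by simp
      then show ?case using r(2) by auto
    qed
    then have "emeasure lborel (ball v r) = 0"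
      by (subst (asm) AE_iff_measurable[where N = "ball v r"]) auto
    then show False using content_ball_pos[OF r(1), of v] by (simp add: measure_def)
  qed
  show "?S \<le> ?E" using point by (intro esssup_I) (auto simp: AE_count_space)
  assume fin: "?E < \<infinity>"
  have S: "ennreal (norm (F (\<gamma> j))) \<le> ?S" if "j \<in> I" for j
    using esssup_AE[where M = "count_space I" and f = "\<lambda>j. ennreal (norm (F (\<gamma> j)))"] that by (simp add: AE_count_space)
  obtain s where s: "?E = ennreal s" "s \<ge> 0" using fin by (cases ?E) auto
  have J: "(\<integral>\<^sup>+w. ennreal (norm (F w) * (\<rho> (v - w) / 4)) \<partial>lborel) \<le> ennreal (s / 4)" for v
  proof -
    have "(\<integral>\<^sup>+w. ennreal (norm (F w) * (\<rho> (v - w) / 4)) \<partial>lborel) \<le> (\<integral>\<^sup>+w. ennreal (s / 4) * ennreal (\<rho> (v - w)) \<partial>lborel)"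
    proof (intro nn_integral_mono)
      fix w
      have "norm (F w) \<le> s" using point[of w] s by simp
      then have "norm (F w) * (\<rho> (v - w) / 4) \<le> s * (\<rho> (v - w) / 4)"
        using kernel_nonneg[of "v - w"] by (intro mult_right_mono) auto
      then show "ennreal (norm (F w) * (\<rho> (v - w) / 4)) \<le> ennreal (s / 4) * ennreal (\<rho> (v - w))"
        using s(2) kernel_nonneg[of "v - w"] by (simp add: ennreal_mult[symmetric] ennreal_leI)
    qed
    also have "\<dots> = ennreal (s / 4) * (\<integral>\<^sup>+w. ennreal (\<rho> (v - w)) \<partial>lborel)"
      by (intro nn_integral_cmult) measurable
    also have "(\<integral>\<^sup>+w. ennreal (\<rho> (v - w)) \<partial>lborel) = 1"
      using nn_integral_reflect[of "\<lambda>w. ennreal (\<rho> w)" v] kernel_nn_integral by simp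
    finally show ?thesis by simp
  qed
  have bound: "ennreal (norm (F v)) \<le> ?S + ennreal (s / 4)" for v
  proof -
    obtain j where j: "j \<in> I" "dist v (\<gamma> j) < \<delta>" using cover by blast
    show ?thesis
      by (rule order_trans[OF locally_controlledD(3)[OF F j(2)]]) (intro add_mono S j J)
  qed
  have "?E \<le> ?S + ennreal (s / 4)" using bound by (intro esssup_I) auto
  show "?E \<le> 2 * ?S"
  proof (cases "?S = \<infinity>")
    case True then show ?thesis by (simp add: ennreal_mult_top)
  next
    case False
    then obtain r where r: "?S = ennreal r" "r \<ge> 0" by (cases ?S) auto
    have "ennreal s \<le> ennreal (r + s / 4)" using \<open>?E \<le> ?S + ennreal (s / 4)\<close> r s by simp
    then have "s \<le> r + s / 4" using r s by (subst (asm) ennreal_le_iff) auto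
    then have "s \<le> 2 * r" using r by simp
    then have "ennreal s \<le> ennreal (2 * r)" by (rule ennreal_leI)
    then show ?thesis unfolding s(1) r(1) using r(2) by (simp add: ennreal_mult)
  qed
qed

end

section \<open>Sampling inequalities in terms of norms\<close>

lemma Lp_norm_finite_iff:
  assumes "p \<noteq> \<infinity>"
  shows "Lp_norm p M F < \<infinity> \<longleftrightarrow> (\<integral>\<^sup>+x. ennreal (norm (F x) powr enn2real p) \<partial>M) < \<infinity>"
proof -
  have "p \<noteq> top" using assms by simp
  then show ?thesis by (simp add: Lp_norm_def Let_def less_top[symmetric])
qed

lemma Lp_norm_le:
  assumes p: "p \<noteq> \<infinity>" and c: "c > 0"
    and le: "(\<integral>\<^sup>+x. ennreal (norm (F x) powr enn2real p) \<partial>M) \<le> ennreal c * (\<integral>\<^sup>+x. ennreal (norm (G x) powr enn2real p) \<partial>M')"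
  shows "Lp_norm p M F \<le> ennreal (c powr (1 / enn2real p)) * Lp_norm p M' G"
proof (cases "(\<integral>\<^sup>+x. ennreal (norm (G x) powr enn2real p) \<partial>M') = \<infinity>")
  case True
  then have "Lp_norm p M' G = \<infinity>" using p by (simp add: Lp_norm_def Let_def)
  then show ?thesis using c by (simp add: ennreal_mult_top)
next
  case False
  then obtain y where y: "(\<integral>\<^sup>+x. ennreal (norm (G x) powr enn2real p) \<partial>M') = ennreal y" "y \<ge> 0"
    by (cases "\<integral>\<^sup>+x. ennreal (norm (G x) powr enn2real p) \<partial>M'") auto
  have "(\<integral>\<^sup>+x. ennreal (norm (F x) powr enn2real p) \<partial>M) \<le> ennreal (c * y)"
    using le y c by (simp add: ennreal_mult)
  moreover from this obtain x where x: "(\<integral>\<^sup>+x. ennreal (norm (F x) powr enn2real p) \<partial>M) = ennreal x" "x \<ge> 0"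
    by (cases "\<integral>\<^sup>+x. ennreal (norm (F x) powr enn2real p) \<partial>M") (auto simp: top_unique)
  ultimately have "x \<le> c * y" using y c by (simp add: ennreal_le_iff)
  then have "x powr (1 / enn2real p) \<le> (c * y) powr (1 / enn2real p)"
    using x by (intro powr_mono2) auto
  also have "\<dots> = c powr (1 / enn2real p) * y powr (1 / enn2real p)" by (rule powr_mult)
  finally have "ennreal (x powr (1 / enn2real p)) \<le> ennreal (c powr (1 / enn2real p) * y powr (1 / enn2real p))"
    by (rule ennreal_leI)
  then show ?thesis using p x y by (simp add: Lp_norm_def Let_def ennreal_mult)
qed

theorem (in unit_kernel) Lp_sampling:
  fixes \<gamma> :: "'i \<Rightarrow> 'b"
  assumes p: "p \<ge> 1" and I: "countable I" and \<delta>': "0 < \<delta>'" "\<delta>' \<le> \<delta>" and N: "N > 0"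
    and cover: "\<And>v. \<exists>j\<in>I. dist v (\<gamma> j) < \<delta>"
    and overlap: "\<And>v. emeasure (count_space I) {j \<in> I. dist (\<gamma> j) v < \<delta>'} \<le> ennreal N"
  obtains A B where "A > 0" "B > 0"
    "\<And>F. locally_controlled \<rho> \<delta> F \<Longrightarrow> Lp_norm p lborel F < \<infinity> \<Longrightarrow>
      ennreal A * Lp_norm p lborel F \<le> Lp_norm p (count_space I) (\<lambda>j. F (\<gamma> j)) \<and>
      Lp_norm p (count_space I) (\<lambda>j. F (\<gamma> j)) \<le> ennreal B * Lp_norm p lborel F"
proof (cases "p = \<infinity>")
  case True
  have "ennreal (1/2) * Lp_norm p lborel F \<le> Lp_norm p (count_space I) (\<lambda>j. F (\<gamma> j)) \<and>
      Lp_norm p (count_space I) (\<lambda>j. F (\<gamma> j)) \<le> ennreal 1 * Lp_norm p lborel F"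
    if F: "locally_controlled \<rho> \<delta> F" and fin: "Lp_norm p lborel F < \<infinity>" for F
  proof
    let ?E = "Lp_norm p lborel F" and ?S = "Lp_norm p (count_space I) (\<lambda>j. F (\<gamma> j))"
    have "?E \<le> 2 * ?S" using sampling_sup(1)[OF F cover] fin True by (simp add: Lp_norm_def)
    then have "ennreal (1/2) * ?E \<le> ennreal (1/2) * (2 * ?S)" by (intro mult_left_mono) auto
    also have "\<dots> = (ennreal (1/2) * ennreal 2) * ?S" by (simp add: mult.assoc)
    also have "ennreal (1/2) * ennreal 2 = 1" by (subst ennreal_mult[symmetric]) auto
    finally show "ennreal (1/2) * ?E \<le> ?S" by simp
    show "?S \<le> ennreal 1 * ?E" using sampling_sup(2)[OF F cover] True by (simp add: Lp_norm_def)
  qed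
  then show ?thesis by (intro that[of "1/2" 1]) auto
next
  case False
  let ?p = "enn2real p"
  have p1: "?p \<ge> 1" using p False enn2real_mono[of 1 p] by (simp add: less_top)
  obtain A B where A: "A > 0" and B: "B > 0"
    and AF: "\<And>F. locally_controlled \<rho> \<delta> F \<Longrightarrow> (\<integral>\<^sup>+v. ennreal (norm (F v) powr ?p) \<partial>lborel) < \<infinity> \<Longrightarrow>
      (\<integral>\<^sup>+v. ennreal (norm (F v) powr ?p) \<partial>lborel)
        \<le> ennreal A * (\<integral>\<^sup>+j. ennreal (norm (F (\<gamma> j)) powr ?p) \<partial>count_space I)"
    and BF: "\<And>F. locally_controlled \<rho> \<delta> F \<Longrightarrow>
      (\<integral>\<^sup>+j. ennreal (norm (F (\<gamma> j)) powr ?p) \<partial>count_space I)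
        \<le> ennreal B * (\<integral>\<^sup>+v. ennreal (norm (F v) powr ?p) \<partial>lborel)"
    by (rule sampling[OF p1 I \<delta>' N cover overlap]) (rule that)
  \<comment> \<open>The integral inequalities pass to norms by p-th roots; the lower bound is then
    inverted to stand on the side of the function.\<close>
  let ?a = "A powr (1 / ?p)" and ?b = "B powr (1 / ?p)"
  have "ennreal (1 / ?a) * Lp_norm p lborel F \<le> Lp_norm p (count_space I) (\<lambda>j. F (\<gamma> j)) \<and>
      Lp_norm p (count_space I) (\<lambda>j. F (\<gamma> j)) \<le> ennreal ?b * Lp_norm p lborel F"
    if F: "locally_controlled \<rho> \<delta> F" and fin: "Lp_norm p lborel F < \<infinity>" for F
  proof
    let ?E = "Lp_norm p lborel F" and ?S = "Lp_norm p (count_space I) (\<lambda>j. F (\<gamma> j))"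
    have "?E \<le> ennreal ?a * ?S"
      using AF[OF F] fin unfolding Lp_norm_finite_iff[OF False] by (intro Lp_norm_le False A)
    then have "ennreal (1 / ?a) * ?E \<le> ennreal (1 / ?a) * (ennreal ?a * ?S)" by (intro mult_left_mono) auto
    also have "\<dots> = ?S" using A by (simp add: mult.assoc[symmetric] ennreal_mult[symmetric])
    finally show "ennreal (1 / ?a) * ?E \<le> ?S" .
    show "?S \<le> ennreal ?b * ?E" by (intro Lp_norm_le False B BF F)
  qed
  then show ?thesis using A B by (intro that[of "1 / ?a" ?b]) auto
qed


section \<open>The hull and the frames\<close>

lemma translate_by_translate_by: "translate_by z (translate_by w A) = translate_by (z + w) A"
  unfolding translate_by_def image_image by (intro image_cong) (simp_all add: algebra_simps)

text \<open>A distance below 1/M with M at least 1 cannot come from the cap 1, so the agreement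
  radius exceeds M, and the supremum defining it has a witness above M.\<close>

lemma agreement_of_small_dist:
  assumes M: "M \<ge> 1" and d: "delone_dist S T < ennreal (1 / M)"
  obtains r z where "r > M" "ball 0 r \<inter> translate_by z S = T \<inter> ball 0 r"
proof -
  have "\<not> ennreal (1 / M) \<le> 1 / agreement_radius S T"
  proof
    assume *: "ennreal (1 / M) \<le> 1 / agreement_radius S T"
    have "ennreal (1 / M) \<le> 1" using M by (simp add: ennreal_le_1)
    with * have "ennreal (1 / M) \<le> delone_dist S T" unfolding delone_dist_def by simp
    with d show False by simp
  qed
  moreover have "ennreal (1 / M) \<le> 1 / agreement_radius S T" if le: "agreement_radius S T \<le> ennreal M"
  proof -
    obtain a where a: "agreement_radius S T = ennreal a" "a \<ge> 0"
      using le by (cases "agreement_radius S T") (auto simp: top_unique)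
    show ?thesis
    proof (cases "a = 0")
      \<comment> \<open>Agreement radius 0 has reciprocal \<infinity> in \<open>ennreal\<close>, so
        the distance bound holds here as well.\<close>
      case True
      then show ?thesis using a by (simp add: divide_ennreal_def)
    next
      case False
      have "a \<le> M" using le a M by (simp add: ennreal_le_iff)
      then have "1 / M \<le> 1 / a" using a False M by (intro divide_left_mono) auto
      then show ?thesis
        using a False divide_ennreal[of 1 a] by (simp add: ennreal_leI)
    qed
  qed
  ultimately have "ennreal M < agreement_radius S T" by force
  then obtain r where r: "r > 0" "\<exists>z. norm z < 1 / r \<and> ball 0 r \<inter> translate_by z S = T \<inter> ball 0 r" "ennreal M < ennreal r"
    unfolding agreement_radius_def less_SUP_iff by blast
  have "r > M" using r(1,3) M by (simp add: ennreal_less_iff)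
  with r(2) show ?thesis using that by blast
qed

text \<open>Inside any ball, a member of the hull coincides with a translate of \<open>\<Lambda>\<close>.  The common covering
  radius is the only property of the hull that the windows depend on.\<close>

lemma hull_common_covering_radius:
  assumes "delone \<Lambda>"
  shows "\<exists>R>0. \<forall>T\<in>delone_hull \<Lambda>. \<forall>z. \<exists>x\<in>T. dist z x < R"
proof -
  have fin: "hole \<Lambda> < \<infinity>" using assms by (simp add: delone_def relatively_dense_def)
  \<comment> \<open>Enlarging the hole by 1 makes the inequality strict, so the infimum of distances
    is undercut by an actual point.\<close>
  define R where "R = enn2real (hole \<Lambda>) + 1"
  have R: "R \<ge> 1" "hole \<Lambda> < ennreal R"
    using fin unfolding R_def by (cases "hole \<Lambda>"; simp add: ennreal_less_iff)+
  have near: "\<exists>x\<in>\<Lambda>. norm (z - x) < R" for z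
  proof -
    have "(INF x\<in>\<Lambda>. ennreal (norm (z - x))) \<le> hole \<Lambda>"
      unfolding hole_def by (rule SUP_upper) simp
    also note R(2)
    finally show ?thesis unfolding INF_less_iff by (simp add: ennreal_less_iff)
  qed
  have "\<exists>x\<in>T. dist z x < R" if T: "T \<in> delone_hull \<Lambda>" for T z
  proof -
    \<comment> \<open>Agreement on this radius covers the whole R-ball around z, so a point of the
      translate found there belongs to \<open>T\<close>.\<close>
    define M where "M = norm z + R"
    have M: "M \<ge> 1" unfolding M_def using R(1) by (simp add: add_increasing)
    then have "ennreal (1 / M) > 0" by simp
    then obtain w where w: "delone_dist (translate_by w \<Lambda>) T < ennreal (1 / M)"
      using T unfolding delone_hull_def by blast
    obtain r z' where r: "r > M" "ball 0 r \<inter> translate_by z' (translate_by w \<Lambda>) = T \<inter> ball 0 r"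
      by (rule agreement_of_small_dist[OF M w]) (rule that)
    obtain x where x: "x \<in> \<Lambda>" "norm (z + (z' + w) - x) < R" using near by blast
    define y where "y = x - (z' + w)"
    have yT: "y \<in> translate_by z' (translate_by w \<Lambda>)"
      unfolding translate_by_translate_by unfolding translate_by_def
      by (rule image_eqI[where x = x]) (simp_all add: y_def x(1))
    have d: "dist z y < R" using x(2) by (simp add: dist_norm y_def algebra_simps)
    have "norm y < r" using d r(1) norm_triangle_ineq2[of y z] unfolding M_def by (simp add: dist_norm norm_minus_commute)
    then have "y \<in> ball 0 r \<inter> translate_by z' (translate_by w \<Lambda>)" using yT by simp
    then have "y \<in> T" unfolding r(2) by simp
    with d show ?thesis by blast
  qed
  then show ?thesis using R(1) by (intro exI[of _ R]) auto
qed

section \<open>Uniformly discrete sets and sums over them\<close>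

lemma uniformly_discreteD:
  assumes "uniformly_discrete T"
  obtains r where "r > 0" "\<And>x y. x \<in> T \<Longrightarrow> y \<in> T \<Longrightarrow> dist x y < r \<Longrightarrow> x = y"
proof -
  obtain r where r: "r > 0" "{x - y | x y. x \<in> T \<and> y \<in> T} \<inter> ball 0 r = {0}"
    using assms by (auto simp: uniformly_discrete_def)
  have "x = y" if xy: "x \<in> T" "y \<in> T" "dist x y < r" for x y
  proof -
    have "x - y \<in> {x - y | x y. x \<in> T \<and> y \<in> T} \<inter> ball 0 r" using xy by (auto simp: dist_norm norm_minus_commute)
    then show ?thesis unfolding r(2) by simp
  qed
  with r(1) show ?thesis using that by blast
qed

lemma uniformly_discrete_countable:
  fixes T :: "'a::euclidean_space set"
  assumes "uniformly_discrete T"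
  shows "countable T"
proof -
  obtain r where r: "r > 0" "\<And>x y. x \<in> T \<Longrightarrow> y \<in> T \<Longrightarrow> dist x y < r \<Longrightarrow> x = y"
    using uniformly_discreteD[OF assms] by metis
  have disj: "x = y" if "x \<in> T" "y \<in> T" "v \<in> ball x (r / 2)" "v \<in> ball y (r / 2)" for x y v
  proof (rule r(2)[OF that(1,2)])
    show "dist x y < r" using dist_triangle[of x y v] that(3,4) by (simp add: dist_commute)
  qed
  have inj: "inj_on (\<lambda>x. ball x (r / 2)) T"
    using disj r(1) by (intro inj_onI) (metis centre_in_ball half_gt_zero)
  \<comment> \<open>Balls of half the separation are disjoint open sets in a separable
    space.\<close>
  have "countable ((\<lambda>x. ball x (r / 2)) ` T)"
  proof (rule countable_disjoint_open_subsets)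
    show "disjoint ((\<lambda>x. ball x (r / 2)) ` T)"
      using disj by (fastforce simp: disjoint_def)
  qed auto
  then show ?thesis using inj by (rule countable_image_inj_on)
qed

text \<open>For nonnegative terms the unconditional sum is the supremum over finite subsets. One
  inequality compares these with indicators, the other runs through an enumeration of the countable
  set.\<close>

lemma infsum_ennreal_eq_nn_integral:
  fixes f :: "'i \<Rightarrow> ennreal"
  assumes T: "countable T"
  shows "infsum f T = (\<integral>\<^sup>+x. f x \<partial>count_space T)"
proof (cases "finite T")
  case True
  then show ?thesis by (simp add: nn_integral_count_space_finite)
next
  case False
  let ?h = "from_nat_into T"
  have bij: "bij_betw ?h UNIV T" by (rule bij_betw_from_nat_into[OF T False])
  have sup: "infsum f T = (SUP F\<in>{F. finite F \<and> F \<subseteq> T}. sum f F)"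
    by (rule nonneg_infsum_complete) simp
  show ?thesis
  proof (rule antisym)
    have "sum f F \<le> (\<integral>\<^sup>+x. f x \<partial>count_space T)" if F: "finite F" "F \<subseteq> T" for F
    proof -
      have "sum f F = (\<Sum>x\<in>F. f x * indicator F x)" by (intro sum.cong) auto
      also have "\<dots> = (\<integral>\<^sup>+x. f x * indicator F x \<partial>count_space T)"
        using F by (intro nn_integral_count_space'[symmetric]) auto
      also have "\<dots> \<le> (\<integral>\<^sup>+x. f x \<partial>count_space T)"
        by (intro nn_integral_mono) (auto split: split_indicator)
      finally show ?thesis .
    qed
    then show "infsum f T \<le> (\<integral>\<^sup>+x. f x \<partial>count_space T)" unfolding sup by (intro SUP_least) auto
    have "(\<integral>\<^sup>+x. f x \<partial>count_space T) = (\<integral>\<^sup>+n. f (?h n) \<partial>count_space UNIV)"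
      by (rule nn_integral_bij_count_space[OF bij, symmetric])
    also have "\<dots> = (\<Sum>n. f (?h n))" by (rule nn_integral_count_space_nat)
    also have "\<dots> = (SUP n. \<Sum>i<n. f (?h i))" by (rule suminf_eq_SUP)
    also have "\<dots> \<le> infsum f T"
      unfolding sup
    proof (rule SUP_least)
      fix n
      have inj: "inj_on ?h {..<n}" using bij by (auto simp: bij_betw_def intro: inj_on_subset)
      have "(\<Sum>i<n. f (?h i)) = sum f (?h ` {..<n})" by (rule sum.reindex[OF inj, symmetric, unfolded comp_def])
      also have "\<dots> \<le> (SUP F\<in>{F. finite F \<and> F \<subseteq> T}. sum f F)"
        using bij by (intro SUP_upper) (auto simp: bij_betw_def)
      finally show "(\<Sum>i<n. f (?h i)) \<le> (SUP F\<in>{F. finite F \<and> F \<subseteq> T}. sum f F)" .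
    qed
    finally show "(\<integral>\<^sup>+x. f x \<partial>count_space T) \<le> infsum f T" .
  qed
qed

lemma nn_integral_count_space_Times:
  fixes f :: "nat \<times> 'b \<Rightarrow> ennreal"
  assumes T: "countable T"
  shows "(\<integral>\<^sup>+j. f j \<partial>count_space ({1..N} \<times> T)) = (\<Sum>i=1..N. (\<Sum>\<^sub>\<infinity>z\<in>T. f (i, z)))"
proof -
  interpret T: sigma_finite_measure "count_space T" by (rule sigma_finite_measure_count_space_countable[OF T])
  have eq: "count_space {1..N} \<Otimes>\<^sub>M count_space T = count_space ({1..N} \<times> T)"
    by (rule pair_measure_countable) (auto intro: T countable_finite)
  have "(\<integral>\<^sup>+j. f j \<partial>count_space ({1..N} \<times> T)) = (\<integral>\<^sup>+i. \<integral>\<^sup>+z. f (i, z) \<partial>count_space T \<partial>count_space {1..N})"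
    unfolding eq[symmetric] by (rule T.nn_integral_fst[symmetric]) (unfold eq, simp)
  also have "\<dots> = (\<Sum>i=1..N. (\<Sum>\<^sub>\<infinity>z\<in>T. f (i, z)))"
    by (simp add: nn_integral_count_space_finite infsum_ennreal_eq_nn_integral[OF T])
  finally show ?thesis .
qed

lemma Lp_norm_cong_norm:
  assumes "\<And>x. norm (F x) = norm (G x)"
  shows "Lp_norm p M F = Lp_norm p M G"
  unfolding Lp_norm_def assms ..

lemma Lp_norm_2_square:
  assumes "(\<integral>\<^sup>+x. ennreal ((norm (F x))\<^sup>2) \<partial>M) < \<infinity>"
  shows "(Lp_norm 2 M F)\<^sup>2 = (\<integral>\<^sup>+x. ennreal ((norm (F x))\<^sup>2) \<partial>M)"
proof -
  have e: "(\<integral>\<^sup>+x. ennreal (norm (F x) powr 2) \<partial>M) = (\<integral>\<^sup>+x. ennreal ((norm (F x))\<^sup>2) \<partial>M)"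
    by (intro nn_integral_cong) (simp add: powr_numeral)
  obtain y where y: "(\<integral>\<^sup>+x. ennreal ((norm (F x))\<^sup>2) \<partial>M) = ennreal y" "y \<ge> 0"
    using assms by (cases "\<integral>\<^sup>+x. ennreal ((norm (F x))\<^sup>2) \<partial>M") auto
  have "(y powr (1 / 2))\<^sup>2 = y" using y(2) by (simp add: powr_half_sqrt)
  then show ?thesis
    using y by (simp add: Lp_norm_def Let_def e ennreal_power)
qed

lemma Lp_space_2_iff:
  "F \<in> Lp_space 2 lborel \<longleftrightarrow> F \<in> borel_measurable borel \<and> (\<integral>\<^sup>+x. ennreal ((norm (F x))\<^sup>2) \<partial>lborel) < \<infinity>"
proof -
  have e: "(\<integral>\<^sup>+x. ennreal (norm (F x) powr 2) \<partial>lborel) = (\<integral>\<^sup>+x. ennreal ((norm (F x))\<^sup>2) \<partial>lborel)"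
    by (intro nn_integral_cong) (simp add: powr_numeral)
  have "Lp_norm 2 lborel F < \<infinity> \<longleftrightarrow> (\<integral>\<^sup>+x. ennreal (norm (F x) powr 2) \<partial>lborel) < \<infinity>"
    using Lp_norm_finite_iff[of 2 lborel F] by simp
  then show ?thesis unfolding Lp_space_def e by auto
qed

lemma schwartz_Lp_space_2:
  assumes "schwartz f" shows "f \<in> Lp_space 2 lborel"
  using schwartz_measurable[OF assms] schwartz_square_integrable[OF assms]
  unfolding Lp_space_2_iff integrable_iff_bounded by simp

section \<open>From sampled transforms to frames\<close>

context schwartz_window
begin

lemma M1_function_tf_shift: "M1_function \<phi> (tf_shift w \<phi>)"
proof -
  have s: "schwartz (tf_shift w \<phi>)" by (intro schwartz_tf_shift schwartz_window)
  have t: "tempered_distribution (fun_distribution (tf_shift w \<phi>))"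
    by (intro tempered_fun_distribution schwartz_measurable schwartz_square_integrable s)
  have m: "stft \<phi> (fun_distribution (tf_shift w \<phi>)) \<in> borel_measurable borel"
    by (intro borel_measurable_continuous_onI stft_continuous schwartz_window t)
  obtain C where "\<And>z. norm (L2_inner (tf_shift w \<phi>) (tf_shift z \<phi>)) \<le> C * decay (DIM('a \<times> 'a) + 2) z"
    using stft_schwartz_decay[OF s schwartz_window] by blast
  then have "integrable lborel (stft \<phi> (fun_distribution (tf_shift w \<phi>)))"
    by (intro integrable_decay_bound[OF m order_refl]) (simp add: stft_fun_distribution)
  then have "Lp_norm 1 lborel (stft \<phi> (fun_distribution (tf_shift w \<phi>))) < \<infinity>"
    using Lp_norm_finite_iff[of 1 lborel "stft \<phi> (fun_distribution (tf_shift w \<phi>))"]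
    unfolding integrable_iff_bounded by simp
  then show ?thesis
    unfolding M1_function_def modulation_space_def Lp_space_def[of 1] using schwartz_Lp_space_2[OF s] t m by simp
qed

text \<open>The weight that governs the oscillation estimate, normalised to total mass 1.\<close>

definition kernel :: "'a \<times> 'a \<Rightarrow> real" where
  "kernel z = decay (DIM('a \<times> 'a) + 2) z / (LINT z|lborel. decay (DIM('a \<times> 'a) + 2) (z :: 'a \<times> 'a))"

lemma decay_integral_pos: "(LINT z|lborel. decay (DIM('a \<times> 'a) + 2) (z :: 'a \<times> 'a)) > 0"
proof -
  let ?d = "decay (DIM('a \<times> 'a) + 2) :: 'a \<times> 'a \<Rightarrow> real"
  have i: "integrable lborel ?d" by (rule integrable_decay) simp
  have "(LINT z|lborel. ?d z) \<noteq> 0"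
  proof
    assume "(LINT z|lborel. ?d z) = 0"
    then have "AE z in lborel. ?d z = 0"
      using integral_nonneg_eq_0_iff_AE[OF i] by simp
    moreover have "?d z \<noteq> 0" for z using decay_pos[of "DIM('a \<times> 'a) + 2" z] by linarith
    ultimately have "AE z in (lborel :: ('a \<times> 'a) measure). False" by simp
    then show False by (simp add: trivial_limit_def[symmetric] ae_filter_eq_bot_iff)
  qed
  moreover have "(LINT z|lborel. ?d z) \<ge> 0" by (intro integral_nonneg_AE) auto
  ultimately show ?thesis by linarith
qed

sublocale unit_kernel kernel
proof
  let ?d = "decay (DIM('a \<times> 'a) + 2) :: 'a \<times> 'a \<Rightarrow> real"
  let ?I = "LINT z|lborel. ?d z"
  show "kernel \<in> borel_measurable borel" unfolding kernel_def[abs_def] by measurable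
  show nn: "kernel x \<ge> 0" for x unfolding kernel_def using decay_integral_pos by simp
  have i: "integrable lborel ?d" by (rule integrable_decay) simp
  have "integrable lborel kernel" unfolding kernel_def[abs_def] using i by simp
  then have "(\<integral>\<^sup>+x. ennreal (kernel x) \<partial>lborel) = ennreal (LINT x|lborel. kernel x)"
    using nn by (intro nn_integral_eq_integral) auto
  also have "(LINT x|lborel. kernel x) = 1"
    unfolding kernel_def using decay_integral_pos by simp
  finally show "(\<integral>\<^sup>+x. ennreal (kernel x) \<partial>lborel) = 1" by simp
qed

text \<open>The compensating phase is unimodular, so both triangle inequalities turn the oscillation
  estimate into one for absolute values. The order of quantifiers matters: one \<delta> for all
  distributions.\<close>

lemma stft_locally_controlled:
  "\<exists>\<delta>>0. \<forall>u. tempered_distribution u \<longrightarrow> locally_controlled kernel \<delta> (stft \<phi> u)"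
proof -
  let ?K = "DIM('a \<times> 'a) + 2"
  let ?I = "LINT z|lborel. decay ?K (z :: 'a \<times> 'a)"
  \<comment> \<open>Chosen so that e times the decay weight is \<open>kernel / 4\<close>.\<close>
  define e where "e = 1 / (4 * ?I)"
  have e: "e > 0" unfolding e_def using decay_integral_pos by simp
  have ek: "e * decay ?K z = kernel z / 4" for z unfolding e_def kernel_def by simp
  obtain \<delta> where \<delta>: "\<delta> > 0" "\<forall>u v q. tempered_distribution u \<longrightarrow> norm q < \<delta> \<longrightarrow>
     ennreal (norm (cis (2 * pi * (snd q \<bullet> fst v)) * stft \<phi> u (v + q) - stft \<phi> u v))
       \<le> (\<integral>\<^sup>+w. ennreal (norm (stft \<phi> u w) * (e * decay ?K (v - w))) \<partial>lborel)"
    using stft_oscillation[OF e] by (elim exE conjE)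
  have "locally_controlled kernel \<delta> (stft \<phi> u)" if u: "tempered_distribution u" for u
    unfolding locally_controlled_def Let_def
  proof (intro conjI allI impI)
    let ?F = "stft \<phi> u"
    show "continuous_on UNIV ?F" by (intro stft_continuous schwartz_window u)
    fix v v' :: "'a \<times> 'a" assume d: "dist v v' < \<delta>"
    let ?J = "\<integral>\<^sup>+w. ennreal (norm (?F w) * (kernel (v - w) / 4)) \<partial>lborel"
    let ?c = "cis (2 * pi * (snd (v' - v) \<bullet> fst v))"
    have J: "ennreal (norm (?c * ?F v' - ?F v)) \<le> ?J"
      using \<delta>(2)[unfolded ek, rule_format, OF u, of "v' - v" v] d by (simp add: dist_norm norm_minus_commute)
    have "norm (?F v) \<le> norm (?F v') + norm (?c * ?F v' - ?F v)"
      using norm_triangle_ineq4[of "?c * ?F v'" "?c * ?F v' - ?F v"] by (simp add: norm_mult)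
    then have "ennreal (norm (?F v)) \<le> ennreal (norm (?F v')) + ennreal (norm (?c * ?F v' - ?F v))"
      by (simp add: ennreal_plus[symmetric] ennreal_leI del: ennreal_plus)
    with J show "ennreal (norm (?F v)) \<le> ennreal (norm (?F v')) + ?J"
      by (meson add_left_mono order_trans)
    have "norm (?F v') \<le> norm (?F v) + norm (?c * ?F v' - ?F v)"
      using norm_triangle_ineq[of "?F v" "?c * ?F v' - ?F v"] by (simp add: norm_mult)
    then have "ennreal (norm (?F v')) \<le> ennreal (norm (?F v)) + ennreal (norm (?c * ?F v' - ?F v))"
      by (simp add: ennreal_plus[symmetric] ennreal_leI del: ennreal_plus)
    with J show "ennreal (norm (?F v')) \<le> ennreal (norm (?F v)) + ?J"
      by (meson add_left_mono order_trans)
  qed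
  with \<delta>(1) show ?thesis by blast
qed

text \<open>Coefficients are indexed by pairs (i, z), with sample point z + \<open>w i\<close>. For
  fixed i the points inherit the separation of \<open>T\<close>, so a ball of at most half that
  radius contains at most one of them, and the overlap is at most N even if different i give the
  same point.\<close>

lemma frame_of_dense_shifts:
  assumes \<delta>: "\<delta> > 0" and ctrl: "\<And>u. tempered_distribution u \<Longrightarrow> locally_controlled kernel \<delta> (stft \<phi> u)"
    and T: "uniformly_discrete T" and N: "N > 0"
    and cover: "\<And>v. \<exists>i\<in>{1..N}. \<exists>z\<in>T. dist v (z + w i) < \<delta>"
  shows "multiwindow_gabor_frame N (\<lambda>i. tf_shift (w i) \<phi>) T"
    and "1 \<le> p \<Longrightarrow> Mp_frame \<phi> p N (\<lambda>i. tf_shift (w i) \<phi>) T"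
proof -
  obtain r where r: "r > 0" "\<And>x y. x \<in> T \<Longrightarrow> y \<in> T \<Longrightarrow> dist x y < r \<Longrightarrow> x = y"
    using uniformly_discreteD[OF T] by metis
  \<comment> \<open>At most \<delta> for the local control, at most r/2 for the separation within
    one index i.\<close>
  define \<delta>' where "\<delta>' = min \<delta> (r / 2)"
  have \<delta>': "0 < \<delta>'" "\<delta>' \<le> \<delta>" "\<delta>' \<le> r / 2" unfolding \<delta>'_def using \<delta> r(1) by auto
  have cT: "countable T" by (rule uniformly_discrete_countable[OF T])
  define I where "I = {1..N} \<times> T"
  define \<gamma> where "\<gamma> = (\<lambda>(i, z). z + w i)"
  have cI: "countable I" unfolding I_def using cT by (intro countable_SIGMA) (auto intro: countable_finite)
  have cov: "\<exists>j\<in>I. dist v (\<gamma> j) < \<delta>" for v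
    using cover[of v] unfolding I_def \<gamma>_def by fastforce
  have overlap: "emeasure (count_space I) {j \<in> I. dist (\<gamma> j) v < \<delta>'} \<le> ennreal (real N)" for v
  proof -
    let ?J = "{j \<in> I. dist (\<gamma> j) v < \<delta>'}"
    have inj: "inj_on fst ?J"
    proof (rule inj_onI)
      fix j j' assume j: "j \<in> ?J" "j' \<in> ?J" and eq: "fst j = fst j'"
      have "dist (snd j) (snd j') = dist (\<gamma> j) (\<gamma> j')"
        using eq unfolding \<gamma>_def by (simp add: case_prod_unfold)
      also have "\<dots> < r"
        using dist_triangle_half_l[of "\<gamma> j" v r "\<gamma> j'"] j \<delta>'(3) by (auto simp: dist_commute)
      finally have "snd j = snd j'" using j by (intro r(2)) (auto simp: I_def)
      with eq show "j = j'" by (rule prod_eqI)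
    qed
    have sub: "fst ` ?J \<subseteq> {1..N}" unfolding I_def by auto
    have fin: "finite ?J" by (rule inj_on_finite[OF inj sub]) simp
    have "card ?J \<le> card {1..N}" by (rule card_inj_on_le[OF inj sub]) simp
    then have "emeasure (count_space I) ?J \<le> of_nat N" using fin by (simp add: emeasure_count_space)
    then show ?thesis by (simp add: ennreal_of_nat_eq_real_of_nat)
  qed
  have rN: "real N > 0" using N by simp
  show "Mp_frame \<phi> p N (\<lambda>i. tf_shift (w i) \<phi>) T" if p: "1 \<le> p"
  proof -
    obtain A B where AB: "A > 0" "B > 0"
      "\<And>F. locally_controlled kernel \<delta> F \<Longrightarrow> Lp_norm p lborel F < \<infinity> \<Longrightarrow>
        ennreal A * Lp_norm p lborel F \<le> Lp_norm p (count_space I) (\<lambda>j. F (\<gamma> j)) \<and>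
        Lp_norm p (count_space I) (\<lambda>j. F (\<gamma> j)) \<le> ennreal B * Lp_norm p lborel F"
      by (rule Lp_sampling[OF p cI \<delta>'(1,2) rN cov overlap]) (rule that)
    have coeff: "Lp_norm p (count_space I) (analysis_coeffs \<phi> (\<lambda>i. tf_shift (w i) \<phi>) u)
        = Lp_norm p (count_space I) (\<lambda>j. stft \<phi> u (\<gamma> j))" if "tempered_distribution u" for u
      using norm_pairing_shifted_window[OF that]
      by (intro Lp_norm_cong_norm) (simp add: analysis_coeffs_def \<gamma>_def case_prod_unfold)
    show ?thesis
      unfolding Mp_frame_def
    proof (rule conjI, rule ballI, rule M1_function_tf_shift, rule exI[of _ A], rule conjI, rule AB(1),
        rule exI[of _ B], rule conjI, rule AB(2), intro ballI conjI)
      fix u assume "u \<in> modulation_space \<phi> p"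
      then have u: "tempered_distribution u" and F: "Lp_norm p lborel (stft \<phi> u) < \<infinity>"
        by (auto simp: modulation_space_def Lp_space_def)
      show "ennreal A * modulation_norm \<phi> p u \<le> Lp_norm p (count_space ({1..N} \<times> T)) (analysis_coeffs \<phi> (\<lambda>i. tf_shift (w i) \<phi>) u)"
        and "Lp_norm p (count_space ({1..N} \<times> T)) (analysis_coeffs \<phi> (\<lambda>i. tf_shift (w i) \<phi>) u) \<le> ennreal B * modulation_norm \<phi> p u"
        using AB(3)[OF ctrl[OF u] F] unfolding I_def[symmetric] coeff[OF u] modulation_norm_def by auto
    qed
  qed
  show "multiwindow_gabor_frame N (\<lambda>i. tf_shift (w i) \<phi>) T"
  proof -
    \<comment> \<open>The integral form of sampling is used at exponent 2, since the frame
      inequality already involves squared sums.\<close>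
    have p2: "(2::real) \<ge> 1" by simp
    obtain A B where A: "A > 0" and B: "B > 0"
      and AF: "\<And>F. locally_controlled kernel \<delta> F \<Longrightarrow> (\<integral>\<^sup>+v. ennreal (norm (F v) powr 2) \<partial>lborel) < \<infinity> \<Longrightarrow>
        (\<integral>\<^sup>+v. ennreal (norm (F v) powr 2) \<partial>lborel) \<le> ennreal A * (\<integral>\<^sup>+j. ennreal (norm (F (\<gamma> j)) powr 2) \<partial>count_space I)"
      and BF: "\<And>F. locally_controlled kernel \<delta> F \<Longrightarrow>
        (\<integral>\<^sup>+j. ennreal (norm (F (\<gamma> j)) powr 2) \<partial>count_space I) \<le> ennreal B * (\<integral>\<^sup>+v. ennreal (norm (F v) powr 2) \<partial>lborel)"
      by (rule sampling[OF p2 cI \<delta>'(1,2) rN cov overlap]) (rule that)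
    have pw: "x powr 2 = x\<^sup>2" if "x \<ge> 0" for x :: real using that by (simp add: powr_numeral)
    \<comment> \<open>By Moyal's identity the integral of the squared transform is the energy of the
      window times that of f; this puts \<open>energy\<close> into both frame bounds.\<close>
    have main: "ennreal (energy / A) * (Lp_norm 2 lborel f)\<^sup>2
          \<le> (\<Sum>i=1..N. \<Sum>\<^sub>\<infinity>z\<in>T. ennreal ((norm (L2_inner f (tf_shift z (tf_shift (w i) \<phi>))))\<^sup>2)) \<and>
        (\<Sum>i=1..N. \<Sum>\<^sub>\<infinity>z\<in>T. ennreal ((norm (L2_inner f (tf_shift z (tf_shift (w i) \<phi>))))\<^sup>2))
          \<le> ennreal (B * energy) * (Lp_norm 2 lborel f)\<^sup>2" if f: "f \<in> Lp_space 2 lborel" for f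
    proof -
      have m: "f \<in> borel_measurable borel" and fin: "(\<integral>\<^sup>+t. ennreal ((norm (f t))\<^sup>2) \<partial>lborel) < \<infinity>"
        using f unfolding Lp_space_2_iff by auto
      have i: "integrable lborel (\<lambda>t. (norm (f t))\<^sup>2)"
        using m fin by (intro integrableI_bounded) auto
      let ?F = "stft \<phi> (fun_distribution f)"
      have ctrlF: "locally_controlled kernel \<delta> ?F" by (intro ctrl tempered_fun_distribution m i)
      let ?n = "(Lp_norm 2 lborel f)\<^sup>2"
      have n: "?n = (\<integral>\<^sup>+t. ennreal ((norm (f t))\<^sup>2) \<partial>lborel)" by (rule Lp_norm_2_square[OF fin])
      have X: "(\<integral>\<^sup>+v. ennreal (norm (?F v) powr 2) \<partial>lborel) = ennreal energy * ?n"
        using moyal[OF m i schwartz_window] unfolding n energy_eq_nn_integral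
        by (simp add: stft_fun_distribution pw mult.commute)
      have S: "(\<integral>\<^sup>+j. ennreal (norm (?F (\<gamma> j)) powr 2) \<partial>count_space I)
         = (\<Sum>i=1..N. \<Sum>\<^sub>\<infinity>z\<in>T. ennreal ((norm (L2_inner f (tf_shift z (tf_shift (w i) \<phi>))))\<^sup>2))"
        unfolding I_def nn_integral_count_space_Times[OF cT]
        by (simp add: stft_fun_distribution pw \<gamma>_def norm_L2_inner_shifted_window)
      have Xfin: "ennreal energy * ?n < \<infinity>" using fin unfolding n by (simp add: ennreal_mult_less_top)
      have "ennreal (energy / A) * ?n = ennreal (1 / A) * (ennreal energy * ?n)"
        using A energy_pos by (simp add: mult.assoc[symmetric] ennreal_mult[symmetric])
      also have "\<dots> \<le> ennreal (1 / A) * (ennreal A * (\<integral>\<^sup>+j. ennreal (norm (?F (\<gamma> j)) powr 2) \<partial>count_space I))"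
        using AF[OF ctrlF] Xfin unfolding X by (intro mult_left_mono) auto
      also have "\<dots> = (\<integral>\<^sup>+j. ennreal (norm (?F (\<gamma> j)) powr 2) \<partial>count_space I)"
        using A by (simp add: mult.assoc[symmetric] ennreal_mult[symmetric])
      finally have 1: "ennreal (energy / A) * ?n \<le> (\<integral>\<^sup>+j. ennreal (norm (?F (\<gamma> j)) powr 2) \<partial>count_space I)" .
      have "(\<integral>\<^sup>+j. ennreal (norm (?F (\<gamma> j)) powr 2) \<partial>count_space I) \<le> ennreal B * (ennreal energy * ?n)"
        using BF[OF ctrlF] unfolding X .
      also have "\<dots> = ennreal (B * energy) * ?n" using B energy_pos by (simp add: mult.assoc[symmetric] ennreal_mult[symmetric])
      finally show ?thesis using 1 unfolding S by simp
    qed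
    show ?thesis
      unfolding multiwindow_gabor_frame_def
    proof (rule conjI, rule ballI, rule_tac [2] exI[of _ "energy / A"], rule_tac [2] conjI,
        rule_tac [3] exI[of _ "B * energy"], rule_tac [3] conjI, rule_tac [4] ballI, rule_tac [4] main)
      show "tf_shift (w i) \<phi> \<in> Lp_space 2 lborel" for i
        by (intro schwartz_Lp_space_2 schwartz_tf_shift schwartz_window)
      show "energy / A > 0" "B * energy > 0" using A B energy_pos by simp_all
    qed
  qed
qed

end

theorem theorem1:
  fixes \<Lambda> :: "((real ^ 'n) \<times> (real ^ 'n)) set"
    and \<phi> :: "real ^ 'n \<Rightarrow> complex"
  assumes "schwartz \<phi>" and "\<phi> \<noteq> (\<lambda>_. 0)"
    and "quasicrystal \<Lambda>"
    and "minimal_hull \<Lambda>" and "uniquely_ergodic_hull \<Lambda>"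
  shows "\<exists>(N::nat) (g :: nat \<Rightarrow> real ^ 'n \<Rightarrow> complex). \<forall>T\<in>delone_hull \<Lambda>.
           multiwindow_gabor_frame N g T \<and> (\<forall>p::ennreal. 1 \<le> p \<longrightarrow> Mp_frame \<phi> p N g T)"
proof -
  interpret schwartz_window \<phi> using assms(1,2) by unfold_locales
  obtain \<delta> where \<delta>: "\<delta> > 0" "\<And>u. tempered_distribution u \<Longrightarrow> locally_controlled kernel \<delta> (stft \<phi> u)"
    using stft_locally_controlled by blast
  have "delone \<Lambda>" using assms(3) by (simp add: quasicrystal_def)
  then obtain R where R: "R > 0" "\<And>T z. T \<in> delone_hull \<Lambda> \<Longrightarrow> \<exists>x\<in>T. dist z x < R"
    using hull_common_covering_radius by blast
  let ?C = "cball 0 R :: ((real ^ 'n) \<times> (real ^ 'n)) set"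
  have "?C \<subseteq> (\<Union>x\<in>?C. ball x \<delta>)" using \<delta>(1) by auto
  then obtain X where X: "finite X" "?C \<subseteq> (\<Union>x\<in>X. ball x \<delta>)"
    by (rule compactE_image[OF compact_cball open_ball]) (rule that)
  \<comment> \<open>A nonempty net ensures N > 0, which the overlap bound requires.\<close>
  have "0 \<in> ?C" using R(1) by simp
  then have "X \<noteq> {}" using X(2) by blast
  obtain w where w: "bij_betw w {1..card X} X" using ex_bij_betw_nat_finite_1[OF X(1)] by blast
  have N: "card X > 0" using X(1) \<open>X \<noteq> {}\<close> by (simp add: card_gt_0_iff)
  have "multiwindow_gabor_frame (card X) (\<lambda>i. tf_shift (w i) \<phi>) T \<and>
      (\<forall>p::ennreal. 1 \<le> p \<longrightarrow> Mp_frame \<phi> p (card X) (\<lambda>i. tf_shift (w i) \<phi>) T)" if T: "T \<in> delone_hull \<Lambda>" for T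
  proof -
    have ud: "uniformly_discrete T" using T by (simp add: delone_hull_def delone_def)
    have cover: "\<exists>i\<in>{1..card X}. \<exists>z\<in>T. dist v (z + w i) < \<delta>" for v
    proof -
      \<comment> \<open>A point of \<open>T\<close> reaches v up to an error in the R-ball, and the
        net approximates that error within \<delta>; the same net works for every
        \<open>T\<close>.\<close>
      obtain z where z: "z \<in> T" "dist v z < R" using R(2)[OF T] by blast
      have "v - z \<in> ?C" using z(2) by (simp add: dist_norm norm_minus_commute)
      then obtain x where x: "x \<in> X" "dist x (v - z) < \<delta>" using X(2) by auto
      have "x \<in> w ` {1..card X}" using x(1) unfolding bij_betw_imp_surj_on[OF w] .
      then obtain i where i: "i \<in> {1..card X}" "w i = x" by blast
      have "dist v (z + w i) < \<delta>" using x(2) i(2) by (simp add: dist_norm norm_minus_commute algebra_simps)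
      with i(1) z(1) show ?thesis by blast
    qed
    show ?thesis
      by (intro conjI allI impI frame_of_dense_shifts[OF \<delta> ud N cover])
  qed
  then show ?thesis by blast
qed

end
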